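(* Let $\Omega\subset\mathbb{R}^d$ be a bounded domain on which the classical Green function $G(\boldsymbol{x},\boldsymbol{y})$ of the Laplacian exists, and let $\mu$ be a finite positive Borel measure with $\operatorname{supp}(\mu)\subseteq\overline\Omega$ and $\mu(\Omega)>0$. Assume $\underline{\dim}_\infty(\mu)>d-2$. Then every eigenfunction of $\Delta_\mu$ is continuous on $\Omega$ (i.e. has a version continuous on $\Omega$). Moreover, if additionally $\Omega$ has Lipschitz boundary, then every eigenfunction is continuous on $\overline\Omega$.
   Context: The classical Green function of $\Omega$ is the Dirichlet Green function of $-\Delta$ on $\Omega$: $G(\boldsymbol{x},\boldsymbol{y})=\Phi(\boldsymbol{x}-\boldsymbol{y})+h(\boldsymbol{x},\boldsymbol{y})$, with $\Phi$ the fundamental solution of $-\Delta$ and $h$ symmetric, continuous and harmonic in each variable, so that $G(\boldsymbol{x},\cdot)$ is harmonic on $\Omega\setminus\{\boldsymbol{x}\}$ with zero boundary values. $\Omega$ has Lipschitz boundary if each boundary point has a ball neighborhood in which $\Omega$ coincides with the region above the graph of a Lipschitz function of $d-1$ variables (after a rotation). The lower $L^\infty$-dimension is $\underline{\dim}_\infty(\mu)=\liminf_{\delta\to0^+}\frac{\ln(\sup_{\boldsymbol{x}\in\operatorname{supp}\mu}\mu(B_\delta(\boldsymbol{x})))}{\ln\delta}$; when it exceeds $d-2$, (MPI) $\int_\Omega|u|^2d\mu\le C\int_\Omega|\nabla u|^2d\boldsymbol{x}$ for $u\in C_c^\infty(\Omega)$ holds. Under (MPI), each $u\in H_0^1(\Omega)$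 has an $L^2(\Omega,\mu)$-representative $\mathcal I(u)$ (the $L^2(\mu)$-limit of $C_c^\infty$ approximants in $H_0^1$); let $\mathcal N=\ker\mathcal I$ and $\mathcal N^\perp$ its orthogonal complement in $H_0^1(\Omega)$. $\Delta_\mu$ is defined by: $u\in\operatorname{Dom}(\Delta_\mu)$, $-\Delta_\mu u=f$ iff $u\in\mathcal N^\perp$, $f\in L^2(\Omega,\mu)$ and $\int_\Omega\nabla u\cdot\nabla\varphi\,d\boldsymbol{x}=\int_\Omega f\varphi\,d\mu$ for all $\varphi\in C_c^\infty(\Omega)$ ($-\Delta_\mu$ is the self-adjoint operator of the closed form $\int\nabla u\cdot\nabla v\,d\boldsymbol{x}$ on $\mathcal N^\perp\subset L^2(\Omega,\mu)$). An eigenfunction is a nonzero $u\in\operatorname{Dom}(\Delta_\mu)$ with $-\Delta_\mu u=\lambda u$. *)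

theory Defs
  imports "HOL-Analysis.Analysis"
begin

fun Ck_on :: "nat \<Rightarrow> 'a::euclidean_space set \<Rightarrow> ('a \<Rightarrow> real) \<Rightarrow> bool" where
  "Ck_on 0 S f = continuous_on S f"
| "Ck_on (Suc k) S f =
     (\<exists>g :: 'a \<Rightarrow> 'a. (\<forall>x\<in>S. (f has_derivative (\<lambda>v. g x \<bullet> v)) (at x)) \<and>
                       (\<forall>b\<in>Basis. Ck_on k S (\<lambda>x. g x \<bullet> b)))"

definition grad :: "('a::euclidean_space \<Rightarrow> real) \<Rightarrow> 'a \<Rightarrow> 'a" where
  "grad f x = (\<Sum>b\<in>Basis. frechet_derivative f (at x) b *\<^sub>R b)"

definition laplacian :: "('a::euclidean_space \<Rightarrow> real) \<Rightarrow> 'a \<Rightarrow> real" where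
  "laplacian f x = (\<Sum>b\<in>Basis. frechet_derivative (\<lambda>y. frechet_derivative f (at y) b) (at x) b)"

definition harmonic_on :: "'a::euclidean_space set \<Rightarrow> ('a \<Rightarrow> real) \<Rightarrow> bool" where
  "harmonic_on S f \<longleftrightarrow> open S \<and> Ck_on 2 S f \<and> (\<forall>x\<in>S. laplacian f x = 0)"

definition fund_sol :: "'a::euclidean_space \<Rightarrow> real" where
  "fund_sol x =
     (let d = real DIM('a) in
      if DIM('a) = 1 then - norm x / 2
      else if DIM('a) = 2 then - (1 / (2 * pi)) * ln (norm x)
      else norm x powr (2 - d) / (d * (d - 2) * measure lebesgue (ball (0::'a) 1)))"

definition classical_green :: "'a::euclidean_space set \<Rightarrow> ('a \<Rightarrow> 'a \<Rightarrow> real) \<Rightarrow> bool" where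
  "classical_green \<Omega> G \<longleftrightarrow>
     (\<exists>h. (\<forall>x\<in>\<Omega>. \<forall>y\<in>\<Omega>. x \<noteq> y \<longrightarrow> G x y = fund_sol (x - y) + h x y) \<and>
          (\<forall>x\<in>\<Omega>. \<forall>y\<in>\<Omega>. h x y = h y x) \<and>
          continuous_on (\<Omega> \<times> \<Omega>) (\<lambda>(x, y). h x y) \<and>
          (\<forall>x\<in>\<Omega>. harmonic_on \<Omega> (\<lambda>y. h x y)) \<and>
          (\<forall>y\<in>\<Omega>. harmonic_on \<Omega> (\<lambda>x. h x y)) \<and>
          (\<forall>x\<in>\<Omega>. \<forall>z\<in>frontier \<Omega>. ((\<lambda>y. G x y) \<longlongrightarrow> 0) (at z within \<Omega>)))"

definition has_classical_green :: "'a::euclidean_space set \<Rightarrow> bool" where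
  "has_classical_green \<Omega> \<longleftrightarrow> (\<exists>G. classical_green \<Omega> G)"

text \<open>Near every boundary point, \<Omega> is (after a rotation, i.e. for some unit "upward"
  direction e) the region above the graph of a Lipschitz function of the d-1 coordinates
  orthogonal to e.\<close>
definition lipschitz_boundary :: "'a::euclidean_space set \<Rightarrow> bool" where
  "lipschitz_boundary \<Omega> \<longleftrightarrow>
     (\<forall>z\<in>frontier \<Omega>. \<exists>r>0. \<exists>e::'a. \<exists>\<psi>::'a \<Rightarrow> real. \<exists>L.
        norm e = 1 \<and> L-lipschitz_on {y. y \<bullet> e = 0} \<psi> \<and>
        \<Omega> \<inter> ball z r = {x \<in> ball z r. x \<bullet> e > \<psi> (x - (x \<bullet> e) *\<^sub>R e)})"

definition msupp :: "'a::metric_space measure \<Rightarrow> 'a set" where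
  "msupp \<mu> = {x. \<forall>\<epsilon>>0. emeasure \<mu> (ball x \<epsilon>) > 0}"

definition lower_Linf_dim :: "'a::metric_space measure \<Rightarrow> ereal" where
  "lower_Linf_dim \<mu> =
     Liminf (at_right 0)
       (\<lambda>\<delta>::real. ereal (ln (SUP x\<in>msupp \<mu>. measure \<mu> (ball x \<delta>)) / ln \<delta>))"

definition test_fun :: "'a::euclidean_space set \<Rightarrow> ('a \<Rightarrow> real) \<Rightarrow> bool" where
  "test_fun \<Omega> \<phi> \<longleftrightarrow> (\<forall>k. Ck_on k UNIV \<phi>) \<and>
     compact (closure {x. \<phi> x \<noteq> 0}) \<and> closure {x. \<phi> x \<noteq> 0} \<subseteq> \<Omega>"

text \<open>H01_rep \<Omega> \<mu> u Du w: u is (a representative of) an element of H_0^1(\<Omega>) with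
  weak gradient Du, and w is (a representative of) its L^2(\<Omega>,\<mu>)-representative I(u): there is
  a sequence of test functions converging to u in H_0^1 (u in L^2(\<Omega>), gradients to Du in
  L^2(\<Omega>)) and to w in L^2(\<Omega>,\<mu>).\<close>
definition H01_rep :: "'a::euclidean_space set \<Rightarrow> 'a measure \<Rightarrow> ('a \<Rightarrow> real) \<Rightarrow> ('a \<Rightarrow> 'a)
    \<Rightarrow> ('a \<Rightarrow> real) \<Rightarrow> bool" where
  "H01_rep \<Omega> \<mu> u Du w \<longleftrightarrow>
     u \<in> borel_measurable lebesgue \<and> Du \<in> borel_measurable lebesgue \<and> w \<in> borel_measurable \<mu> \<and>
     (\<exists>\<phi>::nat \<Rightarrow> 'a \<Rightarrow> real. (\<forall>n. test_fun \<Omega> (\<phi> n)) \<and>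
        (\<lambda>n. \<integral>\<^sup>+x\<in>\<Omega>. ennreal ((\<phi> n x - u x)\<^sup>2) \<partial>lebesgue) \<longlonglongrightarrow> 0 \<and>
        (\<lambda>n. \<integral>\<^sup>+x\<in>\<Omega>. ennreal ((norm (grad (\<phi> n) x - Du x))\<^sup>2) \<partial>lebesgue) \<longlonglongrightarrow> 0 \<and>
        (\<lambda>n. \<integral>\<^sup>+x\<in>\<Omega>. ennreal ((\<phi> n x - w x)\<^sup>2) \<partial>\<mu>) \<longlonglongrightarrow> 0)"

text \<open>u (with weak gradient Du) lies in the orthogonal complement of N = ker I in H_0^1(\<Omega>),
  w.r.t. the Dirichlet inner product.\<close>
definition in_N_perp :: "'a::euclidean_space set \<Rightarrow> 'a measure \<Rightarrow> ('a \<Rightarrow> 'a) \<Rightarrow> bool" where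
  "in_N_perp \<Omega> \<mu> Du \<longleftrightarrow>
     (\<forall>v Dv wv. H01_rep \<Omega> \<mu> v Dv wv \<and> (AE x in \<mu>. x \<in> \<Omega> \<longrightarrow> wv x = 0) \<longrightarrow>
        (LINT x:\<Omega>|lebesgue. Du x \<bullet> Dv x) = 0)"

text \<open>u is an eigenfunction of \<Delta>_\<mu> with eigenvalue \<lambda>: u \<in> Dom(\<Delta>_\<mu>) (u \<in> N^\<perp>),
  -\<Delta>_\<mu> u = \<lambda> u (in L^2(\<Omega>,\<mu>)), and u \<noteq> 0.\<close>
definition eigenfunction :: "'a::euclidean_space set \<Rightarrow> 'a measure \<Rightarrow> ('a \<Rightarrow> real) \<Rightarrow> real \<Rightarrow> bool" where
  "eigenfunction \<Omega> \<mu> u lam \<longleftrightarrow>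
     (\<exists>Du w. H01_rep \<Omega> \<mu> u Du w \<and> in_N_perp \<Omega> \<mu> Du \<and>
        \<not> (AE x in \<mu>. x \<in> \<Omega> \<longrightarrow> w x = 0) \<and>
        (\<forall>\<phi>. test_fun \<Omega> \<phi> \<longrightarrow>
           (LINT x:\<Omega>|lebesgue. Du x \<bullet> grad \<phi> x) = (LINT x:\<Omega>|\<mu>. lam * w x * \<phi> x)))"

end

theory Submission
  imports Defs
begin

text \<open>
  Replace the fundamental solution near its pole by a second order Taylor polynomial in
  \<open>|x|\<^sup>2\<close>; the result \<open>\<Phi>\<^sub>t\<close> is \<open>C\<^sup>2\<close>, superharmonic, and \<open>-\<Delta>\<Phi>\<^sub>t = \<rho>\<^sub>t\<close> is an approximate
  identity. With \<open>g(x, y) = \<Phi>\<^sub>t(x - y) + h(x, y)\<close>, which is nonnegative and vanishes on the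
  boundary, smooth truncations of \<open>g(x, \<cdot>)\<close> have compact support and are admissible in the
  eigenvalue equation; removing the truncation gives
  \<open>\<integral> \<nabla>u \<cdot> \<nabla>g(x, \<cdot>) = \<lambda> \<integral> g(x, y) w(y) d\<mu>(y)\<close>, where \<open>w\<close> is the \<open>L\<^sup>2(\<mu>)\<close>-representative of \<open>u\<close>.
  The left side is the limit of the averages \<open>\<rho>\<^sub>t * \<phi>\<^sub>n\<close> of the approximating test functions.
  A duality estimate bounds \<open>\<parallel>c\<phi> - \<rho>\<^sub>t * \<phi>\<parallel>\<close> in \<open>L\<^sup>1(\<nu>)\<close> by \<open>\<parallel>\<nabla>\<phi>\<parallel>\<^sub>2\<close> times a factor vanishing with \<open>t\<close>,
  for every finite measure \<open>\<nu>\<close> whose balls have mass \<open>O(r\<^sup>Q)\<close> with \<open>Q > d - 2\<close>. Applied to \<open>\<mu>\<close> and to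
  Lebesgue measure, it identifies \<open>w\<close> (\<open>\<mu>\<close>-a.e.) and \<open>u\<close> (Lebesgue-a.e.) with the Green potential of \<open>\<lambda>w\<mu>\<close>.
  Since the near part of the Green kernel is a contraction, \<open>w\<close> is bounded; the potential of a bounded
  density is continuous on \<open>\<Omega>\<close> and tends to zero at the boundary, where the classical Green function vanishes.
\<close>


section \<open>Green's first identity\<close>

text \<open>The obstacle: \<open>u\<close> and \<open>w\<close> are limits of the same test
  functions for two measures that may be mutually singular, and neither has pointwise values. So a
  function is compared with its averages in L1 of an arbitrary measure of sufficient ball growth,
  not pointwise. The condition Q > d - 2 is exactly integrability at 0 of
  \<open>s powr (- d / 2) * sqrt s powr Q\<close>; the first factor is, up to a constant, the
  derivative of the fundamental solution in s = |x|^2, a variable in which all dimensions look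
  alike. The Taylor polynomial has order two so that everything is C2 and Green's identity for
  classical derivatives can replace distribution theory. The truncation can be removed because the
  energy of the truncated functions is bounded independently of the level. The price of smoothing is
  that g(x, .) has zero boundary values only when x is farther than sqrt t from the complement, so
  the estimates live on an exhaustion of the domain. The mass \<open>c\<close> of every \<rho>_t
  stays an abstract constant; it reappears as the factor in c w = potential.\<close>

definition C1_grad :: "'a::euclidean_space set \<Rightarrow> ('a \<Rightarrow> real) \<Rightarrow> ('a \<Rightarrow> 'a) \<Rightarrow> bool" where
  "C1_grad S f A \<longleftrightarrow>
     (\<forall>x\<in>S. (f has_derivative (\<lambda>v. A x \<bullet> v)) (at x)) \<and> continuous_on S A"

text \<open>Gradient and Laplacian are carried as explicit functions, so that sums and translates
  need no differentiability side conditions. \<open>H b\<close> is the gradient of the component of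
  \<open>A\<close> along \<open>b\<close>, and \<open>L\<close> is the trace. Since the trace
  equation stands under the quantifier over \<open>b\<close>, extracting it uses that
  \<open>Basis\<close> is nonempty.\<close>

definition C2_lap :: "'a::euclidean_space set \<Rightarrow> ('a \<Rightarrow> real) \<Rightarrow> ('a \<Rightarrow> 'a) \<Rightarrow> ('a \<Rightarrow> real) \<Rightarrow> bool" where
  "C2_lap S f A L \<longleftrightarrow>
     (\<forall>x\<in>S. (f has_derivative (\<lambda>v. A x \<bullet> v)) (at x)) \<and>
     (\<exists>H. \<forall>b\<in>Basis. C1_grad S (\<lambda>x. A x \<bullet> b) (H b) \<and> (\<forall>x\<in>S. L x = (\<Sum>b\<in>Basis. H b x \<bullet> b)))"

lemma C1_grad_continuous: "C1_grad S f A \<Longrightarrow> continuous_on S f"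
  unfolding C1_grad_def
  by (meson continuous_at_imp_continuous_on has_derivative_continuous)

lemma continuous_on_components:
  fixes A :: "'b::topological_space \<Rightarrow> 'a::euclidean_space"
  assumes "\<And>b. b \<in> Basis \<Longrightarrow> continuous_on S (\<lambda>x. A x \<bullet> b)"
  shows "continuous_on S A"
proof -
  have "continuous_on S (\<lambda>x. \<Sum>b\<in>Basis. (A x \<bullet> b) *\<^sub>R b)"
    by (intro continuous_intros assms)
  then show ?thesis by (simp add: euclidean_representation)
qed

lemma C2_lap_imp_C1_grad: "C2_lap S f A L \<Longrightarrow> C1_grad S f A"
  unfolding C2_lap_def C1_grad_def[of S f]
  by (blast intro: continuous_on_components C1_grad_continuous)

text \<open>No measurability is assumed: \<open>f\<close> and its translate are measurable together,
  and otherwise both Bochner integrals have the default value 0.\<close>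

lemma lborel_integral_shift:
  fixes f :: "'a::euclidean_space \<Rightarrow> 'b::{banach, second_countable_topology}"
  shows "integral\<^sup>L lborel (\<lambda>x. f (a + x)) = integral\<^sup>L lborel f"
proof -
  have "integral\<^sup>L lborel f = integral\<^sup>L (distr lborel borel ((+) a)) f"
    by (simp add: lborel_distr_plus)
  show ?thesis
  proof (cases "f \<in> borel_measurable borel")
    case True
    have "integral\<^sup>L (distr lborel borel ((+) a)) f = integral\<^sup>L lborel (\<lambda>x. f (a + x))"
      by (rule integral_distr) (use True in auto)
    then show ?thesis by (simp add: lborel_distr_plus)
  next
    case False
    have "(\<lambda>x. f (a + x)) \<notin> borel_measurable borel"
    proof
      assume "(\<lambda>x. f (a + x)) \<in> borel_measurable borel"
      then have "(\<lambda>x. f (a + (x - a))) \<in> borel_measurable borel"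
        by (rule measurable_compose[rotated]) simp
      then show False using False by simp
    qed
    then have "\<not> integrable lborel (\<lambda>x. f (a + x))" "\<not> integrable lborel f"
      using False by (auto dest: borel_measurable_integrable)
    then show ?thesis by (simp add: not_integrable_integral_eq)
  qed
qed

lemma continuous_compact_support_bounded:
  fixes f :: "'a::metric_space \<Rightarrow> 'b::real_normed_vector"
  assumes "continuous_on UNIV f" "compact K" "\<And>x. x \<notin> K \<Longrightarrow> f x = 0"
  obtains M where "M \<ge> 0" "\<And>x. norm (f x) \<le> M"
proof -
  have "compact (f ` K)"
    using assms by (meson compact_continuous_image continuous_on_subset top_greatest)
  then obtain M where M: "\<And>x. x \<in> K \<Longrightarrow> norm (f x) \<le> M"
    by (meson bounded_iff compact_imp_bounded image_eqI)
  have "norm (f x) \<le> max M 0" for x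
    using M[of x] assms(3)[of x] by (cases "x \<in> K") auto
  then show ?thesis by (intro that[of "max M 0"]) auto
qed

lemma integrable_continuous_compact_support:
  fixes f :: "'a::euclidean_space \<Rightarrow> 'b::{banach, second_countable_topology}"
  assumes "continuous_on K f" "compact K" "\<And>x. x \<notin> K \<Longrightarrow> f x = 0"
  shows "integrable lborel f"
proof -
  have "(\<lambda>x. indicator K x *\<^sub>R f x) = f"
    using assms(3) by (auto simp: indicator_def)
  then show ?thesis
    using borel_integrable_compact[OF assms(2,1)] by simp
qed

lemma grad_zero_off_support:
  fixes f :: "'a::euclidean_space \<Rightarrow> real"
  assumes "(f has_derivative (\<lambda>v. D \<bullet> v)) (at x)" "closed K" "\<And>x. x \<notin> K \<Longrightarrow> f x = 0" "x \<notin> K"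
  shows "D = 0"
proof -
  have "((\<lambda>x. 0) has_derivative (\<lambda>v. D \<bullet> v)) (at x)"
    by (rule has_derivative_transform_within_open[OF assms(1), of "-K"])
       (use assms in \<open>auto simp: open_Compl\<close>)
  then have "(\<lambda>v. D \<bullet> v) = (\<lambda>v. 0)"
    by (rule has_derivative_unique) (rule has_derivative_const)
  then have "D \<bullet> D = 0" by metis
  then show ?thesis by simp
qed

text \<open>Difference quotients along \<open>b\<close> integrate to zero by translation invariance
  and converge to the directional derivative; the mean value theorem supplies the dominating
  function.\<close>

lemma integral_partial_derivative_zero:
  fixes f :: "'a::euclidean_space \<Rightarrow> real"
  assumes f: "C1_grad UNIV f D" and K: "compact K" and off: "\<And>x. x \<notin> K \<Longrightarrow> f x = 0"
  shows "integral\<^sup>L lborel (\<lambda>x. D x \<bullet> b) = 0"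
proof -
  have cf: "continuous_on UNIV f" and cD: "continuous_on UNIV D"
    using f by (auto simp: C1_grad_def intro: C1_grad_continuous)
  have Doff: "D x = 0" if "x \<notin> K" for x
  proof -
    have "(f has_derivative (\<lambda>v. D x \<bullet> v)) (at x)" using f by (auto simp: C1_grad_def)
    from grad_zero_off_support[OF this compact_imp_closed[OF K] off that] show ?thesis .
  qed
  have contb: "continuous_on UNIV (\<lambda>x. D x \<bullet> b)" by (intro continuous_intros cD)
  obtain M where M: "M \<ge> 0" "\<And>x. norm (D x \<bullet> b) \<le> M"
    using continuous_compact_support_bounded[OF contb K] Doff by (metis inner_zero_left)
  obtain R where R: "K \<subseteq> ball 0 R" "R > 0"
    using bounded_subset_ballD[OF compact_imp_bounded[OF K]] by blast
  \<comment> \<open>The translations have length at most \<open>norm b\<close>, so this one ball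
    contains the supports of all difference quotients.\<close>
  define K' where "K' = cball (0::'a) (R + norm b)"
  have intf: "integrable lborel (\<lambda>x. f x)"
    by (rule integrable_continuous_compact_support[OF continuous_on_subset[OF cf] K off]) auto
  have intf': "integrable lborel (\<lambda>x. f (a + x))" for a
    by (rule integrable_continuous_compact_support[where K="(\<lambda>x. x - a) ` K"])
       (use off cf in \<open>auto intro!: compact_continuous_image continuous_intros K 
          continuous_on_compose2[OF cf] simp: image_iff algebra_simps\<close>)
  define s where "s n x = (f ((1 / real (Suc n)) *\<^sub>R b + x) - f x) * real (Suc n)" for n x
  have s0: "integral\<^sup>L lborel (s n) = 0" for n
    unfolding s_def using intf intf' by (simp add: lborel_integral_shift)
  have der: "(f has_derivative (\<lambda>v. D x \<bullet> v)) (at x)" for x using f by (auto simp: C1_grad_def)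
  have der1: "((\<lambda>t. f (t *\<^sub>R b + x)) has_real_derivative (D (t *\<^sub>R b + x) \<bullet> b)) (at t)" for x t
  proof -
    have "((\<lambda>t. f (t *\<^sub>R b + x)) has_derivative (\<lambda>h. D (t *\<^sub>R b + x) \<bullet> (h *\<^sub>R b))) (at t)"
      by (rule has_derivative_compose[OF _ der]) (auto intro!: derivative_eq_intros)
    then show ?thesis
      by (simp add: has_field_derivative_def mult.commute[of _ "_ \<bullet> _"])
  qed
  have sM: "norm (s n x) \<le> indicator K' x * M" for n x
  proof (cases "x \<in> K'")
    case True
    obtain z where "f ((1 / real (Suc n)) *\<^sub>R b + x) - f (0 *\<^sub>R b + x) = (1 / real (Suc n) - 0) * (D (z *\<^sub>R b + x) \<bullet> b)"
      using MVT2[of 0 "1 / real (Suc n)", OF _ der1] by auto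
    then have "s n x = D (z *\<^sub>R b + x) \<bullet> b" by (simp add: s_def)
    then show ?thesis using M True by simp
  next
    case False
    have "x \<notin> K" using False R by (auto simp: K'_def)
       (smt (verit, best) dist_norm mem_ball norm_ge_zero subsetD dist_0_norm)
    moreover have "(1 / real (Suc n)) *\<^sub>R b + x \<notin> K"
    proof
      assume "(1 / real (Suc n)) *\<^sub>R b + x \<in> K"
      then have "norm ((1 / real (Suc n)) *\<^sub>R b + x) < R" using R by auto
      moreover have "norm x \<le> norm ((1 / real (Suc n)) *\<^sub>R b + x) + norm ((1 / real (Suc n)) *\<^sub>R b)"
        by (metis add_diff_cancel_left' norm_triangle_ineq4)
      moreover have "norm ((1 / real (Suc n)) *\<^sub>R b) \<le> norm b"
        by (simp add: divide_le_eq mult_left_le field_simps)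
      ultimately show False using False by (simp add: K'_def)
    qed
    ultimately show ?thesis using off False by (simp add: s_def)
  qed
  have lim: "(\<lambda>n. s n x) \<longlonglongrightarrow> D x \<bullet> b" for x
  proof -
    have "((\<lambda>t. f (t *\<^sub>R b + x)) has_real_derivative (D x \<bullet> b)) (at 0)"
      using der1[of x 0] by simp
    then have "((\<lambda>t. (f (t *\<^sub>R b + x) - f x) / t) \<longlongrightarrow> D x \<bullet> b) (at 0)"
      by (simp add: has_field_derivative_iff)
    moreover have "filterlim (\<lambda>n. 1 / real (Suc n)) (at 0) sequentially"
      using LIMSEQ_inverse_real_of_nat by (simp add: filterlim_at inverse_eq_divide)
    ultimately show ?thesis unfolding s_def by (auto dest: filterlim_compose)
  qed
  have "(\<lambda>n. integral\<^sup>L lborel (s n)) \<longlonglongrightarrow> integral\<^sup>L lborel (\<lambda>x. D x \<bullet> b)"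
  proof (rule integral_dominated_convergence[where w="\<lambda>x. indicator K' x * M"])
    show "(\<lambda>x. D x \<bullet> b) \<in> borel_measurable lborel"
      using contb by (simp add: borel_measurable_continuous_onI)
    show "s i \<in> borel_measurable lborel" for i
      unfolding s_def
      by (intro borel_measurable_times borel_measurable_diff borel_measurable_const
           borel_measurable_integrable[OF intf] borel_measurable_integrable[OF intf'])
    show "integrable lborel (\<lambda>x. indicator K' x * M)"
      by (auto simp: K'_def intro!: integrable_real_indicator emeasure_lborel_cball_finite)
  qed (use lim sM in auto)
  then show ?thesis using s0 by (simp add: LIMSEQ_const_iff)
qed

text \<open>The function \<^term>\<open>f\<close> times a component of \<^term>\<open>A\<close>, extended by zero, is
  \<open>C\<^sup>1\<close> on the whole space; its partial derivatives integrate to zero.\<close>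
lemma green_first_identity:
  fixes f g :: "'a::euclidean_space \<Rightarrow> real"
  assumes g: "C2_lap S g A L" and S: "open S" and f: "C1_grad UNIV f B"
    and K: "compact K" "K \<subseteq> S" and off: "\<And>x. x \<notin> K \<Longrightarrow> f x = 0"
  shows "integrable lborel (\<lambda>x. B x \<bullet> A x)" "integrable lborel (\<lambda>x. f x * L x)"
    and "integral\<^sup>L lborel (\<lambda>x. B x \<bullet> A x) = - integral\<^sup>L lborel (\<lambda>x. f x * L x)"
proof -
  obtain H where H: "\<And>b. b \<in> Basis \<Longrightarrow> C1_grad S (\<lambda>x. A x \<bullet> b) (H b)"
    and L: "\<And>x. x \<in> S \<Longrightarrow> L x = (\<Sum>b\<in>Basis. H b x \<bullet> b)"
    using g unfolding C2_lap_def by (metis nonempty_Basis ex_in_conv)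
  have df: "(f has_derivative (\<lambda>v. B x \<bullet> v)) (at x)" for x using f by (auto simp: C1_grad_def)
  have cf: "continuous_on UNIV f" and cB: "continuous_on UNIV B"
    using f by (auto simp: C1_grad_def intro: C1_grad_continuous)
  have cA: "continuous_on S A" using C2_lap_imp_C1_grad[OF g] by (simp add: C1_grad_def)
  have cH: "continuous_on S (H b)" if "b \<in> Basis" for b using H[OF that] by (simp add: C1_grad_def)
  have Boff: "B x = 0" if "x \<notin> K" for x
    using grad_zero_off_support[OF df compact_imp_closed[OF K(1)] off that] .
  show i1: "integrable lborel (\<lambda>x. B x \<bullet> A x)"
    by (rule integrable_continuous_compact_support[OF _ K(1)])
       (use K(2) Boff in \<open>auto intro!: continuous_intros continuous_on_subset[OF cB] continuous_on_subset[OF cA]\<close>)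
  have cL: "continuous_on K L"
  proof -
    have "continuous_on K (\<lambda>x. \<Sum>b\<in>Basis. H b x \<bullet> b)"
      by (intro continuous_intros continuous_on_subset[OF cH K(2)])
    then show ?thesis using L K(2) by (subst continuous_on_cong[OF refl]) auto
  qed
  show i2: "integrable lborel (\<lambda>x. f x * L x)"
    by (rule integrable_continuous_compact_support[OF _ K(1)])
       (use off in \<open>auto intro!: continuous_intros continuous_on_subset[OF cf] cL\<close>)
  have partial: "integrable lborel (\<lambda>x. (B x \<bullet> b) * (A x \<bullet> b) + f x * (H b x \<bullet> b)) \<and>
    integral\<^sup>L lborel (\<lambda>x. (B x \<bullet> b) * (A x \<bullet> b) + f x * (H b x \<bullet> b)) = 0" if b: "b \<in> Basis" for b
  proof
    define D where "D x = (A x \<bullet> b) *\<^sub>R B x + f x *\<^sub>R H b x" for x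
    define F where "F x = f x * (A x \<bullet> b)" for x
    have Doff: "D x = 0" if "x \<notin> K" for x using that off Boff by (simp add: D_def)
    have op: "open (- K)" using K(1) by (simp add: compact_imp_closed open_Compl)
    \<comment> \<open>This open cover makes the product continuously differentiable everywhere: the
      product rule works on \<open>S\<close>, and all terms vanish on \<open>- K\<close>.\<close>
    have cov: "S \<union> - K = UNIV" using K(2) by auto
    have cDS: "continuous_on S D"
      unfolding D_def by (intro continuous_intros continuous_on_subset[OF cf] continuous_on_subset[OF cB] cH[OF b] cA) auto
    have "continuous_on (- K) D"
      using Doff by (subst continuous_on_cong[OF refl, of _ _ "\<lambda>x. 0"]) auto
    then have cD: "continuous_on UNIV D"
      using continuous_on_open_Un[OF S op cDS] cov by simp
    have dF: "(F has_derivative (\<lambda>v. D x \<bullet> v)) (at x)" for x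
    proof (cases "x \<in> S")
      case True
      have "((\<lambda>x. A x \<bullet> b) has_derivative (\<lambda>v. H b x \<bullet> v)) (at x)"
        using H[OF b] True by (simp add: C1_grad_def)
      from has_derivative_mult[OF df this] show ?thesis
        unfolding F_def by (rule has_derivative_eq_rhs) (auto simp: D_def inner_simps algebra_simps)
    next
      case False
      then have x: "x \<in> - K" using K(2) by auto
      have "((\<lambda>x. 0) has_derivative (\<lambda>v. D x \<bullet> v)) (at x)" using Doff x by simp
      then show ?thesis
        by (rule has_derivative_transform_within_open[OF _ op x]) (use off in \<open>auto simp: F_def\<close>)
    qed
    have "C1_grad UNIV F D" using dF cD by (simp add: C1_grad_def)
    then have "integral\<^sup>L lborel (\<lambda>x. D x \<bullet> b) = 0"
      by (rule integral_partial_derivative_zero[OF _ K(1)]) (use off in \<open>auto simp: F_def\<close>)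
    then show "integral\<^sup>L lborel (\<lambda>x. (B x \<bullet> b) * (A x \<bullet> b) + f x * (H b x \<bullet> b)) = 0"
      by (simp add: D_def inner_simps algebra_simps)
    have "integrable lborel (\<lambda>x. D x \<bullet> b)"
      by (rule integrable_continuous_compact_support[OF _ K(1)])
         (use Doff in \<open>auto intro!: continuous_intros continuous_on_subset[OF cD]\<close>)
    then show "integrable lborel (\<lambda>x. (B x \<bullet> b) * (A x \<bullet> b) + f x * (H b x \<bullet> b))"
      by (simp add: D_def inner_simps algebra_simps)
  qed
  have "integral\<^sup>L lborel (\<lambda>x. B x \<bullet> A x) + integral\<^sup>L lborel (\<lambda>x. f x * L x)
      = integral\<^sup>L lborel (\<lambda>x. B x \<bullet> A x + f x * L x)"
    using i1 i2 by simp
  also have "(\<lambda>x. B x \<bullet> A x + f x * L x) =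
     (\<lambda>x. \<Sum>b\<in>Basis. (B x \<bullet> b) * (A x \<bullet> b) + f x * (H b x \<bullet> b))"
  proof
    fix x
    show "B x \<bullet> A x + f x * L x = (\<Sum>b\<in>Basis. (B x \<bullet> b) * (A x \<bullet> b) + f x * (H b x \<bullet> b))"
    proof (cases "x \<in> K")
      case True
      have "f x * L x = (\<Sum>b\<in>Basis. f x * (H b x \<bullet> b))"
        using L[of x] K(2) True by (auto simp: sum_distrib_left)
      then show ?thesis unfolding sum.distrib by (simp only: euclidean_inner[of "B x" "A x"])
    next
      case False
      then show ?thesis using off[of x] Boff[of x] by simp
    qed
  qed
  also have "integral\<^sup>L lborel \<dots> = 0"
    using partial by simp
  finally show "integral\<^sup>L lborel (\<lambda>x. B x \<bullet> A x) = - integral\<^sup>L lborel (\<lambda>x. f x * L x)" by simp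
qed

section \<open>The minimum principle\<close>

lemma C1_grad_subset: "C1_grad S f A \<Longrightarrow> T \<subseteq> S \<Longrightarrow> C1_grad T f A"
  unfolding C1_grad_def by (meson continuous_on_subset subsetD)

lemma C2_lap_subset: "C2_lap S f A L \<Longrightarrow> T \<subseteq> S \<Longrightarrow> C2_lap T f A L"
  unfolding C2_lap_def by (meson C1_grad_subset subsetD)

lemma C1_grad_add:
  assumes "C1_grad S f A" "C1_grad S g B"
  shows "C1_grad S (\<lambda>x. f x + g x) (\<lambda>x. A x + B x)"
  using assms unfolding C1_grad_def
  by (auto simp: fun_eq_iff inner_add_left
      intro!: has_derivative_eq_rhs[OF has_derivative_add] continuous_on_add)

lemma C1_grad_cmult:
  assumes "C1_grad S f A"
  shows "C1_grad S (\<lambda>x. c * f x) (\<lambda>x. c *\<^sub>R A x)"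
  using assms unfolding C1_grad_def
  by (auto simp: fun_eq_iff intro!: has_derivative_eq_rhs[OF has_derivative_mult_right] continuous_intros)

lemma C1_grad_translate:
  assumes "C1_grad UNIV f A"
  shows "C1_grad UNIV (\<lambda>x. f (x - a)) (\<lambda>x. A (x - a))"
  unfolding C1_grad_def
proof (intro conjI ballI)
  fix x
  have "(f has_derivative (\<lambda>v. A (x - a) \<bullet> v)) (at (x - a))"
    using assms by (auto simp: C1_grad_def)
  moreover have "((\<lambda>x. x - a) has_derivative (\<lambda>v. v)) (at x)"
    by (auto intro!: derivative_eq_intros)
  ultimately show "((\<lambda>x. f (x - a)) has_derivative (\<bullet>) (A (x - a))) (at x)"
    using has_derivative_compose[of "\<lambda>x. x - a" "\<lambda>v. v" x UNIV f] by blast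
next
  show "continuous_on UNIV (\<lambda>x. A (x - a))"
    using assms by (auto simp: C1_grad_def intro!: continuous_on_compose2[of UNIV A] continuous_intros)
qed

lemma C2_lap_add:
  assumes "C2_lap S f A L" "C2_lap S g B M"
  shows "C2_lap S (\<lambda>x. f x + g x) (\<lambda>x. A x + B x) (\<lambda>x. L x + M x)"
proof -
  obtain H where H: "\<forall>b\<in>Basis. C1_grad S (\<lambda>x. A x \<bullet> b) (H b) \<and> (\<forall>x\<in>S. L x = (\<Sum>b\<in>Basis. H b x \<bullet> b))"
    using assms(1) unfolding C2_lap_def by blast
  obtain K where K: "\<forall>b\<in>Basis. C1_grad S (\<lambda>x. B x \<bullet> b) (K b) \<and> (\<forall>x\<in>S. M x = (\<Sum>b\<in>Basis. K b x \<bullet> b))"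
    using assms(2) unfolding C2_lap_def by blast
  have 1: "C1_grad S (\<lambda>x. (A x + B x) \<bullet> b) (\<lambda>x. H b x + K b x)" if "b \<in> Basis" for b
    unfolding inner_add_left using H K that by (intro C1_grad_add) auto
  have 2: "\<forall>x\<in>S. L x + M x = (\<Sum>b\<in>Basis. (H b x + K b x) \<bullet> b)"
    using H K SOME_Basis by (auto simp: inner_add_left sum.distrib)
  have "\<exists>H. \<forall>b\<in>Basis. C1_grad S (\<lambda>x. (A x + B x) \<bullet> b) (H b) \<and> (\<forall>x\<in>S. L x + M x = (\<Sum>b\<in>Basis. H b x \<bullet> b))"
    using 1 2 by (intro exI[of _ "\<lambda>b x. H b x + K b x"]) auto
  moreover have "\<forall>x\<in>S. ((\<lambda>x. f x + g x) has_derivative (\<bullet>) (A x + B x)) (at x)"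
    using C1_grad_add[OF C2_lap_imp_C1_grad[OF assms(1)] C2_lap_imp_C1_grad[OF assms(2)]]
    by (simp add: C1_grad_def)
  ultimately show ?thesis unfolding C2_lap_def by blast
qed

lemma C2_lap_cmult:
  assumes "C2_lap S f A L"
  shows "C2_lap S (\<lambda>x. c * f x) (\<lambda>x. c *\<^sub>R A x) (\<lambda>x. c * L x)"
proof -
  obtain H where H: "\<forall>b\<in>Basis. C1_grad S (\<lambda>x. A x \<bullet> b) (H b) \<and> (\<forall>x\<in>S. L x = (\<Sum>b\<in>Basis. H b x \<bullet> b))"
    using assms(1) unfolding C2_lap_def by blast
  have 1: "C1_grad S (\<lambda>x. (c *\<^sub>R A x) \<bullet> b) (\<lambda>x. c *\<^sub>R H b x)" if "b \<in> Basis" for b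
    unfolding inner_scaleR_left using H that by (intro C1_grad_cmult) auto
  have 2: "\<forall>x\<in>S. c * L x = (\<Sum>b\<in>Basis. (c *\<^sub>R H b x) \<bullet> b)"
    using H SOME_Basis by (auto simp: sum_distrib_left)
  have "\<exists>H. \<forall>b\<in>Basis. C1_grad S (\<lambda>x. (c *\<^sub>R A x) \<bullet> b) (H b) \<and> (\<forall>x\<in>S. c * L x = (\<Sum>b\<in>Basis. H b x \<bullet> b))"
    using 1 2 by (intro exI[of _ "\<lambda>b x. c *\<^sub>R H b x"]) auto
  moreover have "\<forall>x\<in>S. ((\<lambda>x. c * f x) has_derivative (\<bullet>) (c *\<^sub>R A x)) (at x)"
    using C1_grad_cmult[OF C2_lap_imp_C1_grad[OF assms(1)]]
    unfolding C1_grad_def by blast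
  ultimately show ?thesis unfolding C2_lap_def by blast
qed

lemma C2_lap_diff:
  assumes "C2_lap S f A L" "C2_lap S g B M"
  shows "C2_lap S (\<lambda>x. f x - g x) (\<lambda>x. A x - B x) (\<lambda>x. L x - M x)"
  using C2_lap_add[OF assms(1) C2_lap_cmult[OF assms(2), of "-1"]] by simp

lemma C2_lap_translate:
  assumes "C2_lap UNIV f A L"
  shows "C2_lap UNIV (\<lambda>x. f (x - a)) (\<lambda>x. A (x - a)) (\<lambda>x. L (x - a))"
proof -
  obtain H where H: "\<forall>b\<in>Basis. C1_grad UNIV (\<lambda>x. A x \<bullet> b) (H b) \<and> (\<forall>x\<in>UNIV. L x = (\<Sum>b\<in>Basis. H b x \<bullet> b))"
    using assms(1) unfolding C2_lap_def by blast
  have "C1_grad UNIV (\<lambda>x. A (x - a) \<bullet> b) (\<lambda>x. H b (x - a))" if "b \<in> Basis" for b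
    using H that by (intro C1_grad_translate[of "\<lambda>x. A x \<bullet> b"]) auto
  then have "\<exists>H. \<forall>b\<in>Basis. C1_grad UNIV (\<lambda>x. A (x - a) \<bullet> b) (H b) \<and> (\<forall>x\<in>UNIV. L (x - a) = (\<Sum>b\<in>Basis. H b x \<bullet> b))"
    using H by (intro exI[of _ "\<lambda>b x. H b (x - a)"]) auto
  moreover have "\<forall>x\<in>UNIV. ((\<lambda>x. f (x - a)) has_derivative (\<bullet>) (A (x - a))) (at x)"
    using C1_grad_translate[OF C2_lap_imp_C1_grad[OF assms(1)]]
    by (simp add: C1_grad_def)
  ultimately show ?thesis unfolding C2_lap_def by blast
qed

lemma integral_laplacian_zero:
  assumes "C2_lap UNIV f A L" "compact K" "\<And>x. x \<notin> K \<Longrightarrow> f x = 0"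
  shows "integral\<^sup>L lborel L = 0"
proof -
  obtain H where H: "\<And>b. b \<in> Basis \<Longrightarrow> C1_grad UNIV (\<lambda>x. A x \<bullet> b) (H b)"
    and L: "\<And>x. L x = (\<Sum>b\<in>Basis. H b x \<bullet> b)"
    using assms(1) unfolding C2_lap_def by (metis SOME_Basis UNIV_I)
  have Aoff: "A x = 0" if "x \<notin> K" for x
    using assms(1) grad_zero_off_support[OF _ compact_imp_closed[OF assms(2)] _ that, of f "A x"] assms(3)
    by (auto simp: C2_lap_def)
  have Hoff: "H b x = 0" if "x \<notin> K" "b \<in> Basis" for b x
    using H[OF that(2)] grad_zero_off_support[OF _ compact_imp_closed[OF assms(2)] _ that(1), of "\<lambda>x. A x \<bullet> b" "H b x"] Aoff
    by (auto simp: C1_grad_def)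
  have i: "integrable lborel (\<lambda>x. H b x \<bullet> b)" if "b \<in> Basis" for b
    by (rule integrable_continuous_compact_support[OF _ assms(2)])
       (use H[OF that] Hoff that in \<open>auto simp: C1_grad_def intro!: continuous_intros intro: continuous_on_subset\<close>)
  have "integral\<^sup>L lborel L = (\<Sum>b\<in>Basis. integral\<^sup>L lborel (\<lambda>x. H b x \<bullet> b))"
    unfolding L[abs_def] using i by simp
  also have "\<dots> = 0"
    by (rule sum.neutral) (use integral_partial_derivative_zero[OF H assms(2)] Aoff in auto)
  finally show ?thesis .
qed

text \<open>The boundary condition gives every frontier point a neighbourhood that misses the set,
  so the set is closed in the whole space and not merely relative to \<open>S\<close>.\<close>

lemma compact_superlevel:
  fixes f :: "'a::euclidean_space \<Rightarrow> real"
  assumes "open S" "bounded S" "continuous_on S f"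
    and bd: "\<And>z. z \<in> frontier S \<Longrightarrow> \<forall>\<^sub>F y in at z within S. f y < a"
  shows "compact {y \<in> S. a \<le> f y}"
proof -
  have "open (- {y \<in> S. a \<le> f y})"
    unfolding open_contains_ball
  proof
    fix z assume z: "z \<in> - {y \<in> S. a \<le> f y}"
    consider "z \<in> S" "f z < a" | "z \<in> frontier S" "z \<notin> S" | "z \<notin> closure S"
      using z assms(1) by (cases "z \<in> S"; cases "z \<in> closure S") (auto simp: frontier_def interior_open)
    then show "\<exists>e>0. ball z e \<subseteq> - {y \<in> S. a \<le> f y}"
    proof cases
      case 1
      have "open {y \<in> S. f y < a}"
      proof -
        have "open (S \<inter> f -` {..<a})"
          by (rule continuous_open_preimage[OF assms(3,1) open_lessThan])
        moreover have "S \<inter> f -` {..<a} = {y \<in> S. f y < a}" by auto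
        ultimately show ?thesis by simp
      qed
      then obtain e where "e > 0" "ball z e \<subseteq> {y \<in> S. f y < a}"
        using 1 by (auto elim!: openE)
      then show ?thesis by (intro exI[of _ e]) force
    next
      case 2
      obtain e where e: "e > 0" "\<And>y. y \<in> S \<Longrightarrow> y \<noteq> z \<Longrightarrow> dist y z < e \<Longrightarrow> f y < a"
        using bd[OF 2(1)] unfolding eventually_at by blast
      show ?thesis using e 2 by (intro exI[of _ e]) (force simp: dist_commute)
    next
      case 3
      then obtain e where "e > 0" "ball z e \<subseteq> - closure S"
        using open_contains_ball[of "- closure S"] by auto
      then show ?thesis using closure_subset[of S] by (intro exI[of _ e]) blast
    qed
  qed
  then have "closed {y \<in> S. a \<le> f y}" by (simp add: closed_def)
  moreover have "bounded {y \<in> S. a \<le> f y}" using assms(2) by (rule bounded_subset) auto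
  ultimately show ?thesis by (simp add: compact_eq_bounded_closed)
qed

text \<open>Second derivative test along a line: were the second derivative negative, the first
  would be negative just to the right of the minimum, and the mean value theorem would produce a
  smaller value.\<close>

lemma second_partial_nonneg_at_minimum:
  fixes f :: "'a::euclidean_space \<Rightarrow> real"
  assumes S: "open S" "x \<in> S" and min: "\<And>y. y \<in> S \<Longrightarrow> f x \<le> f y"
    and f: "C1_grad S f A" and A: "C1_grad S (\<lambda>y. A y \<bullet> b) H"
  shows "0 \<le> H x \<bullet> b"
proof (rule ccontr)
  assume "\<not> 0 \<le> H x \<bullet> b"
  then have neg: "H x \<bullet> b < 0" by simp
  define line where "line t = x + t *\<^sub>R b" for t :: real
  have dl: "(line has_derivative (\<lambda>h. h *\<^sub>R b)) (at t)" for t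
    unfolding line_def by (auto intro!: derivative_eq_intros)
  have comp: "((\<lambda>t. F (line t)) has_real_derivative (D \<bullet> b)) (at t)"
    if "(F has_derivative (\<lambda>v. D \<bullet> v)) (at (line t))" for F D t
    using has_derivative_compose[OF dl that]
    by (simp add: has_field_derivative_def mult.commute[of _ "_ \<bullet> _"])
  have d1: "((\<lambda>t. f (line t)) has_real_derivative (A (line t) \<bullet> b)) (at t)" if "line t \<in> S" for t
    by (rule comp) (use f that in \<open>simp add: C1_grad_def\<close>)
  have d2: "((\<lambda>t. A (line t) \<bullet> b) has_real_derivative (H (line t) \<bullet> b)) (at t)" if "line t \<in> S" for t
    by (rule comp[of "\<lambda>y. A y \<bullet> b"]) (use A that in \<open>simp add: C1_grad_def\<close>)
  have l0: "line 0 = x" by (simp add: line_def)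
  have "continuous (at 0) line" using dl has_derivative_continuous by blast
  then have "\<forall>\<^sub>F t in at 0. line t \<in> S"
    using S l0 by (metis continuous_within tendsto_def topological_tendstoD)
  then obtain e where e: "e > 0" and eS: "\<And>t. \<bar>t\<bar> < e \<Longrightarrow> line t \<in> S"
    unfolding eventually_at by (metis S(2) dist_real_def diff_0_right iso_tuple_UNIV_I l0)
  have zero: "A x \<bullet> b = 0"
    using DERIV_local_min[OF d1 e] min eS l0 S(2) by (metis diff_0 abs_minus_cancel)
  obtain r where r: "r > 0" "\<And>h. 0 < h \<Longrightarrow> h < r \<Longrightarrow> A (line (0 + h)) \<bullet> b < A (line 0) \<bullet> b"
    using DERIV_neg_dec_right[OF d2[of 0]] neg l0 S(2) by auto
  define k where "k = min r e / 2"
  have k: "0 < k" "k < r" "k < e" using r(1) e by (auto simp: k_def min_def)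
  obtain z where z: "0 < z" "z < k" "f (line k) - f (line 0) = (k - 0) * (A (line z) \<bullet> b)"
    using MVT2[of 0 k "\<lambda>t. f (line t)" "\<lambda>t. A (line t) \<bullet> b"] d1 eS k by force
  have "A (line z) \<bullet> b < 0" using r(2)[of z] z k zero l0 by simp
  then have "f (line k) < f x" using z k l0 by (smt (verit) mult_pos_neg)
  then show False using min[of "line k"] eS[of k] k by auto
qed

lemma C2_lap_norm_squared:
  "C2_lap UNIV (\<lambda>x::'a::euclidean_space. x \<bullet> x) (\<lambda>x. 2 *\<^sub>R x) (\<lambda>x. 2 * real DIM('a))"
proof -
  have "((\<lambda>x. x \<bullet> x) has_derivative (\<lambda>v. 2 *\<^sub>R x \<bullet> v)) (at x)" for x :: 'a
    by (rule has_derivative_eq_rhs[OF has_derivative_inner[OF has_derivative_ident has_derivative_ident]])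
       (simp add: fun_eq_iff inner_commute)
  moreover have "C1_grad UNIV (\<lambda>x::'a. 2 *\<^sub>R x \<bullet> b) (\<lambda>x. 2 *\<^sub>R b)" for b
    unfolding C1_grad_def by (auto intro!: derivative_eq_intros simp: inner_commute)
  ultimately show ?thesis
    unfolding C2_lap_def
    by (intro conjI ballI exI[of _ "\<lambda>b x. 2 *\<^sub>R b"]) (blast | simp add: inner_same_Basis)+
qed

text \<open>Subtracting a small multiple of |y|^2 makes the Laplacian strictly negative, whereas at
  an interior minimum every pure second derivative is nonnegative. The boundary hypothesis only
  bounds the lower limit, so no continuity up to the frontier is required.\<close>

lemma superharmonic_nonneg:
  fixes v :: "'a::euclidean_space \<Rightarrow> real"
  assumes v: "C2_lap S v A L" and S: "open S" "bounded S" and L: "\<And>x. x \<in> S \<Longrightarrow> L x \<le> 0"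
    and bd: "\<And>z e. z \<in> frontier S \<Longrightarrow> e > 0 \<Longrightarrow> \<forall>\<^sub>F y in at z within S. - e < v y"
    and x: "x \<in> S"
  shows "0 \<le> v x"
proof (rule ccontr)
  assume "\<not> 0 \<le> v x"
  define \<beta> where "\<beta> = - v x"
  have \<beta>: "\<beta> > 0" using \<open>\<not> 0 \<le> v x\<close> by (simp add: \<beta>_def)
  obtain R where R: "R > 0" "\<And>y. y \<in> S \<Longrightarrow> norm y \<le> R" using S(2) bounded_pos by blast
  \<comment> \<open>Chosen so that the perturbation is at most \<open>\<beta> / 2\<close> on
    \<open>S\<close>: near the frontier the perturbed function then stays above
    \<open>- \<beta>\<close>, while at \<open>x\<close> it is at most
    \<open>- \<beta>\<close>.\<close>
  define \<eta> where "\<eta> = \<beta> / (2 * R\<^sup>2)"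
  have \<eta>: "\<eta> > 0" using \<beta> R by (simp add: \<eta>_def)
  have small: "\<eta> * (y \<bullet> y) \<le> \<beta> / 2" if "y \<in> S" for y
  proof -
    have "y \<bullet> y \<le> R\<^sup>2" using R(2)[OF that] by (metis dot_square_norm norm_ge_zero power_mono)
    then have "\<eta> * (y \<bullet> y) \<le> \<eta> * R\<^sup>2" using \<eta> by simp
    then show ?thesis using R by (simp add: \<eta>_def)
  qed
  define m where "m y = v y - \<eta> * (y \<bullet> y)" for y
  have m: "C2_lap S m (\<lambda>y. A y - \<eta> *\<^sub>R 2 *\<^sub>R y) (\<lambda>y. L y - \<eta> * (2 * real DIM('a)))"
    unfolding m_def
    by (intro C2_lap_diff[OF v] C2_lap_subset[OF C2_lap_cmult[OF C2_lap_norm_squared]]) simp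
  have cm: "continuous_on S (\<lambda>y. - m y)"
    using C1_grad_continuous[OF C2_lap_imp_C1_grad[OF m]] by (intro continuous_intros)
  define K where "K = {y \<in> S. \<beta> \<le> - m y}"
  have "compact K" unfolding K_def
  proof (rule compact_superlevel[OF S cm])
    fix z assume z: "z \<in> frontier S"
    have "\<forall>\<^sub>F y in at z within S. - (\<beta> / 2) < v y" using bd[OF z] \<beta> by simp
    moreover have "\<forall>\<^sub>F y in at z within S. y \<in> S" by (simp add: eventually_at_filter)
    ultimately show "\<forall>\<^sub>F y in at z within S. - m y < \<beta>"
    proof eventually_elim
      case (elim y)
      then show ?case using small[of y] by (simp add: m_def)
    qed
  qed
  moreover have xK: "x \<in> K" using x \<eta> by (simp add: K_def m_def \<beta>_def)
  moreover have "continuous_on K m"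
    using C1_grad_continuous[OF C2_lap_imp_C1_grad[OF m]] by (rule continuous_on_subset) (auto simp: K_def)
  ultimately obtain y where y: "y \<in> K" "\<And>u. u \<in> K \<Longrightarrow> m y \<le> m u"
    using continuous_attains_inf[of K m] by auto
  have yS: "y \<in> S" using y by (simp add: K_def)
  \<comment> \<open>Outside \<open>K\<close> the values exceed \<open>- \<beta>\<close>, and the
    value at \<open>y\<close> does not, so the minimum over \<open>K\<close> is a minimum over
    \<open>S\<close>.\<close>
  have min: "m y \<le> m u" if "u \<in> S" for u
    using y(2)[of u] y(1) that by (cases "u \<in> K") (auto simp: K_def)
  obtain H where H: "\<And>b. b \<in> Basis \<Longrightarrow> C1_grad S (\<lambda>x. (A x - \<eta> *\<^sub>R 2 *\<^sub>R x) \<bullet> b) (H b)"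
    and LH: "\<And>x. x \<in> S \<Longrightarrow> L x - \<eta> * (2 * real DIM('a)) = (\<Sum>b\<in>Basis. H b x \<bullet> b)"
    using m SOME_Basis unfolding C2_lap_def by blast
  have "0 \<le> (\<Sum>b\<in>Basis. H b y \<bullet> b)"
    by (intro sum_nonneg second_partial_nonneg_at_minimum[OF S(1) yS min C2_lap_imp_C1_grad[OF m] H]) auto
  then have "\<eta> * (2 * real DIM('a)) \<le> 0" using LH[OF yS] L[OF yS] by simp
  then show False using \<eta> by (simp add: mult_le_0_iff)
qed

section \<open>Smoothed fundamental solutions\<close>

text \<open>As a function of the squared norm the fundamental solution has a derivative of the same
  form in the square root, logarithmic and power cases. From here on the dimension appears only as
  an exponent.\<close>

lemma fund_sol_radial_profile:
  obtains p \<kappa> where "\<kappa> > 0"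
    and "\<And>s. s > 0 \<Longrightarrow> (p has_real_derivative - (\<kappa> * s powr (- real DIM('a) / 2))) (at s)"
    and "\<And>x::'a::euclidean_space. x \<noteq> 0 \<Longrightarrow> fund_sol x = p (x \<bullet> x)"
proof -
  define d where "d = real DIM('a)"
  consider "DIM('a) = 1" | "DIM('a) = 2" | "DIM('a) \<ge> 3"
    using DIM_positive[where 'a='a] by linarith
  then show ?thesis
  proof cases
    case 1
    show ?thesis
    proof (rule that[of "1/4" "\<lambda>s. - sqrt s / 2"])
      show "((\<lambda>s. - sqrt s / 2) has_real_derivative - (1/4 * s powr (- real DIM('a) / 2))) (at s)" if "s > 0" for s
        using that 1 by (auto intro!: derivative_eq_intros simp: powr_minus powr_half_sqrt field_simps)
      show "fund_sol x = - sqrt (x \<bullet> x) / 2" if "x \<noteq> 0" for x :: 'a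
        using 1 by (simp add: fund_sol_def norm_eq_sqrt_inner)
    qed simp
  next
    case 2
    show ?thesis
    proof (rule that[of "1 / (4 * pi)" "\<lambda>s. - (1 / (4 * pi)) * ln s"])
      show "((\<lambda>s. - (1 / (4 * pi)) * ln s) has_real_derivative - (1 / (4 * pi) * s powr (- real DIM('a) / 2))) (at s)" if "s > 0" for s
        using that 2 by (auto intro!: derivative_eq_intros simp: powr_minus field_simps)
      show "fund_sol x = - (1 / (4 * pi)) * ln (x \<bullet> x)" if "x \<noteq> 0" for x :: 'a
        using 2 that by (simp add: fund_sol_def norm_eq_sqrt_inner ln_sqrt)
    qed simp
  next
    case 3
    define \<omega> where "\<omega> = measure lebesgue (ball (0::'a) 1)"
    have \<omega>: "\<omega> > 0"
      unfolding \<omega>_def by (simp add: content_ball_pos)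
    have d: "d \<ge> 3" using 3 by (simp add: d_def)
    show ?thesis
    proof (rule that[of "1 / (2 * d * \<omega>)" "\<lambda>s. s powr ((2 - d) / 2) / (d * (d - 2) * \<omega>)"])
      show "((\<lambda>s. s powr ((2 - d) / 2) / (d * (d - 2) * \<omega>)) has_real_derivative
          - (1 / (2 * d * \<omega>) * s powr (- real DIM('a) / 2))) (at s)" if "s > 0" for s
      proof -
        have e: "(2 - d) / 2 - 1 = - d / 2" by (simp add: field_simps)
        have "((\<lambda>s. s powr ((2 - d) / 2) / (d * (d - 2) * \<omega>)) has_real_derivative
            (2 - d) / 2 * s powr (- d / 2) / (d * (d - 2) * \<omega>)) (at s)"
          using DERIV_cdivide[OF has_real_derivative_powr[OF that, of "(2 - d) / 2"], of "d * (d - 2) * \<omega>"]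
          unfolding e .
        moreover have "(2 - d) / 2 * s powr (- d / 2) / (d * (d - 2) * \<omega>) = - (1 / (2 * d * \<omega>) * s powr (- d / 2))"
          using d \<omega> by (simp add: divide_simps) (simp add: algebra_simps)
        ultimately show ?thesis by (simp add: d_def)
      qed
      show "fund_sol x = (x \<bullet> x) powr ((2 - d) / 2) / (d * (d - 2) * \<omega>)" if "x \<noteq> 0" for x :: 'a
      proof -
        have "(x \<bullet> x) powr ((2 - d) / 2) = (norm x powr 2) powr ((2 - d) / 2)"
          using that by (simp add: dot_square_norm)
        also have "\<dots> = norm x powr (2 - d)" 
        proof -
          have "2 * ((2 - d) / 2) = 2 - d" by simp
          then show ?thesis unfolding powr_powr by (simp only:)
        qed
        finally show ?thesis using 3 by (simp add: fund_sol_def Let_def d_def \<omega>_def)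
      qed
    qed (use d \<omega> in simp)
  qed
qed

text \<open>Each branch needs a derivative only on its own closed side of \<open>t\<close>. This
  matters because the outer branch may be singular at 0.\<close>

lemma has_real_derivative_If:
  fixes f g :: "real \<Rightarrow> real"
  assumes "t \<le> s \<Longrightarrow> (f has_real_derivative f' s) (at s)" "s \<le> t \<Longrightarrow> (g has_real_derivative g' s) (at s)"
    and "f t = g t" "f' t = g' t"
  shows "((\<lambda>s. if t \<le> s then f s else g s) has_real_derivative (if t \<le> s then f' s else g' s)) (at s)"
proof -
  have cl: "closure {t..} \<inter> closure {..<t} = {t}" by auto
  have "((\<lambda>x. if x \<in> {t..} then f x else g x) has_derivative
      (if s \<in> {t..} then (*) (f' s) else (*) (g' s))) (at s within ({t..} \<union> {..<t}))"
    by (rule has_derivative_If_within_closures[where f'="\<lambda>x. (*) (f' x)" and g'="\<lambda>x. (*) (g' x)"])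
       (use assms in \<open>auto simp: has_field_derivative_def intro: has_derivative_at_withinI\<close>)
  moreover have "{t..} \<union> {..<t} = (UNIV::real set)" by auto
  ultimately show ?thesis by (auto simp: has_field_derivative_def split: if_splits)
qed

text \<open>The real parameters do not determine the space; \<open>space_type\<close> ties them to
  the type \<open>'a\<close> whose dimension is \<open>d\<close>.\<close>

locale radial_profile =
  fixes p :: "real \<Rightarrow> real" and \<kappa> d :: real and space_type :: "'a::euclidean_space itself"
  assumes \<kappa>_pos: "\<kappa> > 0" and d_DIM: "d = real DIM('a)"
    and p_deriv: "s > 0 \<Longrightarrow> (p has_real_derivative - (\<kappa> * s powr (- d / 2))) (at s)"
begin

definition q :: "real \<Rightarrow> real" where "q s = \<kappa> * s powr (- d / 2)"

text \<open>Minus the derivative of \<open>q\<close>, just as \<open>q\<close> is minus the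
  derivative of \<open>p\<close>, so that both are nonnegative.\<close>

definition q' :: "real \<Rightarrow> real" where "q' s = \<kappa> * d / 2 * s powr (- d / 2 - 1)"

text \<open>Below level \<^term>\<open>t\<close> the profile is replaced by its second order Taylor polynomial
  at \<^term>\<open>t\<close>, which makes the radial function \<open>C\<^sup>2\<close> at the origin and keeps it superharmonic.\<close>
definition smooth_profile :: "real \<Rightarrow> real \<Rightarrow> real" where
  "smooth_profile t s = (if t \<le> s then p s else p t - q t * (s - t) + q' t / 2 * (s - t)\<^sup>2)"

definition smooth_profile' :: "real \<Rightarrow> real \<Rightarrow> real" where
  "smooth_profile' t s = (if t \<le> s then - q s else - q t + q' t * (s - t))"

definition Phi :: "real \<Rightarrow> 'a \<Rightarrow> real" where "Phi t z = smooth_profile t (z \<bullet> z)"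

definition gradPhi :: "real \<Rightarrow> 'a \<Rightarrow> 'a" where "gradPhi t z = (2 * smooth_profile' t (z \<bullet> z)) *\<^sub>R z"

text \<open>Minus the Laplacian of \<open>Phi t\<close>. For the Taylor polynomial P at s = |z|^2 <
  t, the expression 4 s P'' + 2 d P' is linear in s and vanishes at s = t; the constant \<kappa> d
  (d + 2) is the sum of the contributions 2 d and d^2.\<close>

definition rho :: "real \<Rightarrow> 'a \<Rightarrow> real" where
  "rho t z = \<kappa> * d * (d + 2) * t powr (- d / 2 - 1) * max 0 (t - z \<bullet> z)"

lemma d_ge_1: "d \<ge> 1" using DIM_positive[where 'a='a] unfolding d_DIM by linarith

lemma q_nonneg: "q s \<ge> 0" by (simp add: q_def \<kappa>_pos less_imp_le)
lemma q'_nonneg: "q' s \<ge> 0" using d_ge_1 by (simp add: q'_def \<kappa>_pos less_imp_le)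

lemma q_deriv: "s > 0 \<Longrightarrow> (q has_real_derivative - q' s) (at s)"
  unfolding q_def[abs_def] q'_def
  by (auto intro!: derivative_eq_intros simp: field_simps)

lemma smooth_profile_deriv: assumes "t > 0" shows "(smooth_profile t has_real_derivative smooth_profile' t s) (at s)"
  unfolding smooth_profile_def[abs_def] smooth_profile'_def
  by (rule has_real_derivative_If[where f'="\<lambda>s. - q s" and g'="\<lambda>s. - q t + q' t * (s - t)"])
     (use assms p_deriv in \<open>auto simp: q_def intro!: derivative_eq_intros\<close>)

lemma smooth_profile'_deriv: assumes "t > 0" shows "(smooth_profile' t has_real_derivative q' (max s t)) (at s)"
proof -
  have "(smooth_profile' t has_real_derivative (if t \<le> s then q' s else q' t)) (at s)"
    unfolding smooth_profile'_def[abs_def]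
    by (rule has_real_derivative_If[where f'=q' and g'="\<lambda>s. q' t"])
       (use assms in \<open>auto intro!: derivative_eq_intros q_deriv\<close>)
  moreover have "(if t \<le> s then q' s else q' t) = q' (max s t)" by (auto simp: max_def)
  ultimately show ?thesis by simp
qed

text \<open>A radial function F(|z|^2) has Laplacian 4 s F'' + 2 d F' with s = |z|^2. Above level
  \<open>t\<close> this vanishes because \<open>q' s * s = d / 2 * q s\<close>; below, it is the
  linear expression in the definition of \<open>rho\<close>.\<close>

lemma Phi_C2: assumes t: "t > 0" shows "C2_lap UNIV (Phi t) (gradPhi t) (\<lambda>z. - rho t z)"
proof -
  have dn: "((\<lambda>z::'a. z \<bullet> z) has_derivative (\<lambda>v. 2 * (z \<bullet> v))) (at z)" for z
    by (rule has_derivative_eq_rhs[OF has_derivative_inner[OF has_derivative_ident has_derivative_ident]])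
       (simp add: fun_eq_iff inner_commute)
  have chain: "((\<lambda>z::'a. F (z \<bullet> z)) has_derivative (\<lambda>v. D * (2 * (z \<bullet> v)))) (at z)"
    if "(F has_real_derivative D) (at (z \<bullet> z))" for F D z
    using has_derivative_compose[OF dn that[unfolded has_field_derivative_def]] .
  have 1: "(Phi t has_derivative (\<bullet>) (gradPhi t z)) (at z)" for z
    unfolding Phi_def[abs_def] gradPhi_def
    by (rule has_derivative_eq_rhs[OF chain[OF smooth_profile_deriv[OF t]]]) (simp add: fun_eq_iff)
  define H where "H b z = (4 * q' (max (z \<bullet> z) t) * (z \<bullet> b)) *\<^sub>R z + (2 * smooth_profile' t (z \<bullet> z)) *\<^sub>R b" for b z :: 'a
  have cpt': "continuous_on UNIV (smooth_profile' t)"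
    using smooth_profile'_deriv[OF t] by (meson DERIV_isCont continuous_at_imp_continuous_on)
  have cq': "continuous_on {t..} q'"
    unfolding q'_def[abs_def] using t by (auto intro!: continuous_intros)
  have 2: "C1_grad UNIV (\<lambda>z. gradPhi t z \<bullet> b) (H b)" for b
    unfolding C1_grad_def
  proof (intro conjI ballI)
    fix z
    have "((\<lambda>z. z \<bullet> b) has_derivative (\<lambda>v. v \<bullet> b)) (at z)"
      by (auto intro!: derivative_eq_intros)
    from has_derivative_mult[OF has_derivative_mult_right[OF chain[OF smooth_profile'_deriv[OF t]], of 2 z] this]
    show "((\<lambda>z. gradPhi t z \<bullet> b) has_derivative (\<bullet>) (H b z)) (at z)"
      unfolding gradPhi_def inner_scaleR_left
      by (rule has_derivative_eq_rhs)
         (auto simp: fun_eq_iff H_def inner_simps algebra_simps inner_commute)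
    show "continuous_on UNIV (H b)"
      unfolding H_def
      by (intro continuous_intros continuous_on_compose2[OF cq'] continuous_on_compose2[OF cpt']) auto
  qed
  have 3: "- rho t z = (\<Sum>b\<in>Basis. H b z \<bullet> b)" for z :: 'a
  proof -
    define s where "s = z \<bullet> z"
    have "(\<Sum>b\<in>Basis. H b z \<bullet> b) = 4 * q' (max s t) * (\<Sum>b\<in>Basis. (z \<bullet> b) * (z \<bullet> b)) + 2 * d * smooth_profile' t s"
      unfolding sum_distrib_left
      by (simp add: H_def s_def[symmetric] inner_simps sum.distrib algebra_simps)
         (simp add: d_DIM)
    also have "(\<Sum>b\<in>Basis. (z \<bullet> b) * (z \<bullet> b)) = s"
      unfolding s_def by (subst euclidean_inner) simp
    also have "4 * q' (max s t) * s + 2 * d * smooth_profile' t s = - rho t z"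
    proof (cases "t \<le> s")
      case True
      have "s powr (- d / 2 - 1) * s = s powr (- d / 2)"
        using True t by (simp add: powr_diff)
      then have "q' s * s = d / 2 * q s" by (simp add: q'_def q_def)
      then have "2 * (s * q' s) = d * q s" by (simp add: mult.commute[of s])
      then show ?thesis using True
        by (simp add: rho_def smooth_profile'_def s_def[symmetric] max.absorb1 max.absorb2)
    next
      case False
      have "t powr (- d / 2 - 1) * t = t powr (- d / 2)"
        using t by (simp add: powr_diff)
      then have *: "q t = \<kappa> * t powr (- d / 2 - 1) * t" by (simp add: q_def)
      show ?thesis using False
        by (simp add: rho_def smooth_profile'_def s_def[symmetric] max_def * q'_def) (simp add: field_simps)
    qed
    finally show ?thesis by simp
  qed
  show ?thesis unfolding C2_lap_def
    by (intro conjI ballI exI[of _ H] 1 2 3)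
qed

lemma rho_nonneg: "rho t z \<ge> 0" using d_ge_1 \<kappa>_pos by (simp add: rho_def less_imp_le)

lemma rho_minus: "rho t (x - y) = rho t (y - x)"
  by (simp add: rho_def inner_diff inner_commute algebra_simps)

lemma rho_support: "t \<le> z \<bullet> z \<Longrightarrow> rho t z = 0" by (simp add: rho_def)

lemma continuous_rho: "continuous_on S (rho t)"
  unfolding rho_def by (intro continuous_intros)

lemma continuous_Phi: "t > 0 \<Longrightarrow> continuous_on S (Phi t)"
  using C1_grad_continuous[OF C2_lap_imp_C1_grad[OF Phi_C2]] continuous_on_subset by blast

lemma compact_inner_le: "compact {z::'a. z \<bullet> z \<le> t}"
proof -
  have "{z::'a. z \<bullet> z \<le> t} = cball 0 (sqrt t)" if "t \<ge> 0"
    using that by (auto simp: norm_eq_sqrt_inner)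
  moreover have "{z::'a. z \<bullet> z \<le> t} = {}" if "t < 0"
    using that by (auto simp: not_le intro: order.strict_trans2)
  ultimately show ?thesis by (cases "t \<ge> 0") auto
qed

lemma integrable_rho: "integrable lborel (rho t)"
  by (rule integrable_continuous_compact_support[OF continuous_rho compact_inner_le[of t]])
     (auto intro: rho_support)

text \<open>By \<open>integral_rho\<close> this is the mass of \<open>rho t\<close> for every
  \<open>t > 0\<close>. Only this invariance and positivity are used afterwards.\<close>

definition c :: real where "c = integral\<^sup>L lborel (rho 1)"

text \<open>\<open>Phi 1\<close> and \<open>Phi t\<close> agree outside a ball, so the Laplacian of
  their difference integrates to zero.\<close>

lemma integral_rho: assumes "t > 0" shows "integral\<^sup>L lborel (rho t) = c"
proof -
  have "C2_lap UNIV (\<lambda>z. Phi 1 z - Phi t z) (\<lambda>z. gradPhi 1 z - gradPhi t z) (\<lambda>z. - rho 1 z - - rho t z)"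
    by (intro C2_lap_diff Phi_C2 assms) simp
  then have "integral\<^sup>L lborel (\<lambda>z. - rho 1 z - - rho t z) = 0"
    by (rule integral_laplacian_zero[OF _ compact_inner_le[of "max 1 t"]]) (auto simp: Phi_def smooth_profile_def not_le)
  then show ?thesis using integrable_rho by (simp add: c_def)
qed

lemma c_pos: "c > 0"
proof -
  have "\<not> (AE z in lborel. rho 1 z = 0)"
  proof
    assume "AE z in lborel. rho 1 z = (0::real)"
    then have "AE z in lborel. (z::'a) \<notin> ball 0 1"
    proof (rule AE_mp, intro AE_I2 impI)
      fix z :: 'a assume "rho 1 z = 0"
      then have "max 0 (1 - z \<bullet> z) = 0" using \<kappa>_pos d_ge_1 by (simp add: rho_def)
      then have "1 \<le> z \<bullet> z" by linarith
      then show "z \<notin> ball 0 1" by (simp add: norm_eq_sqrt_inner)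
    qed
    then have "emeasure lborel (ball (0::'a) 1) = 0"
      by (subst (asm) AE_iff_measurable[of "ball 0 1"]) auto
    moreover have "measure lborel (ball (0::'a) 1) > 0"
      using content_ball_pos[of 1 "0::'a"] by simp
    ultimately show False by (simp add: measure_def)
  qed
  then have "integral\<^sup>L lborel (rho 1) \<noteq> 0"
    using integral_nonneg_eq_0_iff_AE[OF integrable_rho] rho_nonneg by auto
  moreover have "integral\<^sup>L lborel (rho 1) \<ge> 0" using rho_nonneg by simp
  ultimately show ?thesis by (simp add: c_def)
qed

end

section \<open>The near field kernel\<close>

lemma LIMSEQ_one_over_Suc: "(\<lambda>n. 1 / real (Suc n)) \<longlonglongrightarrow> 0"
  using LIMSEQ_inverse_real_of_nat by (simp add: inverse_eq_divide)

context radial_profile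
begin

lemma q_measurable [measurable]: "q \<in> borel_measurable borel"
  unfolding q_def[abs_def] by measurable

text \<open>Below level \<^term>\<open>t\<close> this is \<open>p (z \<bullet> z) - p t\<close>, written as an integral so that Tonelli's theorem turns
  its potential into an integral of masses of balls. At the origin it is infinite unless \<open>d = 1\<close>.\<close>
definition near_kernel :: "real \<Rightarrow> 'a \<Rightarrow> ennreal" where
  "near_kernel t z = (\<integral>\<^sup>+\<sigma>. ennreal (q \<sigma>) * indicator {z \<bullet> z<..<t} \<sigma> \<partial>lborel)"

lemma near_kernel_minus: "near_kernel t (x - y) = near_kernel t (y - x)"
proof -
  have "(x - y) \<bullet> (x - y) = (y - x) \<bullet> (y - x)" by (simp add: inner_diff inner_commute)
  then show ?thesis by (simp only: near_kernel_def)
qed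

lemma q_antimono: "0 < s \<Longrightarrow> s \<le> t \<Longrightarrow> q t \<le> q s"
  unfolding q_def using \<kappa>_pos d_ge_1 by (intro mult_left_mono) (auto intro: powr_mono2')

lemma q'_antimono: "0 < s \<Longrightarrow> s \<le> t \<Longrightarrow> q' t \<le> q' s"
  unfolding q'_def using \<kappa>_pos d_ge_1 by (intro mult_left_mono) (auto intro: powr_mono2')

text \<open>\<open>q\<close> decreases, so the levels between \<open>t\<close> and \<open>T\<close>
  contribute a bounded amount. The singular part that remains has a small potential when
  \<open>t\<close> is small.\<close>

lemma near_kernel_split: assumes "0 < t" "t \<le> T" shows "near_kernel T z \<le> near_kernel t z + ennreal (q t * (T - t))"
proof -
  have "near_kernel T z \<le> (\<integral>\<^sup>+\<sigma>. ennreal (q \<sigma>) * indicator {z \<bullet> z<..<t} \<sigma> + ennreal (q t) * indicator {t..T} \<sigma> \<partial>lborel)"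
    unfolding near_kernel_def
    by (intro nn_integral_mono) (use assms q_antimono in \<open>auto simp: indicator_def intro!: ennreal_leI\<close>)
  also have "\<dots> = near_kernel t z + (\<integral>\<^sup>+\<sigma>. ennreal (q t) * indicator {t..T} \<sigma> \<partial>lborel)"
    unfolding near_kernel_def by (intro nn_integral_add) auto
  also have "(\<integral>\<^sup>+\<sigma>. ennreal (q t) * indicator {t..T} \<sigma> \<partial>lborel) = ennreal (q t * (T - t))"
    using assms q_nonneg by (simp add: nn_integral_cmult_indicator ennreal_mult)
  finally show ?thesis .
qed

text \<open>Below \<open>t\<close> the derivative is minus the tangent line of \<open>q\<close> at
  \<open>t\<close>. As \<open>q\<close> is convex, the tangent lies below \<open>q\<close>, and left
  of \<open>t\<close> it is nonnegative.\<close>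

lemma smooth_profile'_bounds:
  assumes "0 < t"
  shows "smooth_profile' t s \<le> 0" and "0 < s \<Longrightarrow> - q s \<le> smooth_profile' t s"
proof -
  show "smooth_profile' t s \<le> 0"
    using assms q_nonneg[of s] q_nonneg[of t] q'_nonneg[of t]
    by (auto simp: smooth_profile'_def intro: mult_nonneg_nonpos order_trans[of _ 0])
       (smt (verit) mult_nonneg_nonpos)
  assume s: "0 < s"
  show "- q s \<le> smooth_profile' t s"
  proof (cases "t \<le> s")
    case False
    \<comment> \<open>Adding the linear term turns the tangent inequality into monotonicity: the
      derivative \<open>- q' r + q' t\<close> is nonpositive for r up to t.\<close>
    have "(\<lambda>s. q s + q' t * (s - t)) t \<le> (\<lambda>s. q s + q' t * (s - t)) s"
    proof (rule DERIV_nonpos_imp_nonincreasing[of s t])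
      show "s \<le> t" using False by simp
      fix r assume r: "s \<le> r" "r \<le> t"
      have "((\<lambda>s. q s + q' t * (s - t)) has_real_derivative (- q' r + q' t)) (at r)"
        using r s by (auto intro!: derivative_eq_intros q_deriv)
      moreover have "- q' r + q' t \<le> 0" using q'_antimono[of r t] r s by simp
      ultimately show "\<exists>y. ((\<lambda>s. q s + q' t * (s - t)) has_real_derivative y) (at r) \<and> y \<le> 0" by blast
    qed
    then show ?thesis using False by (simp add: smooth_profile'_def)
  qed (simp add: smooth_profile'_def)
qed

lemma smooth_profile_antimono: assumes "0 < t" "s \<le> s'" shows "smooth_profile t s' \<le> smooth_profile t s"
  by (rule DERIV_nonpos_imp_nonincreasing[OF assms(2)]) (use smooth_profile_deriv smooth_profile'_bounds assms in blast)

text \<open>By the fundamental theorem of calculus the height above the level \<open>p T\<close> is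
  the integral of the negated derivative from |z|^2 to \<open>T\<close>, which is pointwise at most
  \<open>q\<close>. The bound does not depend on the smoothing parameter.\<close>

lemma Phi_minus_level_le:
  assumes t: "0 < t" "t \<le> T" and z: "z \<bullet> z \<le> T"
  shows "p T \<le> Phi t z" "ennreal (Phi t z - p T) \<le> near_kernel T z"
proof -
  have pT: "smooth_profile t T = p T" using t by (simp add: smooth_profile_def)
  show "p T \<le> Phi t z" using smooth_profile_antimono[OF t(1) z] by (simp add: Phi_def pT)
  have cpt': "continuous_on UNIV (smooth_profile' t)"
    using smooth_profile'_deriv[OF t(1)] by (meson DERIV_isCont continuous_at_imp_continuous_on)
  have "(\<integral>\<^sup>+\<sigma>. ennreal (- smooth_profile' t \<sigma>) * indicator {z \<bullet> z..T} \<sigma> \<partial>lborel) = ennreal (- smooth_profile t T - - smooth_profile t (z \<bullet> z))"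
  proof (rule nn_integral_FTC_Icc)
    show "(\<lambda>\<sigma>. - smooth_profile' t \<sigma>) \<in> borel_measurable borel"
      using cpt' by (intro borel_measurable_continuous_onI continuous_intros)
    fix \<sigma> assume "\<sigma> \<in> {z \<bullet> z..T}"
    show "((\<lambda>s. - smooth_profile t s) has_real_derivative - smooth_profile' t \<sigma>) (at \<sigma>)"
      by (rule DERIV_minus[OF smooth_profile_deriv[OF t(1)]])
    show "0 \<le> - smooth_profile' t \<sigma>" using smooth_profile'_bounds(1)[OF t(1)] by simp
  qed (use z in auto)
  then have "ennreal (Phi t z - p T) = (\<integral>\<^sup>+\<sigma>. ennreal (- smooth_profile' t \<sigma>) * indicator {z \<bullet> z..T} \<sigma> \<partial>lborel)"
    by (simp add: Phi_def pT)
  also have "\<dots> \<le> near_kernel T z" unfolding near_kernel_def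
  proof (rule nn_integral_mono_AE)
    \<comment> \<open>Discarding the endpoints reconciles the closed interval with the open one. It
      also removes \<sigma> = 0 in the case z = 0, where the bound by \<open>q\<close> fails because
      \<open>0 powr _\<close> is 0.\<close>
    have "AE \<sigma> in lborel. \<sigma> \<noteq> z \<bullet> z \<and> \<sigma> \<noteq> T"
      using AE_lborel_singleton[of "z \<bullet> z"] AE_lborel_singleton[of T] by (simp add: AE_conj_iff)
    then show "AE \<sigma> in lborel. ennreal (- smooth_profile' t \<sigma>) * indicator {z \<bullet> z..T} \<sigma>
        \<le> ennreal (q \<sigma>) * indicator {z \<bullet> z<..<T} \<sigma>"
    proof eventually_elim
      case (elim \<sigma>)
      have "0 < \<sigma>" if "z \<bullet> z < \<sigma>" using that inner_ge_zero[of z] by linarith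
      then show ?case using elim smooth_profile'_bounds(2)[OF t(1), of \<sigma>]
        by (auto simp: indicator_def intro!: ennreal_leI)
    qed
  qed
  finally show "ennreal (Phi t z - p T) \<le> near_kernel T z" .
qed

text \<open>Inside the ball both values lie above the common level \<open>p t\<close> and exceed it
  by at most the kernel; outside they coincide.\<close>

lemma Phi_diff_le_near_kernel:
  assumes "0 < \<tau>" "\<tau> \<le> t"
  shows "ennreal \<bar>Phi \<tau> z - Phi t z\<bar> \<le> near_kernel t z"
proof (cases "t \<le> z \<bullet> z")
  case True
  then show ?thesis using assms by (simp add: Phi_def smooth_profile_def)
next
  case False
  then have z: "z \<bullet> z \<le> t" by simp
  have "\<bar>Phi \<tau> z - Phi t z\<bar> \<le> max (Phi \<tau> z - p t) (Phi t z - p t)"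
    using Phi_minus_level_le(1)[OF assms z] Phi_minus_level_le(1)[OF _ order_refl z] assms by auto
  then have "ennreal \<bar>Phi \<tau> z - Phi t z\<bar> \<le> ennreal (max (Phi \<tau> z - p t) (Phi t z - p t))"
    by (rule ennreal_leI)
  also have "\<dots> \<le> near_kernel t z"
    using Phi_minus_level_le(2)[OF assms z] Phi_minus_level_le(2)[OF _ order_refl z] assms by (simp add: max_def)
  finally show ?thesis .
qed

lemma Phi_le_Phi_0: "0 < t \<Longrightarrow> Phi t z \<le> Phi t 0"
  by (simp add: Phi_def smooth_profile_antimono)

lemma near_kernel_measurable [measurable]: "near_kernel t \<in> borel_measurable borel"
proof -
  have "near_kernel t = (\<lambda>z. \<integral>\<^sup>+\<sigma>. ennreal (q \<sigma>) * (if z \<bullet> z < \<sigma> \<and> \<sigma> < t then 1 else 0) \<partial>lborel)"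
    unfolding near_kernel_def[abs_def] by (intro ext nn_integral_cong) (auto simp: indicator_def)
  then show ?thesis by simp
qed

text \<open>After Tonelli the inner integral is the mass of a ball of radius sqrt \<sigma>, which
  leaves the integral of \<sigma> to the power (Q - d) / 2. This is where the dimension hypothesis
  enters: \<alpha> > 0 says precisely that Q > d - 2, and the power \<open>t powr \<alpha>\<close>
  makes the potential small with \<open>t\<close>.\<close>

lemma near_kernel_potential:
  assumes [measurable_cong]: "sets \<nu> = sets borel" and fin: "finite_measure \<nu>"
    and growth: "\<And>r. r > 0 \<Longrightarrow> emeasure \<nu> (ball y r) \<le> ennreal (C * r powr Q)"
    and Q: "Q > d - 2" and C: "C \<ge> 0" and t: "t > 0"
  defines "\<alpha> \<equiv> (Q - d) / 2 + 1"
  shows "\<alpha> > 0" and "(\<integral>\<^sup>+x. near_kernel t (x - y) \<partial>\<nu>) \<le> ennreal (\<kappa> * C * (t powr \<alpha> / \<alpha>))"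
proof -
  interpret finite_measure \<nu> by fact
  interpret pair_sigma_finite \<nu> "lborel :: real measure" ..
  show \<alpha>: "\<alpha> > 0" using Q by (simp add: \<alpha>_def field_simps)
  have "(\<integral>\<^sup>+x. near_kernel t (x - y) \<partial>\<nu>) =
      (\<integral>\<^sup>+x. \<integral>\<^sup>+\<sigma>. ennreal (q \<sigma>) * (if (x - y) \<bullet> (x - y) < \<sigma> \<and> \<sigma> < t then 1 else 0) \<partial>lborel \<partial>\<nu>)"
    unfolding near_kernel_def by (intro nn_integral_cong) (auto simp: indicator_def)
  also have "\<dots> = (\<integral>\<^sup>+\<sigma>. \<integral>\<^sup>+x. ennreal (q \<sigma>) * (if (x - y) \<bullet> (x - y) < \<sigma> \<and> \<sigma> < t then 1 else 0) \<partial>\<nu> \<partial>lborel)"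
    by (rule Fubini'[symmetric]) measurable
  also have "\<dots> \<le> (\<integral>\<^sup>+\<sigma>. ennreal (\<kappa> * C * \<sigma> powr (\<alpha> - 1)) * indicator {0..t} \<sigma> \<partial>lborel)"
  proof (rule nn_integral_mono)
    fix \<sigma> :: real
    show "(\<integral>\<^sup>+x. ennreal (q \<sigma>) * (if (x - y) \<bullet> (x - y) < \<sigma> \<and> \<sigma> < t then 1 else 0) \<partial>\<nu>)
        \<le> ennreal (\<kappa> * C * \<sigma> powr (\<alpha> - 1)) * indicator {0..t} \<sigma>"
    proof (cases "0 < \<sigma> \<and> \<sigma> < t")
      case True
      have "(\<integral>\<^sup>+x. ennreal (q \<sigma>) * (if (x - y) \<bullet> (x - y) < \<sigma> \<and> \<sigma> < t then 1 else 0) \<partial>\<nu>)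
          = (\<integral>\<^sup>+x. ennreal (q \<sigma>) * indicator (ball y (sqrt \<sigma>)) x \<partial>\<nu>)"
      proof (rule nn_integral_cong)
        fix x
        have "(x - y) \<bullet> (x - y) < \<sigma> \<longleftrightarrow> x \<in> ball y (sqrt \<sigma>)"
          unfolding mem_ball dist_norm norm_minus_commute[of y x]
          using True by (simp add: norm_eq_sqrt_inner)
        then show "ennreal (q \<sigma>) * (if (x - y) \<bullet> (x - y) < \<sigma> \<and> \<sigma> < t then 1 else 0) =
            ennreal (q \<sigma>) * indicator (ball y (sqrt \<sigma>)) x"
          using True by (simp add: indicator_def)
      qed
      also have "\<dots> = ennreal (q \<sigma>) * emeasure \<nu> (ball y (sqrt \<sigma>))"
        by (rule nn_integral_cmult_indicator) (simp add: assms(1))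
      also have "\<dots> \<le> ennreal (q \<sigma>) * ennreal (C * sqrt \<sigma> powr Q)"
        using True by (intro mult_left_mono growth) auto
      also have "\<dots> = ennreal (q \<sigma> * (C * sqrt \<sigma> powr Q))"
        using q_nonneg by (simp add: ennreal_mult')
      also have "q \<sigma> * (C * sqrt \<sigma> powr Q) = \<kappa> * C * \<sigma> powr (\<alpha> - 1)"
      proof -
        have "sqrt \<sigma> powr Q = \<sigma> powr (Q / 2)"
          using True by (simp add: powr_half_sqrt[symmetric] powr_powr)
        moreover have "\<sigma> powr (- d / 2) * \<sigma> powr (Q / 2) = \<sigma> powr (\<alpha> - 1)"
          unfolding powr_add[symmetric] by (rule arg_cong[where f="\<lambda>e. \<sigma> powr e"]) (simp add: \<alpha>_def field_simps)
        ultimately show ?thesis by (simp add: q_def)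
      qed
      finally show ?thesis using True by simp
    next
      case False
      have "(if (x - y) \<bullet> (x - y) < \<sigma> \<and> \<sigma> < t then 1 else 0 :: ennreal) = 0" for x
        using False inner_ge_zero[of "x - y"] by (auto simp: not_less intro: order_trans)
      then show ?thesis by simp
    qed
  qed
  also have "\<dots> = ennreal (\<kappa> * C * (t powr \<alpha> / \<alpha>))"
  proof -
    have "((\<lambda>\<sigma>. \<sigma> powr (\<alpha> - 1)) has_integral (t powr (\<alpha> - 1 + 1) / (\<alpha> - 1 + 1))) {0..t}"
      by (rule has_integral_powr_from_0) (use \<alpha> t in auto)
    then have "((\<lambda>\<sigma>. \<kappa> * C * \<sigma> powr (\<alpha> - 1)) has_integral (\<kappa> * C * (t powr \<alpha> / \<alpha>))) {0..t}"
      by (intro has_integral_mult_right) simp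
    then show ?thesis
      by (intro nn_integral_has_integral_lebesgue') (use C \<kappa>_pos in auto)
  qed
  finally show "(\<integral>\<^sup>+x. near_kernel t (x - y) \<partial>\<nu>) \<le> ennreal (\<kappa> * C * (t powr \<alpha> / \<alpha>))" .
qed

lemma near_kernel_tendsto_0:
  assumes fin: "near_kernel t z < \<infinity>" and t: "t > 0"
  shows "(\<lambda>n. near_kernel (min t (1 / Suc n)) z) \<longlonglongrightarrow> 0"
proof -
  have "(\<lambda>n. near_kernel (min t (1 / Suc n)) z) \<longlonglongrightarrow> (\<integral>\<^sup>+\<sigma>. 0 \<partial>(lborel::real measure))"
    unfolding near_kernel_def
  proof (rule nn_integral_dominated_convergence[where w="\<lambda>\<sigma>. ennreal (q \<sigma>) * indicator {z \<bullet> z<..<t} \<sigma>"])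
    show "(\<integral>\<^sup>+\<sigma>. ennreal (q \<sigma>) * indicator {z \<bullet> z<..<t} \<sigma> \<partial>lborel) < \<infinity>" using fin by (simp add: near_kernel_def)
    show "AE \<sigma> in lborel. (\<lambda>n. ennreal (q \<sigma>) * indicator {z \<bullet> z<..<min t (1 / real (Suc n))} \<sigma>) \<longlonglongrightarrow> 0"
    proof (intro AE_I2)
      fix \<sigma> :: real
      have "\<forall>\<^sub>F n in sequentially. \<sigma> \<le> 0 \<or> 1 / real (Suc n) < \<sigma>"
      proof (cases "\<sigma> \<le> 0")
        case False
        then show ?thesis
          using order_tendstoD(2)[OF LIMSEQ_inverse_real_of_nat, of \<sigma>] by (simp add: inverse_eq_divide)
      qed simp
      then have "\<forall>\<^sub>F n in sequentially. ennreal (q \<sigma>) * indicator {z \<bullet> z<..<min t (1 / real (Suc n))} \<sigma> = 0"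
      proof eventually_elim
        case (elim n)
        then have "\<sigma> \<notin> {z \<bullet> z<..<min t (1 / real (Suc n))}" using inner_ge_zero[of z] by (auto simp del: inner_ge_zero)
        then show ?case by simp
      qed
      then show "(\<lambda>n. ennreal (q \<sigma>) * indicator {z \<bullet> z<..<min t (1 / real (Suc n))} \<sigma>) \<longlonglongrightarrow> 0"
        by (rule tendsto_eventually)
    qed
  qed (auto simp: indicator_def)
  then show ?thesis by simp
qed

lemma potential_bound_tendsto_0:
  assumes "\<alpha> > 0"
  shows "(\<lambda>n. \<kappa> * C * ((1 / real (Suc n)) powr \<alpha> / \<alpha>)) \<longlonglongrightarrow> 0"
proof -
  have "(\<lambda>n. (1 / real (Suc n)) powr \<alpha>) \<longlonglongrightarrow> 0"
    by (rule tendsto_zero_powrI[OF LIMSEQ_one_over_Suc tendsto_const]) (use assms in auto)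
  then have "(\<lambda>n. \<kappa> * C * ((1 / real (Suc n)) powr \<alpha> / \<alpha>)) \<longlonglongrightarrow> \<kappa> * C * (0 / \<alpha>)"
    using assms by (intro tendsto_intros) auto
  then show ?thesis by simp
qed

text \<open>Off the origin this is the fundamental solution. At the origin the limit exists only if \<open>d = 1\<close>;
  in higher dimensions the value is junk, which is harmless because \<open>near_kernel\<close> is infinite there.\<close>
definition Phi_lim :: "'a \<Rightarrow> real" where "Phi_lim z = lim (\<lambda>n. Phi (1 / Suc n) z)"

text \<open>The sequence is Cauchy: all terms from index N on lie within
  \<open>near_kernel (1 / Suc N) z\<close> of the N-th one, and this tends to zero once the kernel
  is finite at \<open>z\<close>.\<close>

lemma Phi_tendsto_Phi_lim:
  assumes fin: "near_kernel t z < \<infinity>" and t: "t > 0"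
  shows "(\<lambda>n. Phi (1 / Suc n) z) \<longlonglongrightarrow> Phi_lim z"
proof -
  have "Cauchy (\<lambda>n. Phi (1 / Suc n) z)"
  proof (rule metric_CauchyI)
    fix e :: real assume e: "e > 0"
    note near_kernel_tendsto_0[OF fin t]
    then have ev1: "\<forall>\<^sub>F n in sequentially. near_kernel (min t (1 / Suc n)) z < ennreal (e / 2)"
      using e by (intro order_tendstoD(2)) auto
    have "\<forall>\<^sub>F n in sequentially. 1 / real (Suc n) < t"
      using order_tendstoD(2)[OF LIMSEQ_inverse_real_of_nat t] by (simp add: inverse_eq_divide)
    with ev1 have "\<forall>\<^sub>F n in sequentially. near_kernel (1 / Suc n) z < ennreal (e / 2)"
    proof eventually_elim
      case (elim n)
      then show ?case by (simp add: min_def split: if_splits)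
    qed
    then obtain N where N: "near_kernel (1 / Suc N) z < ennreal (e / 2)" by (auto simp: eventually_sequentially)
    have close: "\<bar>Phi (1 / Suc n) z - Phi (1 / Suc N) z\<bar> < e / 2" if "n \<ge> N" for n
    proof -
      have "ennreal \<bar>Phi (1 / Suc n) z - Phi (1 / Suc N) z\<bar> \<le> near_kernel (1 / Suc N) z"
        by (rule Phi_diff_le_near_kernel) (use that in \<open>auto simp: field_simps\<close>)
      also note N
      finally show ?thesis using e by (simp add: ennreal_less_iff)
    qed
    show "\<exists>M. \<forall>m\<ge>M. \<forall>n\<ge>M. dist (Phi (1 / Suc m) z) (Phi (1 / Suc n) z) < e"
    proof (intro exI[of _ N] allI impI)
      fix m n assume "N \<le> m" "N \<le> n"
      then show "dist (Phi (1 / Suc m) z) (Phi (1 / Suc n) z) < e"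
        using close[of m] close[of n] unfolding dist_real_def by linarith
    qed
  qed
  then have "convergent (\<lambda>n. Phi (1 / Suc n) z)" by (simp add: Cauchy_convergent_iff)
  then show ?thesis unfolding Phi_lim_def by (simp add: convergent_LIMSEQ_iff)
qed

lemma Phi_lim_diff_le_near_kernel:
  assumes t: "t > 0" and fin: "near_kernel t z < \<infinity>"
  shows "ennreal \<bar>Phi_lim z - Phi t z\<bar> \<le> near_kernel t z"
proof -
  have lim: "(\<lambda>n. ennreal \<bar>Phi (1 / Suc n) z - Phi t z\<bar>) \<longlonglongrightarrow> ennreal \<bar>Phi_lim z - Phi t z\<bar>"
    by (intro tendsto_ennrealI tendsto_intros Phi_tendsto_Phi_lim[OF fin t])
  have "\<forall>\<^sub>F n in sequentially. 1 / real (Suc n) < t"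
    using order_tendstoD(2)[OF LIMSEQ_inverse_real_of_nat t] by (simp add: inverse_eq_divide)
  then have "\<forall>\<^sub>F n in sequentially. ennreal \<bar>Phi (1 / Suc n) z - Phi t z\<bar> \<le> near_kernel t z"
    by eventually_elim (auto intro!: Phi_diff_le_near_kernel)
  then show ?thesis by (rule tendsto_upperbound[OF lim]) simp
qed

lemma Phi_eq_p: "0 < t \<Longrightarrow> t \<le> z \<bullet> z \<Longrightarrow> Phi t z = p (z \<bullet> z)"
  by (simp add: Phi_def smooth_profile_def)

lemma Phi_lim_eq_p: assumes "z \<noteq> 0" shows "Phi_lim z = p (z \<bullet> z)"
proof -
  have "z \<bullet> z > 0" using assms by simp
  then have "\<forall>\<^sub>F n in sequentially. 1 / real (Suc n) < z \<bullet> z"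
    using order_tendstoD(2)[OF LIMSEQ_inverse_real_of_nat] by (simp add: inverse_eq_divide)
  then have "\<forall>\<^sub>F n in sequentially. Phi (1 / Suc n) z = p (z \<bullet> z)"
    by eventually_elim (auto intro!: Phi_eq_p)
  then have "(\<lambda>n. Phi (1 / Suc n) z) \<longlonglongrightarrow> p (z \<bullet> z)" by (rule tendsto_eventually)
  then show ?thesis unfolding Phi_lim_def by (rule limI)
qed

end

section \<open>Functions of class \<open>C\<^sup>k\<close> and convolution\<close>

lemma Ck_on_continuous: "Ck_on k S f \<Longrightarrow> continuous_on S f"
  by (cases k) (auto intro!: continuous_at_imp_continuous_on dest: bspec has_derivative_continuous)

lemma Ck_on_Suc_imp: "Ck_on (Suc k) S f \<Longrightarrow> Ck_on k S f"
proof (induction k arbitrary: f)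
  case 0
  then have "continuous_on S f" by (rule Ck_on_continuous)
  then show ?case by simp
next
  case (Suc k)
  from Suc.prems obtain g where g: "\<forall>x\<in>S. (f has_derivative (\<lambda>v. g x \<bullet> v)) (at x)"
    "\<forall>b\<in>Basis. Ck_on (Suc k) S (\<lambda>x. g x \<bullet> b)"
    unfolding Ck_on.simps(2)[of "Suc k"] by blast
  have "\<forall>b\<in>Basis. Ck_on k S (\<lambda>x. g x \<bullet> b)" using g(2) Suc.IH by blast
  with g(1) show ?case unfolding Ck_on.simps(2)[of k] by blast
qed

lemma Ck_on_add: "Ck_on k S f \<Longrightarrow> Ck_on k S g \<Longrightarrow> Ck_on k S (\<lambda>x. f x + g x)"
proof (induction k arbitrary: f g)
  case (Suc k)
  obtain F where F: "\<forall>x\<in>S. (f has_derivative (\<lambda>v. F x \<bullet> v)) (at x)" "\<forall>b\<in>Basis. Ck_on k S (\<lambda>x. F x \<bullet> b)"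
    using Suc.prems(1) by auto
  obtain G where G: "\<forall>x\<in>S. (g has_derivative (\<lambda>v. G x \<bullet> v)) (at x)" "\<forall>b\<in>Basis. Ck_on k S (\<lambda>x. G x \<bullet> b)"
    using Suc.prems(2) by auto
  have "\<forall>x\<in>S. ((\<lambda>x. f x + g x) has_derivative (\<lambda>v. (F x + G x) \<bullet> v)) (at x)"
    using has_derivative_add F(1) G(1) by (simp add: inner_add_left)
  moreover have "\<forall>b\<in>Basis. Ck_on k S (\<lambda>x. (F x + G x) \<bullet> b)"
    using Suc.IH F(2) G(2) by (simp add: inner_add_left)
  ultimately show ?case unfolding Ck_on.simps(2) by (intro exI[of _ "\<lambda>x. F x + G x"]) blast
qed (auto intro: continuous_intros)

lemma Ck_on_mult: "Ck_on k S f \<Longrightarrow> Ck_on k S g \<Longrightarrow> Ck_on k S (\<lambda>x. f x * g x)"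
proof (induction k arbitrary: f g)
  case (Suc k)
  obtain F where F: "\<forall>x\<in>S. (f has_derivative (\<lambda>v. F x \<bullet> v)) (at x)" "\<forall>b\<in>Basis. Ck_on k S (\<lambda>x. F x \<bullet> b)"
    using Suc.prems(1) by auto
  obtain G where G: "\<forall>x\<in>S. (g has_derivative (\<lambda>v. G x \<bullet> v)) (at x)" "\<forall>b\<in>Basis. Ck_on k S (\<lambda>x. G x \<bullet> b)"
    using Suc.prems(2) by auto
  have "\<forall>x\<in>S. ((\<lambda>x. f x * g x) has_derivative (\<lambda>v. (f x *\<^sub>R G x + g x *\<^sub>R F x) \<bullet> v)) (at x)"
  proof
    fix x assume x: "x \<in> S"
    show "((\<lambda>x. f x * g x) has_derivative (\<lambda>v. (f x *\<^sub>R G x + g x *\<^sub>R F x) \<bullet> v)) (at x)"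
      by (rule has_derivative_eq_rhs[OF has_derivative_mult[OF bspec[OF F(1) x] bspec[OF G(1) x]]])
         (auto simp: fun_eq_iff inner_simps algebra_simps)
  qed
  moreover have "\<forall>b\<in>Basis. Ck_on k S (\<lambda>x. (f x *\<^sub>R G x + g x *\<^sub>R F x) \<bullet> b)"
    unfolding inner_add_left inner_scaleR_left
    by (intro ballI Ck_on_add Suc.IH Suc.prems[THEN Ck_on_Suc_imp] bspec[OF F(2)] bspec[OF G(2)])
  ultimately show ?case unfolding Ck_on.simps(2) by (intro exI[of _ "\<lambda>x. f x *\<^sub>R G x + g x *\<^sub>R F x"]) blast
qed (auto intro: continuous_intros)

lemma Ck_on_cmult: "Ck_on k S f \<Longrightarrow> Ck_on k S (\<lambda>x. s * f x)"
proof (induction k arbitrary: f)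
  case (Suc k)
  obtain F where F: "\<forall>x\<in>S. (f has_derivative (\<lambda>v. F x \<bullet> v)) (at x)" "\<forall>b\<in>Basis. Ck_on k S (\<lambda>x. F x \<bullet> b)"
    using Suc.prems by auto
  have "\<forall>x\<in>S. ((\<lambda>x. s * f x) has_derivative (\<lambda>v. (s *\<^sub>R F x) \<bullet> v)) (at x)"
    using F(1) by (auto intro: has_derivative_mult_right)
  moreover have "\<forall>b\<in>Basis. Ck_on k S (\<lambda>x. (s *\<^sub>R F x) \<bullet> b)"
    using Suc.IH F(2) by simp
  ultimately show ?case unfolding Ck_on.simps(2) by (intro exI[of _ "\<lambda>x. s *\<^sub>R F x"]) blast
qed (auto intro: continuous_intros)

lemma Ck_on_affine: "Ck_on k UNIV f \<Longrightarrow> Ck_on k UNIV (\<lambda>x. f (a + s *\<^sub>R x))"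
proof (induction k arbitrary: f)
  case 0
  then show ?case by (auto intro!: continuous_on_compose2[of UNIV f] continuous_intros)
next
  case (Suc k)
  obtain F where F: "\<forall>x\<in>UNIV. (f has_derivative (\<lambda>v. F x \<bullet> v)) (at x)" "\<forall>b\<in>Basis. Ck_on k UNIV (\<lambda>x. F x \<bullet> b)"
    using Suc.prems by auto
  have "((\<lambda>x. f (a + s *\<^sub>R x)) has_derivative (\<lambda>v. (s *\<^sub>R F (a + s *\<^sub>R x)) \<bullet> v)) (at x)" for x
  proof -
    have "((\<lambda>x. a + s *\<^sub>R x) has_derivative (\<lambda>v. s *\<^sub>R v)) (at x)"
      by (auto intro!: derivative_eq_intros)
    from has_derivative_compose[OF this bspec[OF F(1)]] show ?thesis
      by simp
  qed
  moreover have "\<forall>b\<in>Basis. Ck_on k UNIV (\<lambda>x. (s *\<^sub>R F (a + s *\<^sub>R x)) \<bullet> b)"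
    unfolding inner_scaleR_left
    by (intro ballI Ck_on_cmult Suc.IH[of "\<lambda>x. F x \<bullet> _"] bspec[OF F(2)])
  ultimately show ?case unfolding Ck_on.simps(2) by (intro exI[of _ "\<lambda>x. s *\<^sub>R F (a + s *\<^sub>R x)"]) blast
qed

section \<open>Classical gradients of test functions and harmonic functions\<close>

lemma grad_eqI: "(f has_derivative (\<lambda>v. D \<bullet> v)) (at x) \<Longrightarrow> grad f x = D"
  by (simp add: grad_def frechet_derivative_at[symmetric] euclidean_representation)

lemma test_fun_C1_grad: assumes "test_fun \<Omega> \<phi>" shows "C1_grad UNIV \<phi> (grad \<phi>)"
proof -
  have "Ck_on (Suc 0) UNIV \<phi>" using assms by (simp only: test_fun_def)
  then obtain g where g: "\<And>x. (\<phi> has_derivative (\<lambda>v. g x \<bullet> v)) (at x)"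
    "\<And>b. b \<in> Basis \<Longrightarrow> continuous_on UNIV (\<lambda>x. g x \<bullet> b)" by auto
  have "grad \<phi> = g" using g(1) grad_eqI by blast
  then show ?thesis using g by (simp add: C1_grad_def continuous_on_components)
qed

lemma test_fun_support:
  assumes "test_fun \<Omega> \<phi>"
  shows "compact (closure {x. \<phi> x \<noteq> 0})" "closure {x. \<phi> x \<noteq> 0} \<subseteq> \<Omega>"
    "x \<notin> closure {x. \<phi> x \<noteq> 0} \<Longrightarrow> \<phi> x = 0"
  using assms closure_subset[of "{x. \<phi> x \<noteq> 0}"] by (auto simp: test_fun_def)

text \<open>The witnesses in \<open>Ck_on\<close> agree with the Frechet derivatives in
  \<open>laplacian\<close> only on \<open>S\<close>. Openness of \<open>S\<close> makes them agree
  near each point, which is enough to transfer the second derivatives.\<close>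

lemma harmonic_on_C2_lap:
  assumes "harmonic_on S f"
  shows "C2_lap S f (grad f) (\<lambda>_. 0)"
proof -
  have S: "open S" and "Ck_on (Suc (Suc 0)) S f" and lap: "\<And>x. x \<in> S \<Longrightarrow> laplacian f x = 0"
    using assms by (auto simp: harmonic_on_def numeral_2_eq_2 simp del: Ck_on.simps)
  then obtain g where g: "\<And>x. x \<in> S \<Longrightarrow> (f has_derivative (\<lambda>v. g x \<bullet> v)) (at x)"
    "\<And>b. b \<in> Basis \<Longrightarrow> Ck_on (Suc 0) S (\<lambda>x. g x \<bullet> b)"
    unfolding Ck_on.simps(2)[of "Suc 0"] by blast
  have "\<exists>H. \<forall>x\<in>S. ((\<lambda>x. g x \<bullet> b) has_derivative (\<lambda>v. H x \<bullet> v)) (at x) \<and> continuous_on S H" if b: "b \<in> Basis" for b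
  proof -
    obtain H where "\<forall>x\<in>S. ((\<lambda>x. g x \<bullet> b) has_derivative (\<lambda>v. H x \<bullet> v)) (at x)"
      "\<forall>c\<in>Basis. continuous_on S (\<lambda>x. H x \<bullet> c)"
      using g(2)[OF b] by auto
    moreover from this(2) have "continuous_on S H" using continuous_on_components by blast
    ultimately show ?thesis by blast
  qed
  then obtain H where H: "\<And>b x. b \<in> Basis \<Longrightarrow> x \<in> S \<Longrightarrow> ((\<lambda>x. g x \<bullet> b) has_derivative (\<lambda>v. H b x \<bullet> v)) (at x)"
    "\<And>b x. b \<in> Basis \<Longrightarrow> x \<in> S \<Longrightarrow> continuous_on S (H b)"
    by metis
  have gr: "grad f x = g x" if "x \<in> S" for x using g(1)[OF that] by (rule grad_eqI)
  have H': "((\<lambda>x. grad f x \<bullet> b) has_derivative (\<lambda>v. H b x \<bullet> v)) (at x)" if "b \<in> Basis" "x \<in> S" for b x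
    by (rule has_derivative_transform_within_open[OF H(1)[OF that] S that(2)]) (simp add: gr)
  have "0 = (\<Sum>b\<in>Basis. H b x \<bullet> b)" if x: "x \<in> S" for x
  proof -
    have "frechet_derivative (\<lambda>y. frechet_derivative f (at y) b) (at x) b = H b x \<bullet> b" if b: "b \<in> Basis" for b
    proof -
      have "((\<lambda>y. frechet_derivative f (at y) b) has_derivative (\<lambda>v. H b x \<bullet> v)) (at x)"
        by (rule has_derivative_transform_within_open[OF H(1)[OF b x] S x])
           (simp add: frechet_derivative_at[OF g(1), symmetric])
      then show ?thesis by (simp add: frechet_derivative_at[symmetric])
    qed
    then show ?thesis using lap[OF x] by (simp add: laplacian_def)
  qed
  moreover have "C1_grad S (\<lambda>x. grad f x \<bullet> b) (H b)" if "b \<in> Basis" for b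
  proof (cases "S = {}")
    case False
    then show ?thesis using H' H(2) that unfolding C1_grad_def by blast
  qed (simp add: C1_grad_def)
  ultimately show ?thesis
    unfolding C2_lap_def using g(1) gr by (intro conjI exI[of _ H]) auto
qed

section \<open>Differentiation of convolutions\<close>

lemma lborel_integral_reflect:
  fixes f :: "'a::euclidean_space \<Rightarrow> 'b::{banach, second_countable_topology}"
  assumes "f \<in> borel_measurable borel"
  shows "integral\<^sup>L lborel (\<lambda>y. f (x - y)) = integral\<^sup>L lborel f"
proof -
  have "lborel = distr lborel borel (\<lambda>y::'a. x - y)"
    using lborel_affine[of "-1" x] by (simp add: density_1)
  then have "integral\<^sup>L lborel f = integral\<^sup>L (distr lborel borel (\<lambda>y. x - y)) f" by simp
  also have "\<dots> = integral\<^sup>L lborel (\<lambda>y. f (x - y))"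
    by (rule integral_distr) (use assms in auto)
  finally show ?thesis by simp
qed

text \<open>A bridge to the gauge integral over a box, the setting of the Leibniz rule for parameter
  integrals.\<close>

lemma integral_cbox_eq_lborel:
  fixes g :: "'a::euclidean_space \<Rightarrow> 'b::euclidean_space"
  assumes "integrable lborel g" "\<And>y. y \<notin> cbox a b \<Longrightarrow> g y = 0"
  shows "integral (cbox a b) g = integral\<^sup>L lborel g"
proof -
  have "(g has_integral integral\<^sup>L lborel g) UNIV"
    using assms(1) by (rule has_integral_integral_lborel)
  moreover have "(\<lambda>y. if y \<in> cbox a b then g y else 0) = g" using assms(2) by auto
  ultimately have "(g has_integral integral\<^sup>L lborel g) (cbox a b)"
    using has_integral_restrict_UNIV[of "cbox a b" g] by metis
  then show ?thesis by (rule integral_unique)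
qed

text \<open>Differentiation under the integral. The Leibniz rule asks for a continuous family of
  bounded linear maps, so the gradient is wrapped by \<open>blinfun_inner_right\<close> and
  unwrapped afterwards.\<close>

lemma convolution_has_derivative:
  fixes f :: "'a::euclidean_space \<Rightarrow> real"
  assumes k: "continuous_on UNIV k" and f: "C1_grad UNIV f F"
  shows "((\<lambda>x. integral (cbox a b) (\<lambda>y. k y * f (x - y))) has_derivative
     (\<lambda>v. integral (cbox a b) (\<lambda>y. k y *\<^sub>R F (x - y)) \<bullet> v)) (at x)"
proof -
  have cF: "continuous_on UNIV F" and cf: "continuous_on UNIV f"
    using f C1_grad_continuous by (auto simp: C1_grad_def)
  have "((\<lambda>x. integral (cbox a b) ((\<lambda>x y. k y * f (x - y)) x)) has_derivative
     blinfun_apply (integral (cbox a b) (\<lambda>y. blinfun_inner_right (k y *\<^sub>R F (x - y))))) (at x within UNIV)"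
  proof (rule leibniz_rule)
    fix x y
    have "((\<lambda>x. f (x - y)) has_derivative (\<lambda>v. F (x - y) \<bullet> v)) (at x)"
      using C1_grad_translate[OF f, of y] by (simp add: C1_grad_def)
    from has_derivative_mult_right[OF this, of "k y"]
    show "((\<lambda>x. k y * f (x - y)) has_derivative blinfun_apply (blinfun_inner_right (k y *\<^sub>R F (x - y)))) (at x within UNIV)"
      by (rule has_derivative_eq_rhs) (simp add: blinfun_inner_right.rep_eq fun_eq_iff)
  next
    fix x
    show "(\<lambda>y. k y * f (x - y)) integrable_on cbox a b"
      by (intro integrable_continuous continuous_intros continuous_on_subset[OF k]
            continuous_on_compose2[OF cf]) auto
  next
    show "continuous_on (UNIV \<times> cbox a b) (\<lambda>(x, y). blinfun_inner_right (k y *\<^sub>R F (x - y)))"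
      unfolding split_beta
      by (intro bounded_linear.continuous_on[OF bounded_linear_blinfun_inner_right] continuous_intros
          continuous_on_compose2[OF k] continuous_on_compose2[OF cF]) auto
  qed auto
  moreover have "integral (cbox a b) (\<lambda>y. blinfun_inner_right (k y *\<^sub>R F (x - y)))
      = blinfun_inner_right (integral (cbox a b) (\<lambda>y. k y *\<^sub>R F (x - y)))"
    by (rule integral_linear[OF _ bounded_linear_blinfun_inner_right, unfolded o_def])
       (intro integrable_continuous continuous_intros continuous_on_subset[OF k]
            continuous_on_compose2[OF cF]; simp)
  ultimately show ?thesis by (simp add: blinfun_inner_right.rep_eq)
qed

text \<open>All derivatives fall on \<eta>, so \<psi> need only be continuous. In the induction the
  components of the gradient take the place of \<eta>.\<close>

lemma Ck_on_convolution:
  fixes \<eta> :: "'a::euclidean_space \<Rightarrow> real"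
  assumes k: "continuous_on UNIV \<psi>"
  shows "Ck_on k UNIV \<eta> \<Longrightarrow> Ck_on k UNIV (\<lambda>x. integral (cbox a b) (\<lambda>y. \<psi> y * \<eta> (x - y)))"
proof (induction k arbitrary: \<eta>)
  case 0
  then have c: "continuous_on UNIV \<eta>" by simp
  have "continuous_on UNIV (\<lambda>x. integral (cbox a b) ((\<lambda>x y. \<psi> y * \<eta> (x - y)) x))"
    by (rule integral_continuous_on_param)
       (auto simp: split_beta intro!: continuous_intros continuous_on_compose2[OF k] continuous_on_compose2[OF c])
  then show ?case by simp
next
  case (Suc k)
  obtain F where F: "\<And>x. (\<eta> has_derivative (\<lambda>v. F x \<bullet> v)) (at x)"
    "\<And>b. b \<in> Basis \<Longrightarrow> Ck_on k UNIV (\<lambda>x. F x \<bullet> b)"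
    using Suc.prems by auto
  have cF: "continuous_on UNIV F"
    by (rule continuous_on_components) (use F(2) Ck_on_continuous in blast)
  have "C1_grad UNIV \<eta> F" using F(1) cF by (simp add: C1_grad_def)
  note der = convolution_has_derivative[OF k this, of a b]
  have comp: "integral (cbox a b) (\<lambda>y. \<psi> y *\<^sub>R F (x - y)) \<bullet> c = integral (cbox a b) (\<lambda>y. \<psi> y * (F (x - y) \<bullet> c))" for x c
  proof -
    have "continuous_on (cbox a b) (\<lambda>y. F (x - y))"
      by (rule continuous_on_compose2[OF cF]) (intro continuous_intros, simp)
    then have "(\<lambda>y. \<psi> y *\<^sub>R F (x - y)) integrable_on cbox a b"
      by (intro integrable_continuous continuous_on_scaleR continuous_on_subset[OF k]) auto
    from integral_linear[OF this bounded_linear_inner_left, of c] show ?thesis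
      by (simp add: o_def)
  qed
  have "\<forall>c\<in>Basis. Ck_on k UNIV (\<lambda>x. integral (cbox a b) (\<lambda>y. \<psi> y *\<^sub>R F (x - y)) \<bullet> c)"
    unfolding comp using Suc.IH F(2) by blast
  with der show ?case unfolding Ck_on.simps(2)
    by (intro exI[of _ "\<lambda>x. integral (cbox a b) (\<lambda>y. \<psi> y *\<^sub>R F (x - y))"]) blast
qed

section \<open>Mollification of the weak equation\<close>

lemma integral_pos_continuous:
  fixes f :: "'a::euclidean_space \<Rightarrow> real"
  assumes c: "continuous_on UNIV f" and i: "integrable lborel f" and nn: "\<And>x. f x \<ge> 0" and a: "f a > 0"
  shows "integral\<^sup>L lborel f > 0"
proof -
  have "open {x. f x > 0}"
    using c by (intro open_Collect_less) (auto intro: continuous_on_const)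
  then obtain r where r: "r > 0" "ball a r \<subseteq> {x. f x > 0}" using a by (auto elim!: openE)
  have "\<not> (AE x in lborel. f x = 0)"
  proof
    assume "AE x in lborel. f x = 0"
    then have "AE x in lborel. x \<notin> ball a r"
      by (rule AE_mp) (use r(2) in \<open>intro AE_I2 impI, force\<close>)
    then have "emeasure lborel (ball a r) = 0"
      by (subst (asm) AE_iff_measurable[of "ball a r"]) auto
    moreover have "measure lborel (ball a r) > 0"
      using content_ball_pos[OF r(1), of a] by simp
    ultimately show False by (simp add: measure_def)
  qed
  then have "integral\<^sup>L lborel f \<noteq> 0"
    using integral_nonneg_eq_0_iff_AE[OF i] nn by auto
  moreover have "integral\<^sup>L lborel f \<ge> 0" using nn by simp
  ultimately show ?thesis by simp
qed

text \<open>No bump function has to be constructed: a nonzero eigenfunction supplies a nonzero test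
  function, and its rescaled square is a mollifier.\<close>
lemma mollifier_of_test_fun:
  fixes \<phi> :: "'a::euclidean_space \<Rightarrow> real"
  assumes \<phi>: "test_fun \<Omega> \<phi>" and a: "\<phi> a \<noteq> 0" and r: "r > 0"
  shows "\<exists>\<eta> :: 'a \<Rightarrow> real. (\<forall>k. Ck_on k UNIV \<eta>) \<and> (\<forall>x. \<eta> x \<ge> 0) \<and> (\<forall>x. norm x \<ge> r \<longrightarrow> \<eta> x = 0) \<and>
    integrable lborel \<eta> \<and> integral\<^sup>L lborel \<eta> = 1"
proof -
  obtain R where R: "R > 0" "closure {x. \<phi> x \<noteq> 0} \<subseteq> ball 0 R"
    using bounded_subset_ballD[OF compact_imp_bounded[OF test_fun_support(1)[OF \<phi>]]] by blast
  \<comment> \<open>With this scale, |z| at least \<open>r\<close> gives |s z| at least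
    \<open>R + norm a\<close>, which moves the argument of \<phi> out of the ball containing its
    support.\<close>
  define s where "s = (R + norm a) / r"
  have s: "s > 0" using R r by (simp add: s_def add_pos_nonneg)
  define \<eta> where "\<eta> z = \<phi> (a + s *\<^sub>R z) * \<phi> (a + s *\<^sub>R z)" for z
  have Ck: "Ck_on k UNIV \<eta>" for k
    unfolding \<eta>_def using \<phi> by (intro Ck_on_mult Ck_on_affine) (auto simp: test_fun_def)
  have off: "\<eta> z = 0" if "norm z \<ge> r" for z
  proof -
    have "R + norm a \<le> norm (s *\<^sub>R z)"
    proof -
      have "s * r \<le> s * norm z" using that s by simp
      moreover have "s * r = R + norm a" using r by (simp add: s_def)
      ultimately show ?thesis using s by simp
    qed
    also have "\<dots> \<le> norm (a + s *\<^sub>R z) + norm a"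
      using norm_triangle_ineq4[of "a + s *\<^sub>R z" a] by simp
    finally have "a + s *\<^sub>R z \<notin> ball 0 R" by simp
    then have "a + s *\<^sub>R z \<notin> closure {x. \<phi> x \<noteq> 0}" using R(2) by blast
    from test_fun_support(3)[OF \<phi> this] show ?thesis by (simp add: \<eta>_def)
  qed
  have c: "continuous_on UNIV \<eta>" using Ck_on_continuous[OF Ck[of 0]] .
  have i: "integrable lborel \<eta>"
    by (rule integrable_continuous_compact_support[OF continuous_on_subset[OF c] compact_cball[of 0 r]])
       (auto intro: off)
  have pos: "integral\<^sup>L lborel \<eta> > 0"
    by (rule integral_pos_continuous[OF c i, of 0])
       (use a in \<open>auto simp: \<eta>_def zero_less_mult_iff linorder_neq_iff\<close>)
  show ?thesis
  proof (intro exI[of _ "\<lambda>x. inverse (integral\<^sup>L lborel \<eta>) * \<eta> x"] conjI allI impI)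
    show "Ck_on k UNIV (\<lambda>x. inverse (integral\<^sup>L lborel \<eta>) * \<eta> x)" for k by (rule Ck_on_cmult[OF Ck])
    show "0 \<le> inverse (integral\<^sup>L lborel \<eta>) * \<eta> x" for x using pos by (simp add: \<eta>_def)
    show "integral\<^sup>L lborel (\<lambda>x. inverse (integral\<^sup>L lborel \<eta>) * \<eta> x) = 1" using pos by simp
  qed (use off i in auto)
qed

lemma uniformly_continuous_compact_support:
  fixes f :: "'a::euclidean_space \<Rightarrow> 'b::real_normed_vector"
  assumes c: "continuous_on UNIV f" and K: "compact K" and off: "\<And>x. x \<notin> K \<Longrightarrow> f x = 0" and e: "e > 0"
  obtains \<delta> where "\<delta> > 0" "\<And>x z. norm z < \<delta> \<Longrightarrow> norm (f (x - z) - f x) < e"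
proof -
  obtain R where R: "R > 0" "K \<subseteq> ball 0 R"
    using bounded_subset_ballD[OF compact_imp_bounded[OF K]] by blast
  have "uniformly_continuous_on (cball 0 (R + 1)) f"
    by (intro compact_uniformly_continuous continuous_on_subset[OF c]) auto
  then obtain \<delta> where \<delta>: "\<delta> > 0" "\<And>x y. x \<in> cball 0 (R + 1) \<Longrightarrow> y \<in> cball 0 (R + 1) \<Longrightarrow> dist y x < \<delta> \<Longrightarrow> dist (f y) (f x) < e"
    using e unfolding uniformly_continuous_on_def by metis
  show ?thesis
  proof (rule that[of "min \<delta> 1"])
    show "0 < min \<delta> 1" using \<delta> by simp
    fix x z :: 'a assume z: "norm z < min \<delta> 1"
    show "norm (f (x - z) - f x) < e"
    proof (cases "x \<in> K \<or> x - z \<in> K")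
      case True
      then have "norm x < R \<or> norm (x - z) < R" using R by auto
      moreover have "norm x \<le> norm (x - z) + norm z" "norm (x - z) \<le> norm x + norm z"
        using norm_triangle_ineq[of "x - z" z] norm_triangle_ineq4[of x z] by auto
      ultimately have "norm x \<le> R + 1" "norm (x - z) \<le> R + 1" using z by auto
      then show ?thesis using \<delta>(2)[of x "x - z"] z by (simp add: dist_norm norm_minus_commute)
    qed (use off e in simp)
  qed
qed

text \<open>The weight is merely continuous, so that the lemma serves both the smooth mollifiers and
  the normalised kernels \<open>rho\<close>.\<close>

lemma weighted_average_close:
  fixes f :: "'a::euclidean_space \<Rightarrow> 'b::euclidean_space"
  assumes c: "continuous_on UNIV f" and \<eta>: "continuous_on UNIV \<eta>" "\<And>x. \<eta> x \<ge> 0" "\<And>x. norm x \<ge> r \<Longrightarrow> \<eta> x = (0::real)"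
    "integrable lborel \<eta>" "integral\<^sup>L lborel \<eta> = 1"
    and e: "\<And>z. norm z < r \<Longrightarrow> norm (f (x - z) - f x) < e"
  shows "integrable lborel (\<lambda>z. \<eta> z *\<^sub>R f (x - z))"
    and "norm (integral\<^sup>L lborel (\<lambda>z. \<eta> z *\<^sub>R f (x - z)) - f x) \<le> e"
proof -
  have cfx: "continuous_on S (\<lambda>z. f (x - z))" for S
    by (rule continuous_on_compose2[OF c]) (intro continuous_intros, simp)
  show i: "integrable lborel (\<lambda>z. \<eta> z *\<^sub>R f (x - z))"
    by (rule integrable_continuous_compact_support[OF _ compact_cball[of 0 r]])
       (use \<eta>(3) in \<open>auto intro!: continuous_on_scaleR cfx continuous_on_subset[OF \<eta>(1)]\<close>)
  have i2: "integrable lborel (\<lambda>z. \<eta> z *\<^sub>R (f (x - z) - f x))"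
    using i \<eta>(4) by (simp add: scaleR_diff_right)
  have "integral\<^sup>L lborel (\<lambda>z. \<eta> z *\<^sub>R f (x - z)) - f x
      = integral\<^sup>L lborel (\<lambda>z. \<eta> z *\<^sub>R (f (x - z) - f x))"
    using i \<eta>(4,5) by (simp add: scaleR_diff_right)
  also have "norm \<dots> \<le> integral\<^sup>L lborel (\<lambda>z. norm (\<eta> z *\<^sub>R (f (x - z) - f x)))"
    by (rule integral_norm_bound)
  also have "\<dots> \<le> integral\<^sup>L lborel (\<lambda>z. \<eta> z * e)"
  proof (rule integral_mono)
    show "integrable lborel (\<lambda>z. norm (\<eta> z *\<^sub>R (f (x - z) - f x)))" using i2 by (rule integrable_norm)
    show "integrable lborel (\<lambda>z. \<eta> z * e)" using \<eta>(4) by simp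
    fix z
    show "norm (\<eta> z *\<^sub>R (f (x - z) - f x)) \<le> \<eta> z * e"
    proof (cases "norm z < r")
      case True
      then show ?thesis using e[OF True] \<eta>(2)[of z] by (simp add: mult_left_mono)
    qed (use \<eta>(3) in simp)
  qed
  also have "\<dots> = e" using \<eta>(4,5) by simp
  finally show "norm (integral\<^sup>L lborel (\<lambda>z. \<eta> z *\<^sub>R f (x - z)) - f x) \<le> e" .
qed

text \<open>The mollification is written in two ways. With the shift on \<eta> it inherits
  smoothness; with the shift on \<psi> its gradient is the average of \<open>B\<close>, so values
  and gradients are uniformly close at once. The test function \<phi>0 only provides the shape of
  the mollifier, and may belong to another domain.\<close>

lemma test_fun_approximation:
  fixes \<psi> \<phi>0 :: "'a::euclidean_space \<Rightarrow> real"
  assumes \<phi>0: "test_fun \<Omega>' \<phi>0" "\<phi>0 a0 \<noteq> 0" and \<Omega>: "open \<Omega>"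
    and \<psi>: "C1_grad UNIV \<psi> B" and K: "compact K" "K \<subseteq> \<Omega>" and off: "\<And>x. x \<notin> K \<Longrightarrow> \<psi> x = 0"
    and e: "e > 0"
  obtains \<phi> where "test_fun \<Omega> \<phi>" "\<And>x. \<bar>\<phi> x - \<psi> x\<bar> \<le> e" "\<And>x. norm (grad \<phi> x - B x) \<le> e"
proof -
  have c\<psi>: "continuous_on UNIV \<psi>" and cB: "continuous_on UNIV B"
    using \<psi> C1_grad_continuous by (auto simp: C1_grad_def)
  have Boff: "B x = 0" if "x \<notin> K" for x
    using \<psi> grad_zero_off_support[OF _ compact_imp_closed[OF K(1)] _ that, of \<psi> "B x"] off
    by (auto simp: C1_grad_def)
  obtain \<delta>1 where \<delta>1: "\<delta>1 > 0" "\<And>x z. norm z < \<delta>1 \<Longrightarrow> norm (\<psi> (x - z) - \<psi> x) < e"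
    using uniformly_continuous_compact_support[OF c\<psi> K(1) off e] by blast
  obtain \<delta>2 where \<delta>2: "\<delta>2 > 0" "\<And>x z. norm z < \<delta>2 \<Longrightarrow> norm (B (x - z) - B x) < e"
    using uniformly_continuous_compact_support[OF cB K(1) Boff e] by blast
  obtain \<delta>3 where \<delta>3: "\<delta>3 > 0" "(\<Union>x\<in>K. ball x \<delta>3) \<subseteq> \<Omega>"
    using compact_subset_open_imp_ball_epsilon_subset[OF K(1) \<Omega> K(2)] by blast
  \<comment> \<open>The first two radii control oscillation. The third is halved so that the closed
    \<open>r\<close>-neighbourhood of \<open>K\<close> still lies in \<Omega>.\<close>
  define r where "r = min \<delta>1 (min \<delta>2 (\<delta>3 / 2))"
  have r: "r > 0" "r \<le> \<delta>1" "r \<le> \<delta>2" "r < \<delta>3" using \<delta>1 \<delta>2 \<delta>3 by (auto simp: r_def min_def)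
  from mollifier_of_test_fun[OF \<phi>0 r(1)]
  obtain \<eta> :: "'a \<Rightarrow> real" where \<eta>_all: "(\<forall>k. Ck_on k UNIV \<eta>) \<and> (\<forall>x. \<eta> x \<ge> 0) \<and> (\<forall>x. norm x \<ge> r \<longrightarrow> \<eta> x = 0) \<and>
    integrable lborel \<eta> \<and> integral\<^sup>L lborel \<eta> = 1" ..
  have \<eta>: "Ck_on k UNIV \<eta>" "\<eta> x \<ge> 0" "norm x \<ge> r \<Longrightarrow> \<eta> x = 0"
    "integrable lborel \<eta>" "integral\<^sup>L lborel \<eta> = 1" for k x
    using \<eta>_all by auto
  have c\<eta>: "continuous_on UNIV \<eta>" using Ck_on_continuous[OF \<eta>(1)[of 0]] .
  have av\<psi>: "integrable lborel (\<lambda>z. \<eta> z *\<^sub>R \<psi> (x - z))"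
    "norm (integral\<^sup>L lborel (\<lambda>z. \<eta> z *\<^sub>R \<psi> (x - z)) - \<psi> x) \<le> e" for x
  proof -
    have close: "norm (\<psi> (x - z) - \<psi> x) < e" if "norm z < r" for z
      using \<delta>1(2) r(2) that by simp
    show "integrable lborel (\<lambda>z. \<eta> z *\<^sub>R \<psi> (x - z))"
      by (rule weighted_average_close(1)[OF c\<psi> c\<eta> \<eta>(2-5) close])
    show "norm (integral\<^sup>L lborel (\<lambda>z. \<eta> z *\<^sub>R \<psi> (x - z)) - \<psi> x) \<le> e"
      by (rule weighted_average_close(2)[OF c\<psi> c\<eta> \<eta>(2-5) close])
  qed
  have avB: "integrable lborel (\<lambda>z. \<eta> z *\<^sub>R B (x - z))"
    "norm (integral\<^sup>L lborel (\<lambda>z. \<eta> z *\<^sub>R B (x - z)) - B x) \<le> e" for x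
  proof -
    have close: "norm (B (x - z) - B x) < e" if "norm z < r" for z
      using \<delta>2(2) r(3) that by simp
    show "integrable lborel (\<lambda>z. \<eta> z *\<^sub>R B (x - z))"
      by (rule weighted_average_close(1)[OF cB c\<eta> \<eta>(2-5) close])
    show "norm (integral\<^sup>L lborel (\<lambda>z. \<eta> z *\<^sub>R B (x - z)) - B x) \<le> e"
      by (rule weighted_average_close(2)[OF cB c\<eta> \<eta>(2-5) close])
  qed
  define \<phi> where "\<phi> x = integral\<^sup>L lborel (\<lambda>z. \<eta> z *\<^sub>R \<psi> (x - z))" for x
  obtain u v where uv: "K \<subseteq> cbox u v"
    using bounded_subset_cbox_symmetric[OF compact_imp_bounded[OF K(1)]] by blast
  obtain u' v' where uv': "cball (0::'a) r \<subseteq> cbox u' v'"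
    using bounded_subset_cbox_symmetric[OF bounded_cball] by blast
  have eq1: "\<phi> x = integral (cbox u v) (\<lambda>y. \<psi> y * \<eta> (x - y))" for x
  proof -
    have m: "(\<lambda>y. \<psi> y * \<eta> (x - y)) \<in> borel_measurable borel"
      by (intro borel_measurable_continuous_onI continuous_on_mult c\<psi> continuous_on_compose2[OF c\<eta>] continuous_on_diff continuous_on_const continuous_on_id) simp
    have i: "integrable lborel (\<lambda>y. \<psi> y * \<eta> (x - y))"
      by (rule integrable_continuous_compact_support[OF _ K(1)])
         (use off in \<open>auto intro!: continuous_on_mult continuous_on_subset[OF c\<psi>] continuous_on_compose2[OF c\<eta>]
            continuous_on_diff continuous_on_const continuous_on_id\<close>)
    have "\<phi> x = integral\<^sup>L lborel (\<lambda>z. (\<lambda>y. \<psi> y * \<eta> (x - y)) (x - z))"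
      by (simp add: \<phi>_def mult.commute)
    also have "\<dots> = integral\<^sup>L lborel (\<lambda>y. \<psi> y * \<eta> (x - y))"
      by (rule lborel_integral_reflect[OF m])
    also have "\<dots> = integral (cbox u v) (\<lambda>y. \<psi> y * \<eta> (x - y))"
      by (rule integral_cbox_eq_lborel[OF i, symmetric]) (use off uv in auto)
    finally show ?thesis .
  qed
  have off': "\<eta> z = 0" if "z \<notin> cbox u' v'" for z
  proof -
    have "z \<notin> cball 0 r" using that uv' by blast
    then show ?thesis using \<eta>(3)[of z] by simp
  qed
  have eq2: "\<phi> x = integral (cbox u' v') (\<lambda>z. \<eta> z * \<psi> (x - z))" for x
    unfolding \<phi>_def using integral_cbox_eq_lborel[OF av\<psi>(1)[of x], of u' v'] off' by auto
  have eq3: "integral\<^sup>L lborel (\<lambda>z. \<eta> z *\<^sub>R B (x - z)) = integral (cbox u' v') (\<lambda>z. \<eta> z *\<^sub>R B (x - z))" for x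
    using integral_cbox_eq_lborel[OF avB(1)[of x], of u' v'] off' by auto
  have der: "(\<phi> has_derivative (\<lambda>v. integral\<^sup>L lborel (\<lambda>z. \<eta> z *\<^sub>R B (x - z)) \<bullet> v)) (at x)" for x
    unfolding eq2[abs_def] eq3 by (rule convolution_has_derivative[OF c\<eta> \<psi>])
  have nz: "\<exists>y\<in>K. dist y x \<le> r" if "\<phi> x \<noteq> 0" for x
  proof (rule ccontr)
    assume *: "\<not> (\<exists>y\<in>K. dist y x \<le> r)"
    have "(\<lambda>z. \<eta> z *\<^sub>R \<psi> (x - z)) = (\<lambda>z. 0)"
    proof
      fix z
      show "\<eta> z *\<^sub>R \<psi> (x - z) = 0"
      proof (cases "norm z \<ge> r")
        case False
        then have "x - z \<notin> K" using * by (auto simp: dist_norm)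
        then show ?thesis using off by simp
      qed (use \<eta>(3) in simp)
    qed
    then show False using that by (simp add: \<phi>_def)
  qed
  define K' where "K' = (\<Union>x\<in>K. cball x r)"
  have cK': "compact K'"
  proof -
    have "K' = (\<lambda>(x, y). x + y) ` (K \<times> cball 0 r)"
    proof (intro equalityI subsetI)
      fix y assume "y \<in> K'"
      then obtain x where "x \<in> K" "dist x y \<le> r" by (auto simp: K'_def)
      then have "(x, y - x) \<in> K \<times> cball 0 r" "y = x + (y - x)" by (auto simp: dist_norm norm_minus_commute)
      then show "y \<in> (\<lambda>(x, y). x + y) ` (K \<times> cball 0 r)" by (metis (no_types, lifting) case_prod_conv image_eqI)
    qed (auto simp: K'_def dist_norm intro!: bexI)
    then show ?thesis
      by (auto intro!: compact_continuous_image compact_Times K(1) continuous_intros simp: split_beta)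
  qed
  have sub: "closure {x. \<phi> x \<noteq> 0} \<subseteq> K'"
    by (rule closure_minimal[OF _ compact_imp_closed[OF cK']]) (use nz in \<open>auto simp: K'_def\<close>)
  have "K' \<subseteq> \<Omega>" using \<delta>3(2) r(4) by (force simp: K'_def)
  then have "test_fun \<Omega> \<phi>"
    unfolding test_fun_def
  proof (intro conjI allI)
    show "Ck_on k UNIV \<phi>" for k
      unfolding eq1[abs_def] by (rule Ck_on_convolution[OF c\<psi> \<eta>(1)])
    show "compact (closure {x. \<phi> x \<noteq> 0})"
      using sub cK' by (meson bounded_subset closed_closure compact_eq_bounded_closed)
  qed (use sub in auto)
  moreover have "\<bar>\<phi> x - \<psi> x\<bar> \<le> e" for x using av\<psi>(2)[of x] by (simp add: \<phi>_def)
  moreover have "norm (grad \<phi> x - B x) \<le> e" for x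
    using avB(2)[of x] by (simp only: grad_eqI[OF der])
  ultimately show ?thesis by (rule that)
qed

text \<open>The truncated Green functions are only C1, whereas the eigenvalue equation speaks of
  smooth test functions. Uniform approximation of value and gradient, together with integrability of
  \<open>Du\<close> and \<open>w\<close>, carries the equation over by dominated
  convergence.\<close>

lemma weak_equation_C1:
  fixes \<psi> \<phi>0 :: "'a::euclidean_space \<Rightarrow> real"
  assumes \<phi>0: "test_fun \<Omega>' \<phi>0" "\<phi>0 a0 \<noteq> 0" and \<Omega>: "open \<Omega>"
    and \<mu>: "sets \<mu> = sets borel"
    and Du: "set_integrable lebesgue \<Omega> Du" and w: "set_integrable \<mu> \<Omega> w"
    and eq: "\<And>\<phi>. test_fun \<Omega> \<phi> \<Longrightarrow>
           (LINT x:\<Omega>|lebesgue. Du x \<bullet> grad \<phi> x) = (LINT x:\<Omega>|\<mu>. w x * \<phi> x)"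
    and \<psi>: "C1_grad UNIV \<psi> B" and K: "compact K" "K \<subseteq> \<Omega>" and off: "\<And>x. x \<notin> K \<Longrightarrow> \<psi> x = 0"
  shows "(LINT x:\<Omega>|lebesgue. Du x \<bullet> B x) = (LINT x:\<Omega>|\<mu>. w x * \<psi> x)"
proof -
  have c\<psi>: "continuous_on UNIV \<psi>" and cB: "continuous_on UNIV B"
    using \<psi> C1_grad_continuous by (auto simp: C1_grad_def)
  have Boff: "B x = 0" if "x \<notin> K" for x
    using \<psi> grad_zero_off_support[OF _ compact_imp_closed[OF K(1)] _ that, of \<psi> "B x"] off
    by (auto simp: C1_grad_def)
  obtain M1 where M1: "M1 \<ge> 0" "\<And>x. norm (\<psi> x) \<le> M1"
    using continuous_compact_support_bounded[OF c\<psi> K(1) off] by blast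
  obtain M2 where M2: "M2 \<ge> 0" "\<And>x. norm (B x) \<le> M2"
    using continuous_compact_support_bounded[OF cB K(1) Boff] by blast
  have "\<exists>\<phi>. test_fun \<Omega> \<phi> \<and> (\<forall>x. \<bar>\<phi> x - \<psi> x\<bar> \<le> 1 / real (Suc n)) \<and> (\<forall>x. norm (grad \<phi> x - B x) \<le> 1 / real (Suc n))" for n
    using test_fun_approximation[OF \<phi>0 \<Omega> \<psi> K off, of "1 / real (Suc n)"] by (metis zero_less_divide_1_iff of_nat_0_less_iff zero_less_Suc)
  then obtain \<phi> where \<phi>: "\<And>n. test_fun \<Omega> (\<phi> n)" "\<And>n x. \<bar>\<phi> n x - \<psi> x\<bar> \<le> 1 / real (Suc n)"
    "\<And>n x. norm (grad (\<phi> n) x - B x) \<le> 1 / real (Suc n)" by metis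
  note inv = LIMSEQ_one_over_Suc
  have lim1: "(\<lambda>n. \<phi> n x) \<longlonglongrightarrow> \<psi> x" for x
    by (rule LIM_zero_cancel, rule Lim_null_comparison[OF _ inv]) (use \<phi>(2) in auto)
  have lim2: "(\<lambda>n. grad (\<phi> n) x) \<longlonglongrightarrow> B x" for x
    by (rule LIM_zero_cancel, rule Lim_null_comparison[OF _ inv]) (use \<phi>(3) in auto)
  have le1: "1 / real (Suc n) \<le> 1" for n by simp
  have b1: "\<bar>\<phi> n x\<bar> \<le> M1 + 1" for n x
    using \<phi>(2)[of n x] M1(2)[of x] le1[of n] unfolding real_norm_def by linarith
  have b2: "norm (grad (\<phi> n) x) \<le> M2 + 1" for n x
    using \<phi>(3)[of n x] M2(2)[of x] le1[of n] norm_triangle_sub[of "grad (\<phi> n) x" "B x"] by linarith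
  have mDu: "(\<lambda>x. indicator \<Omega> x *\<^sub>R Du x) \<in> borel_measurable lebesgue"
    using Du borel_measurable_integrable unfolding set_integrable_def by blast
  have mw: "(\<lambda>x. indicator \<Omega> x *\<^sub>R w x) \<in> borel_measurable \<mu>"
    using w borel_measurable_integrable unfolding set_integrable_def by blast
  have mg: "grad (\<phi> n) \<in> borel_measurable lebesgue" for n
    using test_fun_C1_grad[OF \<phi>(1)] unfolding C1_grad_def
    by (intro measurable_completion) (simp add: borel_measurable_continuous_onI)
  have mB: "B \<in> borel_measurable lebesgue"
    using cB by (intro measurable_completion) (simp add: borel_measurable_continuous_onI)
  have m\<phi>: "\<phi> n \<in> borel_measurable \<mu>" for n
    using C1_grad_continuous[OF test_fun_C1_grad[OF \<phi>(1)]] \<mu>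
    by (simp add: borel_measurable_continuous_onI cong: measurable_cong_sets)
  have m\<psi>: "\<psi> \<in> borel_measurable \<mu>"
    using c\<psi> \<mu> by (simp add: borel_measurable_continuous_onI cong: measurable_cong_sets)
  have L1: "(\<lambda>n. integral\<^sup>L lebesgue (\<lambda>x. indicator \<Omega> x *\<^sub>R (Du x \<bullet> grad (\<phi> n) x)))
      \<longlonglongrightarrow> integral\<^sup>L lebesgue (\<lambda>x. indicator \<Omega> x *\<^sub>R (Du x \<bullet> B x))"
  proof (rule integral_dominated_convergence[where w="\<lambda>x. norm (indicator \<Omega> x *\<^sub>R Du x) * (M2 + 1)"])
    show "integrable lebesgue (\<lambda>x. norm (indicator \<Omega> x *\<^sub>R Du x) * (M2 + 1))"
      using Du unfolding set_integrable_def by (intro integrable_mult_left integrable_norm)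
    show "AE x in lebesgue. (\<lambda>n. indicator \<Omega> x *\<^sub>R (Du x \<bullet> grad (\<phi> n) x)) \<longlonglongrightarrow> indicator \<Omega> x *\<^sub>R (Du x \<bullet> B x)"
      by (intro AE_I2 tendsto_intros lim2)
    show "AE x in lebesgue. norm (indicator \<Omega> x *\<^sub>R (Du x \<bullet> grad (\<phi> n) x)) \<le> norm (indicator \<Omega> x *\<^sub>R Du x) * (M2 + 1)" for n
    proof (intro AE_I2)
      fix x
      have "\<bar>Du x \<bullet> grad (\<phi> n) x\<bar> \<le> norm (Du x) * (M2 + 1)"
        using Cauchy_Schwarz_ineq2[of "Du x" "grad (\<phi> n) x"] mult_left_mono[OF b2[of n x] norm_ge_zero[of "Du x"]] by linarith
      then show "norm (indicator \<Omega> x *\<^sub>R (Du x \<bullet> grad (\<phi> n) x)) \<le> norm (indicator \<Omega> x *\<^sub>R Du x) * (M2 + 1)"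
        by (simp add: indicator_def)
    qed
    show "(\<lambda>x. indicator \<Omega> x *\<^sub>R (Du x \<bullet> B x)) \<in> borel_measurable lebesgue"
      using borel_measurable_inner[OF mDu mB] by simp
    show "(\<lambda>x. indicator \<Omega> x *\<^sub>R (Du x \<bullet> grad (\<phi> n) x)) \<in> borel_measurable lebesgue" for n
      using borel_measurable_inner[OF mDu mg] by simp
  qed
  have L2: "(\<lambda>n. integral\<^sup>L \<mu> (\<lambda>x. indicator \<Omega> x *\<^sub>R (w x * \<phi> n x)))
      \<longlonglongrightarrow> integral\<^sup>L \<mu> (\<lambda>x. indicator \<Omega> x *\<^sub>R (w x * \<psi> x))"
  proof (rule integral_dominated_convergence[where w="\<lambda>x. norm (indicator \<Omega> x *\<^sub>R w x) * (M1 + 1)"])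
    show "integrable \<mu> (\<lambda>x. norm (indicator \<Omega> x *\<^sub>R w x) * (M1 + 1))"
      using w unfolding set_integrable_def by (intro integrable_mult_left integrable_norm)
    show "AE x in \<mu>. (\<lambda>n. indicator \<Omega> x *\<^sub>R (w x * \<phi> n x)) \<longlonglongrightarrow> indicator \<Omega> x *\<^sub>R (w x * \<psi> x)"
      by (intro AE_I2 tendsto_intros lim1)
    show "AE x in \<mu>. norm (indicator \<Omega> x *\<^sub>R (w x * \<phi> n x)) \<le> norm (indicator \<Omega> x *\<^sub>R w x) * (M1 + 1)" for n
      using b1 by (intro AE_I2) (auto simp: indicator_def abs_mult intro: mult_left_mono)
    show "(\<lambda>x. indicator \<Omega> x *\<^sub>R (w x * \<psi> x)) \<in> borel_measurable \<mu>"
      using borel_measurable_times[OF mw m\<psi>] by (simp add: mult.assoc)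
    show "(\<lambda>x. indicator \<Omega> x *\<^sub>R (w x * \<phi> n x)) \<in> borel_measurable \<mu>" for n
      using borel_measurable_times[OF mw m\<phi>] by (simp add: mult.assoc)
  qed
  have eqn: "integral\<^sup>L lebesgue (\<lambda>x. indicator \<Omega> x *\<^sub>R (Du x \<bullet> grad (\<phi> n) x)) = integral\<^sup>L \<mu> (\<lambda>x. indicator \<Omega> x *\<^sub>R (w x * \<phi> n x))" for n
    using eq[OF \<phi>(1)] unfolding set_lebesgue_integral_def .
  show ?thesis
    unfolding set_lebesgue_integral_def by (rule LIMSEQ_unique[OF L1[unfolded eqn] L2])
qed

section \<open>The energy estimate\<close>

text \<open>Integrability is not assumed: otherwise the Bochner integral is 0 by default.\<close>

lemma norm_integral_le_nn_integral:
  fixes f :: "'a \<Rightarrow> 'b::{banach, second_countable_topology}"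
  shows "ennreal (norm (integral\<^sup>L M f)) \<le> (\<integral>\<^sup>+x. ennreal (norm (f x)) \<partial>M)"
  by (cases "integrable M f") (simp_all add: integral_norm_bound_ennreal not_integrable_integral_eq)

lemma emeasure_lborel_cball_translate:
  "emeasure lborel (cball (c::'a::euclidean_space) R) = emeasure lborel (cball (0::'a) R)"
  by (cases "R \<ge> 0") (simp_all add: emeasure_cball)

lemma ennreal_le_of_square_le:
  fixes a :: ennreal
  assumes "a\<^sup>2 \<le> (ennreal b)\<^sup>2" "b \<ge> 0"
  shows "a \<le> ennreal b"
proof (cases a)
  case (real r)
  then have "r\<^sup>2 \<le> b\<^sup>2" using assms by (simp add: ennreal_power)
  then have "r \<le> b" using assms(2) by (rule power2_le_imp_le)
  then show ?thesis using real by (simp add: ennreal_leI)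
next
  case top
  then have "(ennreal b)\<^sup>2 = top" using assms(1) by (simp add: top_unique power2_eq_square ennreal_top_mult)
  then show ?thesis using assms(2) by (simp add: ennreal_power)
qed

text \<open>The centre may move with \<open>x\<close>. A constant centre serves integrands supported
  in a fixed compact set, and the centre \<open>x\<close> itself serves kernels of finite
  range.\<close>

lemma integrable_bounded_on_balls:
  fixes F :: "'a::euclidean_space \<times> 'a \<Rightarrow> 'b::{banach, second_countable_topology}"
  assumes \<nu>: "finite_measure \<nu>" and F: "F \<in> borel_measurable (\<nu> \<Otimes>\<^sub>M lborel)"
    and M: "\<And>x y. norm (F (x, y)) \<le> M" and off: "\<And>x y. y \<notin> cball (k x) R \<Longrightarrow> F (x, y) = 0"
  shows "integrable (\<nu> \<Otimes>\<^sub>M lborel) F"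
proof (rule integrableI_bounded[OF F])
  interpret finite_measure \<nu> by fact
  have M0: "M \<ge> 0" using M[of undefined undefined] norm_ge_zero[of "F (undefined, undefined)"] by linarith
  have [measurable]: "F \<in> borel_measurable (\<nu> \<Otimes>\<^sub>M lborel)" by fact
  have "(\<integral>\<^sup>+ z. ennreal (norm (F z)) \<partial>(\<nu> \<Otimes>\<^sub>M lborel)) = (\<integral>\<^sup>+x. \<integral>\<^sup>+y. ennreal (norm (F (x, y))) \<partial>lborel \<partial>\<nu>)"
    by (rule lborel.nn_integral_fst[symmetric]) measurable
  also have "\<dots> \<le> (\<integral>\<^sup>+x. ennreal M * emeasure lborel (cball (0::'a) R) \<partial>\<nu>)"
  proof (rule nn_integral_mono)
    fix x
    have "(\<integral>\<^sup>+y. ennreal (norm (F (x, y))) \<partial>lborel) \<le> (\<integral>\<^sup>+y. ennreal M * indicator (cball (k x) R) y \<partial>lborel)"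
      by (intro nn_integral_mono) (use off M in \<open>auto simp: indicator_def ennreal_leI\<close>)
    also have "\<dots> = ennreal M * emeasure lborel (cball (0::'a) R)"
      by (subst nn_integral_cmult_indicator) (simp_all only: emeasure_lborel_cball_translate[of "k x"], simp)
    finally show "(\<integral>\<^sup>+y. ennreal (norm (F (x, y))) \<partial>lborel) \<le> ennreal M * emeasure lborel (cball (0::'a) R)" .
  qed
  also have "\<dots> < \<infinity>"
  proof -
    have "emeasure \<nu> (space \<nu>) < top" unfolding less_top[symmetric] by simp
    then show ?thesis using emeasure_lborel_cball_finite[of "0::'a" R]
      by (simp add: ennreal_mult_less_top)
  qed
  finally show "(\<integral>\<^sup>+ z. ennreal (norm (F z)) \<partial>(\<nu> \<Otimes>\<^sub>M lborel)) < \<infinity>" .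
qed

section \<open>Averages against the approximate identity and their energy bound\<close>

context radial_profile
begin

text \<open>Not normalised: the weight has mass \<open>c\<close>, which is why the averages
  approximate \<open>c * \<phi> x\<close>.\<close>

definition avg :: "real \<Rightarrow> ('a \<Rightarrow> real) \<Rightarrow> 'a \<Rightarrow> real" where
  "avg t \<phi> x = integral\<^sup>L lborel (\<lambda>y. rho t (y - x) * \<phi> y)"

lemma avg_measurable:
  assumes "continuous_on UNIV \<phi>"
  shows "avg t \<phi> \<in> borel_measurable borel"
proof -
  have [measurable]: "\<phi> \<in> borel_measurable borel" "rho t \<in> borel_measurable borel"
    using assms continuous_rho by (auto intro: borel_measurable_continuous_onI)
  show ?thesis unfolding avg_def[abs_def] by measurable
qed

text \<open>Approximation of the identity. The minimum with \<open>t\<close> keeps the parameter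
  below \<open>t\<close>, as the comparison of two smoothings demands.\<close>

lemma avg_tendsto:
  assumes \<phi>: "continuous_on UNIV \<phi>" and t: "t > 0"
  shows "(\<lambda>n. avg (min t (1 / Suc n)) \<phi> x) \<longlonglongrightarrow> c * \<phi> x"
proof (rule metric_LIMSEQ_I)
  fix e :: real assume e: "e > 0"
  \<comment> \<open>The average is only weakly within e' of the value; the factor 2 restores the
    strict inequality after multiplication by \<open>c\<close>.\<close>
  define e' where "e' = e / (2 * c)"
  have e': "e' > 0" using e c_pos by (simp add: e'_def)
  obtain \<delta> where \<delta>: "\<delta> > 0" "\<And>y. dist y x < \<delta> \<Longrightarrow> dist (\<phi> y) (\<phi> x) < e'"
    using \<phi> e' unfolding continuous_on_iff by (metis UNIV_I)
  have "\<forall>\<^sub>F n in sequentially. inverse (real (Suc n)) < \<delta>\<^sup>2"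
    using \<delta>(1) by (intro order_tendstoD(2)[OF LIMSEQ_inverse_real_of_nat]) simp
  then obtain N where N: "\<And>n. n \<ge> N \<Longrightarrow> inverse (real (Suc n)) < \<delta>\<^sup>2"
    by (auto simp: eventually_sequentially)
  have "dist (avg (min t (1 / Suc n)) \<phi> x) (c * \<phi> x) < e" if n: "n \<ge> N" for n
  proof -
    define \<tau> where "\<tau> = min t (1 / Suc n)"
    \<comment> \<open>\<open>rho \<tau>\<close> lives on |z|^2 < \<tau>, so this places its support
      in the ball of radius \<delta>.\<close>
    have \<tau>: "\<tau> > 0" "\<tau> < \<delta>\<^sup>2" using t N[OF n] by (auto simp: \<tau>_def inverse_eq_divide)
    define \<eta> where "\<eta> z = rho \<tau> z / c" for z
    have cr: "continuous_on UNIV \<eta>" unfolding \<eta>_def using c_pos by (intro continuous_intros continuous_rho) auto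
    have 1: "\<eta> z \<ge> 0" for z using rho_nonneg c_pos by (simp add: \<eta>_def)
    have 2: "\<eta> z = 0" if "norm z \<ge> \<delta>" for z
    proof -
      have "\<delta>\<^sup>2 \<le> z \<bullet> z" using that \<delta>(1) by (simp add: dot_square_norm power_mono)
      then show ?thesis using \<tau>(2) rho_support[of \<tau> z] by (simp add: \<eta>_def)
    qed
    have 3: "integrable lborel \<eta>" "integral\<^sup>L lborel \<eta> = 1"
      unfolding \<eta>_def using integrable_rho integral_rho[OF \<tau>(1)] c_pos by auto
    have "norm (\<phi> (x - z) - \<phi> x) < e'" if "norm z < \<delta>" for z
      using \<delta>(2)[of "x - z"] that by (simp add: dist_norm)
    note av = weighted_average_close(2)[OF \<phi> cr 1 2 3 this]
    have m: "(\<lambda>y. rho \<tau> (x - y) * \<phi> y) \<in> borel_measurable borel"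
      by (intro borel_measurable_continuous_onI continuous_on_mult \<phi>
          continuous_on_compose2[OF continuous_rho[of UNIV]] continuous_on_diff continuous_on_const continuous_on_id) simp
    have "avg \<tau> \<phi> x = integral\<^sup>L lborel (\<lambda>y. rho \<tau> (x - y) * \<phi> y)"
      unfolding avg_def by (subst rho_minus) simp
    also have "\<dots> = integral\<^sup>L lborel (\<lambda>z. rho \<tau> z * \<phi> (x - z))"
      using lborel_integral_reflect[OF m, of x] by simp
    also have "\<dots> = c * integral\<^sup>L lborel (\<lambda>z. \<eta> z *\<^sub>R \<phi> (x - z))"
      by (subst integral_mult_right_zero[symmetric]) (use c_pos in \<open>simp add: \<eta>_def\<close>)
    finally have "dist (avg \<tau> \<phi> x) (c * \<phi> x) = c * norm (integral\<^sup>L lborel (\<lambda>z. \<eta> z *\<^sub>R \<phi> (x - z)) - \<phi> x)"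
      using c_pos by (simp add: dist_norm right_diff_distrib[symmetric] abs_mult)
    also have "\<dots> \<le> c * e'" using av c_pos by (intro mult_left_mono) auto
    also have "\<dots> < e" using c_pos e by (simp add: e'_def)
    finally show ?thesis by (simp add: \<tau>_def)
  qed
  then show "\<exists>no. \<forall>n\<ge>no. dist (avg (min t (1 / Suc n)) \<phi> x) (c * \<phi> x) < e" by blast
qed

text \<open>Duality: the signed \<^term>\<open>\<nu>\<close>-integral of the difference of averages is the Dirichlet pairing
  of \<^term>\<open>\<phi>\<close> with a potential \<open>V\<close> whose energy is controlled by the short range kernel \<open>near_kernel\<close>.\<close>
lemma energy_estimate_smooth:
  assumes \<nu>: "finite_measure \<nu>" and [measurable_cong]: "sets \<nu> = sets borel"
    and pot: "\<And>y. (\<integral>\<^sup>+x. near_kernel t (x - y) \<partial>\<nu>) \<le> k" and \<tau>: "0 < \<tau>" "\<tau> \<le> t"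
    and \<phi>: "C1_grad UNIV \<phi> B" and K: "compact K" and off: "\<And>x. x \<notin> K \<Longrightarrow> \<phi> x = 0"
  shows "(\<integral>\<^sup>+x. ennreal \<bar>avg \<tau> \<phi> x - avg t \<phi> x\<bar> \<partial>\<nu>)\<^sup>2
    \<le> (\<integral>\<^sup>+y. ennreal ((norm (B y))\<^sup>2) \<partial>lborel) * (k * (2 * ennreal c) * emeasure \<nu> (space \<nu>))"
proof -
  interpret finite_measure \<nu> by fact
  interpret P: pair_sigma_finite \<nu> "lborel :: 'a measure" ..
  interpret PP: pair_sigma_finite \<nu> \<nu> ..
  have t: "t > 0" using \<tau> by simp
  define E where "E z = Phi \<tau> z - Phi t z" for z
  define gE where "gE z = gradPhi \<tau> z - gradPhi t z" for z
  define D where "D z = rho \<tau> z - rho t z" for z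
  have C2: "C2_lap UNIV E gE (\<lambda>z. - D z)"
    using C2_lap_diff[OF Phi_C2[OF \<tau>(1)] Phi_C2[OF t]] unfolding E_def gE_def D_def by simp
  have C1: "C1_grad UNIV E gE" by (rule C2_lap_imp_C1_grad[OF C2])
  have cE: "continuous_on UNIV E" and cgE: "continuous_on UNIV gE"
    using C1 C1_grad_continuous by (auto simp: C1_grad_def)
  have cD: "continuous_on UNIV D" unfolding D_def by (intro continuous_intros continuous_rho)
  have c\<phi>: "continuous_on UNIV \<phi>" and cB: "continuous_on UNIV B"
    using \<phi> C1_grad_continuous by (auto simp: C1_grad_def)
  have [measurable]: "E \<in> borel_measurable borel" "gE \<in> borel_measurable borel" "D \<in> borel_measurable borel"
    "\<phi> \<in> borel_measurable borel" "B \<in> borel_measurable borel" "rho \<tau> \<in> borel_measurable borel" "rho t \<in> borel_measurable borel"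
    using cE cgE cD c\<phi> cB continuous_rho by (auto intro: borel_measurable_continuous_onI)
  \<comment> \<open>Beyond this radius both smoothings equal the unmodified profile, so their
    difference has compact support.\<close>
  define R where "R = sqrt t"
  have R: "t < z \<bullet> z" if "z \<notin> cball 0 R" for z :: 'a
    using that t by (simp add: R_def norm_eq_sqrt_inner not_le)
  have Eoff: "E z = 0" if "z \<notin> cball 0 R" for z
    using R[OF that] \<tau> by (simp add: E_def Phi_def smooth_profile_def)
  have gEoff: "gE z = 0" if "z \<notin> cball 0 R" for z
    using R[OF that] \<tau> by (simp add: gE_def gradPhi_def smooth_profile'_def)
  have Boff: "B x = 0" if "x \<notin> K" for x
    using \<phi> grad_zero_off_support[OF _ compact_imp_closed[OF K] _ that, of \<phi> "B x"] off
    by (auto simp: C1_grad_def)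
  obtain M1 where M1: "M1 \<ge> 0" "\<And>z. norm (gE z) \<le> M1"
    using continuous_compact_support_bounded[OF cgE compact_cball gEoff] by blast
  obtain M2 where M2: "M2 \<ge> 0" "\<And>z. norm (B z) \<le> M2"
    using continuous_compact_support_bounded[OF cB K Boff] by blast
  obtain RK where RK: "K \<subseteq> ball 0 RK"
    using bounded_subset_ballD[OF compact_imp_bounded[OF K]] by blast
  define a where "a x = avg \<tau> \<phi> x - avg t \<phi> x" for x
  have [measurable]: "a \<in> borel_measurable borel"
    unfolding a_def by (intro borel_measurable_diff avg_measurable c\<phi>)
  have irho: "integrable lborel (\<lambda>y. rho s (y - x) * \<phi> y)" for s x
    by (rule integrable_continuous_compact_support[OF _ K])
       (use off in \<open>auto intro!: continuous_on_mult continuous_on_subset[OF c\<phi>]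
         continuous_on_compose2[OF continuous_rho[of UNIV]] continuous_on_diff continuous_on_const continuous_on_id\<close>)
  have a_eq: "a x = integral\<^sup>L lborel (\<lambda>y. B y \<bullet> gE (y - x))" for x
  proof -
    have "a x = integral\<^sup>L lborel (\<lambda>y. \<phi> y * D (y - x))"
      unfolding a_def avg_def D_def using irho
      by (subst Bochner_Integration.integral_diff[symmetric]) (auto simp: algebra_simps)
    then show ?thesis
      using green_first_identity(3)[OF C2_lap_translate[OF C2, of x] open_UNIV \<phi> K _ off] by simp
  qed
  \<comment> \<open>The sign is the dual function that realises the L1 norm:
    \<open>\<sigma> x * a x = \<bar>a x\<bar>\<close>.\<close>
  define \<sigma> where "\<sigma> x = sgn (a x)" for x
  have [measurable]: "\<sigma> \<in> borel_measurable borel" unfolding \<sigma>_def by measurable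
  have \<sigma>1: "\<bar>\<sigma> x\<bar> \<le> 1" for x by (simp add: \<sigma>_def abs_sgn_eq)
  \<comment> \<open>The gradient of the potential, with kernel \<open>E\<close>, of the signed
    measure \<sigma> \<nu>. By Fubini its pairing with \<open>B\<close> is the L1 norm of
    \<open>a\<close>.\<close>
  define V where "V y = integral\<^sup>L \<nu> (\<lambda>x. \<sigma> x *\<^sub>R gE (y - x))" for y
  have iV: "integrable \<nu> (\<lambda>x. \<sigma> x *\<^sub>R gE (y - x))" for y
  proof (rule integrable_const_bound[where B=M1])
    show "AE x in \<nu>. norm (\<sigma> x *\<^sub>R gE (y - x)) \<le> M1"
      using mult_mono[OF \<sigma>1 M1(2)] by (intro AE_I2) (simp add: )
  qed measurable
  have [measurable]: "V \<in> borel_measurable borel"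
    unfolding V_def by measurable
  define MV where "MV = M1 * measure \<nu> (space \<nu>)"
  have MV: "norm (V y) \<le> MV" for y
  proof -
    have "norm (V y) \<le> integral\<^sup>L \<nu> (\<lambda>x. norm (\<sigma> x *\<^sub>R gE (y - x)))"
      unfolding V_def by (rule integral_norm_bound)
    also have "\<dots> \<le> integral\<^sup>L \<nu> (\<lambda>x. M1)"
      using mult_mono[OF \<sigma>1 M1(2)] by (intro integral_mono integrable_norm iV) auto
    finally show ?thesis by (simp add: MV_def mult.commute)
  qed
  have MV0: "MV \<ge> 0" using MV[of 0] norm_ge_zero order_trans by blast
  have ab: "norm (\<sigma> x * (v \<bullet> gE z)) \<le> M * M1" if "norm v \<le> M" for x z v M
  proof -
    have "\<bar>v \<bullet> gE z\<bar> \<le> M * M1"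
      using Cauchy_Schwarz_ineq2[of v "gE z"] mult_mono[OF that M1(2)[of z]] that norm_ge_zero[of v] by (smt (verit) norm_ge_zero)
    then show ?thesis using mult_mono[OF \<sigma>1[of x], of "\<bar>v \<bullet> gE z\<bar>" "M * M1"] by (simp add: abs_mult)
  qed
  have int1: "integrable \<nu> (\<lambda>x. \<bar>a x\<bar>)" and abs_a: "integral\<^sup>L \<nu> (\<lambda>x. \<bar>a x\<bar>) = integral\<^sup>L lborel (\<lambda>y. B y \<bullet> V y)"
  proof -
    have i: "integrable (\<nu> \<Otimes>\<^sub>M lborel) (case_prod (\<lambda>x y. \<sigma> x * (B y \<bullet> gE (y - x))))"
    proof (rule integrable_bounded_on_balls[OF \<nu>, where k="\<lambda>_. 0" and R=RK and M="M2 * M1"])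
      show "norm (case (x, y) of (x, y) \<Rightarrow> \<sigma> x * (B y \<bullet> gE (y - x))) \<le> M2 * M1" for x y
        using ab[OF M2(2)] by simp
      show "(case (x, y) of (x, y) \<Rightarrow> \<sigma> x * (B y \<bullet> gE (y - x))) = 0" if "y \<notin> cball 0 RK" for x y
      proof -
        have "y \<notin> K" using that RK by auto
        then show ?thesis using Boff by simp
      qed
    qed measurable
    have e: "\<bar>a x\<bar> = integral\<^sup>L lborel (\<lambda>y. \<sigma> x * (B y \<bullet> gE (y - x)))" for x
      by (simp add: a_eq[symmetric] \<sigma>_def abs_sgn mult.commute)
    show "integrable \<nu> (\<lambda>x. \<bar>a x\<bar>)"
      unfolding e using P.integrable_fst'[OF i] by simp
    have "integral\<^sup>L \<nu> (\<lambda>x. \<bar>a x\<bar>) = integral\<^sup>L lborel (\<lambda>y. integral\<^sup>L \<nu> (\<lambda>x. \<sigma> x * (B y \<bullet> gE (y - x))))"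
      unfolding e by (rule P.Fubini_integral[OF i, symmetric])
    also have "\<dots> = integral\<^sup>L lborel (\<lambda>y. B y \<bullet> V y)"
      unfolding V_def by (simp add: integral_inner_right[OF iV, symmetric])
    finally show "integral\<^sup>L \<nu> (\<lambda>x. \<bar>a x\<bar>) = integral\<^sup>L lborel (\<lambda>y. B y \<bullet> V y)" .
  qed
  \<comment> \<open>The mutual energy of the potentials of unit masses at \<open>x\<close> and
    \<open>x'\<close>.\<close>
  define W where "W x x' = integral\<^sup>L lborel (\<lambda>y. gE (y - x) \<bullet> gE (y - x'))" for x x'
  \<comment> \<open>Green's identity once more: \<open>D\<close> is minus the Laplacian of
    \<open>E\<close>, so no gradient remains to be estimated, only the short range kernel against a
    difference of densities.\<close>
  have W_eq: "W x x' = integral\<^sup>L lborel (\<lambda>y. E (y - x) * D (y - x'))" for x x'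
  proof -
    have "integral\<^sup>L lborel (\<lambda>y. gE (y - x) \<bullet> gE (y - x')) = - integral\<^sup>L lborel (\<lambda>y. E (y - x) * - D (y - x'))"
      by (rule green_first_identity(3)[OF C2_lap_translate[OF C2] open_UNIV C1_grad_translate[OF C1] compact_cball[of x R]])
         (auto intro!: Eoff simp: dist_norm norm_minus_commute)
    then show ?thesis by (simp add: W_def)
  qed
  \<comment> \<open>Expanding one factor \<open>V\<close> at a time by Fubini writes the energy as a
    double \<nu>-integral of \<open>W\<close> with signs.\<close>
  define J where "J y = (norm (V y))\<^sup>2" for y
  have iJ: "integrable lborel J" and J_eq: "integral\<^sup>L lborel J = integral\<^sup>L \<nu> (\<lambda>x. \<sigma> x * integral\<^sup>L \<nu> (\<lambda>x'. \<sigma> x' * W x x'))"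
  proof -
    have i: "integrable (\<nu> \<Otimes>\<^sub>M lborel) (case_prod (\<lambda>x y. \<sigma> x * (V y \<bullet> gE (y - x))))"
    proof (rule integrable_bounded_on_balls[OF \<nu>, where k="\<lambda>x. x" and R=R and M="MV * M1"])
      show "norm (case (x, y) of (x, y) \<Rightarrow> \<sigma> x * (V y \<bullet> gE (y - x))) \<le> MV * M1" for x y
        using ab[OF MV] by simp
      show "(case (x, y) of (x, y) \<Rightarrow> \<sigma> x * (V y \<bullet> gE (y - x))) = 0" if "y \<notin> cball x R" for x y
        using gEoff[of "y - x"] that by (simp add: dist_norm norm_minus_commute)
    qed measurable
    have J: "J y = integral\<^sup>L \<nu> (\<lambda>x. \<sigma> x * (V y \<bullet> gE (y - x)))" for y
    proof -
      have "J y = V y \<bullet> V y" by (simp add: J_def dot_square_norm)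
      also have "\<dots> = integral\<^sup>L \<nu> (\<lambda>x. V y \<bullet> (\<sigma> x *\<^sub>R gE (y - x)))"
        using integral_inner_right[OF iV, of "V y" y] by (simp add: V_def)
      finally show ?thesis by simp
    qed
    show "integrable lborel J"
      unfolding J[abs_def] by (rule P.integrable_snd[OF i])
    have "integral\<^sup>L lborel J = integral\<^sup>L \<nu> (\<lambda>x. integral\<^sup>L lborel (\<lambda>y. \<sigma> x * (V y \<bullet> gE (y - x))))"
      unfolding J[abs_def] by (rule P.Fubini_integral[OF i])
    also have "\<dots> = integral\<^sup>L \<nu> (\<lambda>x. \<sigma> x * integral\<^sup>L \<nu> (\<lambda>x'. \<sigma> x' * W x x'))"
    proof (rule Bochner_Integration.integral_cong[OF refl])
      fix x
      have i2: "integrable (\<nu> \<Otimes>\<^sub>M lborel) (case_prod (\<lambda>x' y. \<sigma> x' * (gE (y - x) \<bullet> gE (y - x'))))"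
      proof (rule integrable_bounded_on_balls[OF \<nu>, where k="\<lambda>_. x" and R=R and M="M1 * M1"])
        show "norm (case (x', y) of (x', y) \<Rightarrow> \<sigma> x' * (gE (y - x) \<bullet> gE (y - x'))) \<le> M1 * M1" for x' y
          using ab[OF M1(2)] by simp
        show "(case (x', y) of (x', y) \<Rightarrow> \<sigma> x' * (gE (y - x) \<bullet> gE (y - x'))) = 0" if "y \<notin> cball x R" for x' y
          using gEoff[of "y - x"] that by (simp add: dist_norm norm_minus_commute)
      qed measurable
      have "integral\<^sup>L lborel (\<lambda>y. V y \<bullet> gE (y - x)) = integral\<^sup>L lborel (\<lambda>y. integral\<^sup>L \<nu> (\<lambda>x'. \<sigma> x' * (gE (y - x) \<bullet> gE (y - x'))))"
        unfolding V_def by (simp add: integral_inner_right[OF iV, symmetric] inner_commute[of "integral\<^sup>L _ _"])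
      also have "\<dots> = integral\<^sup>L \<nu> (\<lambda>x'. integral\<^sup>L lborel (\<lambda>y. \<sigma> x' * (gE (y - x) \<bullet> gE (y - x'))))"
        by (rule P.Fubini_integral[OF i2])
      also have "\<dots> = integral\<^sup>L \<nu> (\<lambda>x'. \<sigma> x' * W x x')" by (simp add: W_def)
      finally show "integral\<^sup>L lborel (\<lambda>y. \<sigma> x * (V y \<bullet> gE (y - x))) = \<sigma> x * integral\<^sup>L \<nu> (\<lambda>x'. \<sigma> x' * W x x')" by simp
    qed
    finally show "integral\<^sup>L lborel J = integral\<^sup>L \<nu> (\<lambda>x. \<sigma> x * integral\<^sup>L \<nu> (\<lambda>x'. \<sigma> x' * W x x'))" .
  qed
  \<comment> \<open>A majorant of |D|. Cancellation is given up here, but its mass 2 c does not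
    depend on the smoothing parameters.\<close>
  define D' where "D' z = ennreal (rho \<tau> z + rho t z)" for z
  have [measurable]: "D' \<in> borel_measurable borel" unfolding D'_def by measurable
  have D'int: "(\<integral>\<^sup>+y. D' (y - x') \<partial>lborel) = 2 * ennreal c" for x'
  proof -
    have i: "integrable lborel (\<lambda>y. rho s (y - x'))" "integral\<^sup>L lborel (\<lambda>y. rho s (y - x')) = c" if "s > 0" for s
    proof -
      show "integral\<^sup>L lborel (\<lambda>y. rho s (y - x')) = c"
        using lborel_integral_shift[of "rho s" "- x'"] integral_rho[OF that] by simp
      then show "integrable lborel (\<lambda>y. rho s (y - x'))"
        using c_pos not_integrable_integral_eq by fastforce
    qed
    have "(\<integral>\<^sup>+y. D' (y - x') \<partial>lborel) = ennreal (integral\<^sup>L lborel (\<lambda>y. rho \<tau> (y - x') + rho t (y - x')))"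
      unfolding D'_def using i \<tau> t rho_nonneg by (intro nn_integral_eq_integral) auto
    also have "\<dots> = 2 * ennreal c" using i \<tau> t c_pos by (simp add: ennreal_mult'[symmetric] flip: ennreal_numeral)
    finally show ?thesis .
  qed
  have W_le: "ennreal \<bar>W x x'\<bar> \<le> (\<integral>\<^sup>+y. near_kernel t (x - y) * D' (y - x') \<partial>lborel)" for x x'
  proof -
    have "ennreal \<bar>W x x'\<bar> \<le> (\<integral>\<^sup>+y. ennreal (norm (E (y - x) * D (y - x'))) \<partial>lborel)"
      unfolding W_eq using norm_integral_le_nn_integral[of lborel "(\<lambda>y. E (y - x) * D (y - x'))"] by simp
    also have "\<dots> \<le> (\<integral>\<^sup>+y. near_kernel t (x - y) * D' (y - x') \<partial>lborel)"
    proof (rule nn_integral_mono)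
      fix y
      have "ennreal \<bar>E (y - x)\<bar> \<le> near_kernel t (y - x)" unfolding E_def by (rule Phi_diff_le_near_kernel[OF \<tau>])
      then have "ennreal \<bar>E (y - x)\<bar> \<le> near_kernel t (x - y)" by (simp only: near_kernel_minus[of t x y])
      moreover have "ennreal \<bar>D (y - x')\<bar> \<le> D' (y - x')"
        unfolding D_def D'_def using rho_nonneg[of \<tau> "y - x'"] rho_nonneg[of t "y - x'"] by (intro ennreal_leI) linarith
      ultimately show "ennreal (norm (E (y - x) * D (y - x'))) \<le> near_kernel t (x - y) * D' (y - x')"
        by (simp add: abs_mult ennreal_mult mult_mono)
    qed
    finally show ?thesis .
  qed
  have J_le: "(\<integral>\<^sup>+y. ennreal (J y) \<partial>lborel) \<le> k * (2 * ennreal c) * emeasure \<nu> (space \<nu>)"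
  proof -
    have "(\<integral>\<^sup>+y. ennreal (J y) \<partial>lborel) = ennreal (integral\<^sup>L lborel J)"
      by (rule nn_integral_eq_integral[OF iJ]) (simp add: J_def)
    also have "\<dots> \<le> ennreal \<bar>integral\<^sup>L \<nu> (\<lambda>x. \<sigma> x * integral\<^sup>L \<nu> (\<lambda>x'. \<sigma> x' * W x x'))\<bar>"
      unfolding J_eq by (intro ennreal_leI) simp
    also have "\<dots> \<le> (\<integral>\<^sup>+x. ennreal \<bar>\<sigma> x * integral\<^sup>L \<nu> (\<lambda>x'. \<sigma> x' * W x x')\<bar> \<partial>\<nu>)"
      using norm_integral_le_nn_integral[of "\<nu>" "(\<lambda>x. \<sigma> x * integral\<^sup>L \<nu> (\<lambda>x'. \<sigma> x' * W x x'))"] by simp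
    also have "\<dots> \<le> (\<integral>\<^sup>+x. \<integral>\<^sup>+x'. ennreal \<bar>W x x'\<bar> \<partial>\<nu> \<partial>\<nu>)"
    proof (rule nn_integral_mono)
      fix x
      have "ennreal \<bar>\<sigma> x * integral\<^sup>L \<nu> (\<lambda>x'. \<sigma> x' * W x x')\<bar> \<le> ennreal \<bar>integral\<^sup>L \<nu> (\<lambda>x'. \<sigma> x' * W x x')\<bar>"
        using \<sigma>1[of x] by (intro ennreal_leI) (simp add: abs_mult mult_left_le_one_le)
      also have "\<dots> \<le> (\<integral>\<^sup>+x'. ennreal \<bar>\<sigma> x' * W x x'\<bar> \<partial>\<nu>)"
        using norm_integral_le_nn_integral[of "\<nu>" "(\<lambda>x'. \<sigma> x' * W x x')"] by simp
      also have "\<dots> \<le> (\<integral>\<^sup>+x'. ennreal \<bar>W x x'\<bar> \<partial>\<nu>)"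
        using \<sigma>1 by (intro nn_integral_mono ennreal_leI) (simp add: abs_mult mult_left_le_one_le)
      finally show "ennreal \<bar>\<sigma> x * integral\<^sup>L \<nu> (\<lambda>x'. \<sigma> x' * W x x')\<bar> \<le> (\<integral>\<^sup>+x'. ennreal \<bar>W x x'\<bar> \<partial>\<nu>)" .
    qed
    also have "\<dots> \<le> (\<integral>\<^sup>+x. \<integral>\<^sup>+x'. \<integral>\<^sup>+y. near_kernel t (x - y) * D' (y - x') \<partial>lborel \<partial>\<nu> \<partial>\<nu>)"
      by (intro nn_integral_mono W_le)
    \<comment> \<open>The order is arranged so that \<open>x\<close> is integrated before
      \<open>y\<close>: the near kernel gives \<open>k\<close>, then \<open>D'\<close> gives 2 c,
      and \<open>x'\<close> gives the total mass of \<nu>.\<close>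
    also have "\<dots> = (\<integral>\<^sup>+x'. \<integral>\<^sup>+x. \<integral>\<^sup>+y. near_kernel t (x - y) * D' (y - x') \<partial>lborel \<partial>\<nu> \<partial>\<nu>)"
      by (rule PP.Fubini') measurable
    also have "\<dots> = (\<integral>\<^sup>+x'. \<integral>\<^sup>+y. \<integral>\<^sup>+x. near_kernel t (x - y) * D' (y - x') \<partial>\<nu> \<partial>lborel \<partial>\<nu>)"
      by (intro nn_integral_cong P.Fubini'[symmetric]) measurable
    also have "\<dots> \<le> (\<integral>\<^sup>+x'. \<integral>\<^sup>+y. k * D' (y - x') \<partial>lborel \<partial>\<nu>)"
    proof (intro nn_integral_mono)
      fix x' y
      have "(\<integral>\<^sup>+x. near_kernel t (x - y) * D' (y - x') \<partial>\<nu>) = (\<integral>\<^sup>+x. near_kernel t (x - y) \<partial>\<nu>) * D' (y - x')"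
        by (rule nn_integral_multc) measurable
      also have "\<dots> \<le> k * D' (y - x')" by (intro mult_right_mono pot) auto
      finally show "(\<integral>\<^sup>+x. near_kernel t (x - y) * D' (y - x') \<partial>\<nu>) \<le> k * D' (y - x')" .
    qed
    also have "\<dots> = k * (2 * ennreal c) * emeasure \<nu> (space \<nu>)"
      by (simp add: nn_integral_cmult D'int)
    finally show ?thesis .
  qed
  have "(\<integral>\<^sup>+x. ennreal \<bar>a x\<bar> \<partial>\<nu>) = ennreal (integral\<^sup>L lborel (\<lambda>y. B y \<bullet> V y))"
    using nn_integral_eq_integral[OF int1] abs_a by simp
  also have "\<dots> \<le> (\<integral>\<^sup>+y. ennreal (norm (B y)) * ennreal (norm (V y)) \<partial>lborel)"
  proof -
    have "ennreal (integral\<^sup>L lborel (\<lambda>y. B y \<bullet> V y)) \<le> ennreal (norm (integral\<^sup>L lborel (\<lambda>y. B y \<bullet> V y)))"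
      by (intro ennreal_leI) simp
    also have "\<dots> \<le> (\<integral>\<^sup>+y. ennreal (norm (B y \<bullet> V y)) \<partial>lborel)"
      by (rule norm_integral_le_nn_integral)
    also have "\<dots> \<le> (\<integral>\<^sup>+y. ennreal (norm (B y)) * ennreal (norm (V y)) \<partial>lborel)"
      by (intro nn_integral_mono) (simp add: ennreal_mult[symmetric] Cauchy_Schwarz_ineq2 ennreal_leI)
    finally show ?thesis .
  qed
  finally have "(\<integral>\<^sup>+x. ennreal \<bar>a x\<bar> \<partial>\<nu>)\<^sup>2 \<le> (\<integral>\<^sup>+y. ennreal (norm (B y)) * ennreal (norm (V y)) \<partial>lborel)\<^sup>2"
    by (rule power_mono) simp
  also have "\<dots> \<le> (\<integral>\<^sup>+y. ennreal (norm (B y)) ^ 2 \<partial>lborel) * (\<integral>\<^sup>+y. ennreal (norm (V y)) ^ 2 \<partial>lborel)"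
    by (rule Cauchy_Schwarz_nn_integral) measurable
  also have "\<dots> \<le> (\<integral>\<^sup>+y. ennreal ((norm (B y))\<^sup>2) \<partial>lborel) * (k * (2 * ennreal c) * emeasure \<nu> (space \<nu>))"
    using J_le by (intro mult_mono) (auto simp: J_def ennreal_power)
  finally show ?thesis by (simp add: a_def)
qed

text \<open>The bound of \<open>energy_estimate_smooth\<close> is independent of the finer
  parameter. That parameter tends to 0, its average tends pointwise to \<open>c * \<phi> x\<close>,
  and Fatou's lemma preserves the bound.\<close>

lemma energy_estimate:
  assumes \<nu>: "finite_measure \<nu>" and sets[measurable_cong]: "sets \<nu> = sets borel"
    and pot: "\<And>y. (\<integral>\<^sup>+x. near_kernel t (x - y) \<partial>\<nu>) \<le> ennreal k" and t: "t > 0" and k: "k \<ge> 0"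
    and \<phi>: "C1_grad UNIV \<phi> B" and K: "compact K" and off: "\<And>x. x \<notin> K \<Longrightarrow> \<phi> x = 0"
    and N: "(\<integral>\<^sup>+y. ennreal ((norm (B y))\<^sup>2) \<partial>lborel) \<le> ennreal N" "N \<ge> 0"
  shows "(\<integral>\<^sup>+x. ennreal \<bar>c * \<phi> x - avg t \<phi> x\<bar> \<partial>\<nu>) \<le> ennreal (sqrt (N * (2 * k * c * measure \<nu> (space \<nu>))))"
proof -
  interpret finite_measure \<nu> by fact
  have c\<phi>: "continuous_on UNIV \<phi>" using \<phi> by (rule C1_grad_continuous)
  have [measurable]: "avg s \<phi> \<in> borel_measurable borel" for s by (rule avg_measurable[OF c\<phi>])
  define X where "X = N * (2 * k * c * measure \<nu> (space \<nu>))"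
  have X: "X \<ge> 0" using N k c_pos by (simp add: X_def)
  define \<tau> where "\<tau> n = min t (1 / real (Suc n))" for n
  have \<tau>: "0 < \<tau> n" "\<tau> n \<le> t" for n using t by (auto simp: \<tau>_def)
  have bound: "(\<integral>\<^sup>+x. ennreal \<bar>avg (\<tau> n) \<phi> x - avg t \<phi> x\<bar> \<partial>\<nu>) \<le> ennreal (sqrt X)" for n
  proof -
    have "(\<integral>\<^sup>+x. ennreal \<bar>avg (\<tau> n) \<phi> x - avg t \<phi> x\<bar> \<partial>\<nu>)\<^sup>2
        \<le> (\<integral>\<^sup>+y. ennreal ((norm (B y))\<^sup>2) \<partial>lborel) * (ennreal k * (2 * ennreal c) * emeasure \<nu> (space \<nu>))"
      by (rule energy_estimate_smooth[OF \<nu> sets pot \<tau> \<phi> K off])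
    also have "\<dots> \<le> ennreal N * (ennreal k * (2 * ennreal c) * emeasure \<nu> (space \<nu>))"
      by (intro mult_right_mono N) auto
    also have "\<dots> = ennreal X"
      using N k c_pos by (simp add: X_def emeasure_eq_measure ennreal_mult[symmetric] mult_ac flip: ennreal_numeral)
    also have "\<dots> = (ennreal (sqrt X))\<^sup>2" using X by (simp add: ennreal_power)
    finally show ?thesis using X by (intro ennreal_le_of_square_le) auto
  qed
  have "(\<integral>\<^sup>+x. ennreal \<bar>c * \<phi> x - avg t \<phi> x\<bar> \<partial>\<nu>)
      = (\<integral>\<^sup>+x. liminf (\<lambda>n. ennreal \<bar>avg (\<tau> n) \<phi> x - avg t \<phi> x\<bar>) \<partial>\<nu>)"
  proof (rule nn_integral_cong)
    fix x
    have "(\<lambda>n. ennreal \<bar>avg (\<tau> n) \<phi> x - avg t \<phi> x\<bar>) \<longlonglongrightarrow> ennreal \<bar>c * \<phi> x - avg t \<phi> x\<bar>"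
      unfolding \<tau>_def by (intro tendsto_ennrealI tendsto_intros avg_tendsto[OF c\<phi> t])
    then show "ennreal \<bar>c * \<phi> x - avg t \<phi> x\<bar> = liminf (\<lambda>n. ennreal \<bar>avg (\<tau> n) \<phi> x - avg t \<phi> x\<bar>)"
      by (rule lim_imp_Liminf[OF sequentially_bot, symmetric])
  qed
  also have "\<dots> \<le> liminf (\<lambda>n. \<integral>\<^sup>+x. ennreal \<bar>avg (\<tau> n) \<phi> x - avg t \<phi> x\<bar> \<partial>\<nu>)"
    by (rule nn_integral_liminf) measurable
  also have "\<dots> \<le> liminf (\<lambda>n::nat. ennreal (sqrt X))"
    by (intro Liminf_mono always_eventually allI bound)
  also have "\<dots> = ennreal (sqrt X)" by (simp add: Liminf_const)
  finally show ?thesis by (simp add: X_def)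
qed

end

section \<open>Green functions and the truncated test functions\<close>

lemma C2_lap_const: "C2_lap S (\<lambda>_. k) (\<lambda>_. 0) (\<lambda>_. 0)"
proof -
  have "C1_grad S (\<lambda>x::'a. (0::'a) \<bullet> b) (\<lambda>_. 0)" for b
    unfolding C1_grad_def by (auto intro!: derivative_eq_intros)
  then show ?thesis
    unfolding C2_lap_def by (auto intro!: exI[of _ "\<lambda>_ _. 0"] derivative_eq_intros)
qed

lemma C1_grad_extend_zero:
  fixes f :: "'a::euclidean_space \<Rightarrow> real"
  assumes S: "open S" and f: "C1_grad S f A" and K: "compact K" "K \<subseteq> S"
    and off: "\<And>x. x \<in> S - K \<Longrightarrow> f x = 0" "\<And>x. x \<in> S - K \<Longrightarrow> A x = 0"
  shows "C1_grad UNIV (\<lambda>x. if x \<in> S then f x else 0) (\<lambda>x. if x \<in> S then A x else 0)"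
    (is "C1_grad UNIV ?f ?A")
proof -
  have op: "open (- K)" using K(1) by (simp add: compact_imp_closed open_Compl)
  have cov: "S \<union> - K = UNIV" using K(2) by auto
  have c1: "continuous_on S ?A" using f by (subst continuous_on_cong[OF refl, of _ _ A]) (auto simp: C1_grad_def)
  have c2: "continuous_on (- K) ?A"
    using off by (subst continuous_on_cong[OF refl, of _ _ "\<lambda>_. 0"]) auto
  have "continuous_on UNIV ?A"
    using continuous_on_open_Un[OF S op c1 c2] unfolding cov .
  moreover have "(?f has_derivative (\<lambda>v. ?A x \<bullet> v)) (at x)" for x
  proof (cases "x \<in> S")
    case True
    then have "(f has_derivative (\<lambda>v. ?A x \<bullet> v)) (at x)" using f by (simp add: C1_grad_def)
    then show ?thesis
      by (rule has_derivative_transform_within_open[OF _ S True]) simp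
  next
    case False
    then have x: "x \<in> - K" using K(2) by auto
    have "((\<lambda>_. 0) has_derivative (\<lambda>v. ?A x \<bullet> v)) (at x)" using False by simp
    then show ?thesis
      by (rule has_derivative_transform_within_open[OF _ op x]) (use off(1) in auto)
  qed
  ultimately show ?thesis by (simp add: C1_grad_def)
qed

lemma C1_grad_zero_at_minimum:
  assumes S: "open S" "x \<in> S" and f: "C1_grad S f A" and min: "\<And>y. y \<in> S \<Longrightarrow> f x \<le> f y"
  shows "A x = 0"
proof -
  have "(f has_derivative (\<lambda>v. A x \<bullet> v)) (at x)" using f S by (simp add: C1_grad_def)
  moreover have "\<forall>\<^sub>F y in at x. f x \<le> f y"
    using S min by (auto simp: eventually_at_topological)
  ultimately have "(\<lambda>v. A x \<bullet> v) = (\<lambda>v. 0)"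
    by (rule has_derivative_local_min)
  then have "A x \<bullet> A x = 0" by metis
  then show ?thesis by simp
qed

text \<open>A \<open>C\<^sup>1\<close> truncation below level \<^term>\<open>\<delta>\<close> that converges to the positive part, with slope between 0 and 1.\<close>
definition shrink :: "real \<Rightarrow> real \<Rightarrow> real" where "shrink \<delta> s = (if \<delta> \<le> s then (s - \<delta>)\<^sup>2 / s else 0)"
text \<open>For s at least \<delta>, \<open>(s - \<delta>)\<^sup>2 / s\<close> equals
  \<open>s - 2 * \<delta> + \<delta>\<^sup>2 / s\<close>. Its derivative vanishes at \<delta>, and
  the maximum merges it with the zero branch.\<close>

definition shrink' :: "real \<Rightarrow> real \<Rightarrow> real" where "shrink' \<delta> s = 1 - \<delta>\<^sup>2 / (max s \<delta>)\<^sup>2"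

lemma shrink_bounds: "\<delta> > 0 \<Longrightarrow> 0 \<le> s \<Longrightarrow> 0 \<le> shrink \<delta> s \<and> shrink \<delta> s \<le> s"
proof (cases "\<delta> \<le> s")
  case True
  assume "\<delta> > 0"
  then have "(s - \<delta>)\<^sup>2 \<le> s\<^sup>2" using True by (intro power_mono) auto
  then show ?thesis using True \<open>\<delta> > 0\<close> by (simp add: shrink_def divide_le_eq power2_eq_square)
qed (simp add: shrink_def)

lemma shrink'_bounds: "\<delta> > 0 \<Longrightarrow> 0 \<le> shrink' \<delta> s \<and> shrink' \<delta> s \<le> 1"
  by (simp add: shrink'_def divide_le_eq power_mono)

lemma shrink_zero: "\<delta> > 0 \<Longrightarrow> s < \<delta> \<Longrightarrow> shrink \<delta> s = 0" "\<delta> > 0 \<Longrightarrow> s < \<delta> \<Longrightarrow> shrink' \<delta> s = 0"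
  by (auto simp: shrink_def shrink'_def max_def)

lemma shrink_deriv: assumes "\<delta> > 0" shows "(shrink \<delta> has_real_derivative shrink' \<delta> s) (at s)"
proof -
  have "(shrink \<delta> has_real_derivative (if \<delta> \<le> s then 1 - \<delta>\<^sup>2 / s\<^sup>2 else 0)) (at s)"
    unfolding shrink_def[abs_def]
  proof (rule has_real_derivative_If[where f'="\<lambda>s. 1 - \<delta>\<^sup>2 / s\<^sup>2" and g'="\<lambda>s. 0"])
    show "((\<lambda>s. (s - \<delta>)\<^sup>2 / s) has_real_derivative 1 - \<delta>\<^sup>2 / s\<^sup>2) (at s)" if "\<delta> \<le> s"
    proof -
      have "s > 0" using that assms by simp
      then show ?thesis
        by (auto intro!: derivative_eq_intros simp: field_simps power2_eq_square)
    qed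
  qed (use assms in auto)
  moreover have "(if \<delta> \<le> s then 1 - \<delta>\<^sup>2 / s\<^sup>2 else 0) = shrink' \<delta> s"
    using assms by (auto simp: shrink'_def max_def)
  ultimately show ?thesis by simp
qed

lemma continuous_shrink': "\<delta> > 0 \<Longrightarrow> continuous_on S (shrink' \<delta>)"
  unfolding shrink'_def by (intro continuous_intros) (auto dest: max.strict_coboundedI2[of 0 \<delta>])

lemma shrink_tendsto: assumes "s > 0"
  shows "(\<lambda>n. shrink (1 / Suc n) s) \<longlonglongrightarrow> s" "(\<lambda>n. shrink' (1 / Suc n) s) \<longlonglongrightarrow> 1"
proof -
  note inv = LIMSEQ_one_over_Suc
  have ev: "\<forall>\<^sub>F n in sequentially. 1 / real (Suc n) < s"
    using order_tendstoD(2)[OF inv assms] .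
  have "(\<lambda>n. (s - 1 / real (Suc n))\<^sup>2 / s) \<longlonglongrightarrow> (s - 0)\<^sup>2 / s"
    using assms by (intro tendsto_intros inv) auto
  then have "(\<lambda>n. (s - 1 / real (Suc n))\<^sup>2 / s) \<longlonglongrightarrow> s"
    using assms by (simp add: power2_eq_square)
  then show "(\<lambda>n. shrink (1 / Suc n) s) \<longlonglongrightarrow> s"
    by (rule Lim_transform_eventually) (use ev in \<open>eventually_elim, auto simp: shrink_def\<close>)
  have "(\<lambda>n. 1 - (1 / real (Suc n))\<^sup>2 / s\<^sup>2) \<longlonglongrightarrow> 1 - 0\<^sup>2 / s\<^sup>2"
    using assms by (intro tendsto_intros inv) auto
  then have "(\<lambda>n. 1 - (1 / real (Suc n))\<^sup>2 / s\<^sup>2) \<longlonglongrightarrow> 1" by simp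
  then show "(\<lambda>n. shrink' (1 / Suc n) s) \<longlonglongrightarrow> 1"
    by (rule Lim_transform_eventually) (use ev in \<open>eventually_elim, auto simp: shrink'_def max_def\<close>)
qed

text \<open>Only the regular part \<open>h\<close> is kept, and the boundary condition is expressed
  through the profile. Since \<open>T\<close> bounds all squared distances and \<open>p\<close>
  decreases, \<open>p T\<close> is a lower bound for the fundamental solution between distinct
  points of \<Omega>.\<close>

locale green_function = radial_profile p \<kappa> d space_type
  for p \<kappa> d and space_type :: "'a::euclidean_space itself" +
  fixes \<Omega> :: "'a set" and h :: "'a \<Rightarrow> 'a \<Rightarrow> real" and T :: real
  assumes open_\<Omega>: "open \<Omega>" and bounded_\<Omega>: "bounded \<Omega>"
    and T_pos: "T > 0" and T: "\<And>x y. x \<in> closure \<Omega> \<Longrightarrow> y \<in> closure \<Omega> \<Longrightarrow> (y - x) \<bullet> (y - x) \<le> T"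
    and h_sym: "\<And>x y. x \<in> \<Omega> \<Longrightarrow> y \<in> \<Omega> \<Longrightarrow> h x y = h y x"
    and h_cont: "continuous_on (\<Omega> \<times> \<Omega>) (\<lambda>(x, y). h x y)"
    and h_harm: "\<And>x. x \<in> \<Omega> \<Longrightarrow> harmonic_on \<Omega> (h x)"
    and bdry: "\<And>x z. x \<in> \<Omega> \<Longrightarrow> z \<in> frontier \<Omega> \<Longrightarrow>
        ((\<lambda>y. p ((y - x) \<bullet> (y - x)) + h x y) \<longlongrightarrow> 0) (at z within \<Omega>)"
begin

lemma p_antimono: "0 < s \<Longrightarrow> s \<le> s' \<Longrightarrow> p s' \<le> p s"
  using smooth_profile_antimono[of s s s'] by (simp add: smooth_profile_def)

lemma frontier_not_in: "z \<in> frontier \<Omega> \<Longrightarrow> z \<notin> \<Omega>"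
  using open_\<Omega> by (simp add: frontier_def interior_open)

lemma eventually_in_\<Omega>: "\<forall>\<^sub>F y in at z within \<Omega>. y \<in> \<Omega>"
  by (simp add: eventually_at_filter)

text \<open>At the frontier \<open>h x\<close> approaches minus the fundamental solution, hence has
  upper limit at most \<open>- p T\<close>; the minimum principle carries this inside. It turns
  bounds for \<open>Phi\<close> above the level \<open>p T\<close> into upper bounds for
  \<open>g\<close>.\<close>

lemma h_le:
  assumes x: "x \<in> \<Omega>" and y: "y \<in> \<Omega>"
  shows "h x y \<le> - p T"
proof -
  have C2: "C2_lap \<Omega> (\<lambda>y. - p T - h x y) (\<lambda>y. 0 - grad (h x) y) (\<lambda>y. 0 - 0)"
    by (intro C2_lap_diff C2_lap_const harmonic_on_C2_lap h_harm x)
  have "0 \<le> - p T - h x y"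
  proof (rule superharmonic_nonneg[OF C2 open_\<Omega> bounded_\<Omega> _ _ y])
    fix z and e :: real assume z: "z \<in> frontier \<Omega>" and e: "e > 0"
    have "\<forall>\<^sub>F y in at z within \<Omega>. p ((y - x) \<bullet> (y - x)) + h x y < e"
      using order_tendstoD(2)[OF bdry[OF x z]] e by simp
    moreover have "\<forall>\<^sub>F y in at z within \<Omega>. y \<noteq> x"
      using tendsto_imp_eventually_ne[OF tendsto_ident_at, of z x \<Omega>] frontier_not_in[OF z] x by auto
    ultimately show "\<forall>\<^sub>F y in at z within \<Omega>. - e < - p T - h x y"
      using eventually_in_\<Omega>[of z]
    proof eventually_elim
      case (elim y)
      have "p T \<le> p ((y - x) \<bullet> (y - x))"
        using elim x closure_subset by (intro p_antimono T) auto
      then show ?case using elim by linarith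
    qed
  qed simp
  then show ?thesis by simp
qed

definition g :: "real \<Rightarrow> 'a \<Rightarrow> 'a \<Rightarrow> real" where "g t x y = Phi t (y - x) + h x y"

definition grad_g :: "real \<Rightarrow> 'a \<Rightarrow> 'a \<Rightarrow> 'a" where "grad_g t x y = gradPhi t (y - x) + grad (h x) y"

text \<open>Points whose ball of radius \<open>sqrt t\<close> stays inside the domain: there \<^term>\<open>Phi t\<close> agrees with
  the fundamental solution near the boundary.\<close>
definition inner_region :: "real \<Rightarrow> 'a set" where "inner_region t = {x. sqrt t < infdist x (- \<Omega>)}"

lemma compl_nonempty: "- \<Omega> \<noteq> {}"
  using bounded_\<Omega> not_bounded_UNIV by (metis Compl_UNIV_eq boolean_algebra.compl_zero double_compl)

lemma inner_region_D:
  assumes "x \<in> inner_region t" "t \<ge> 0" "z \<notin> \<Omega>" shows "t < (z - x) \<bullet> (z - x)"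
proof -
  have "sqrt t < dist x z" using assms infdist_le[of z "- \<Omega>" x] by (simp add: inner_region_def)
  then have "(sqrt t)\<^sup>2 < (dist x z)\<^sup>2" using assms(2) by (intro power_strict_mono) auto
  then show ?thesis using assms(2) by (simp add: dist_norm norm_minus_commute dot_square_norm)
qed

lemma inner_region_subset: assumes "t \<ge> 0" shows "inner_region t \<subseteq> \<Omega>"
proof
  fix x assume "x \<in> inner_region t"
  then show "x \<in> \<Omega>" using assms inner_region_D[of x t x] by (cases "x \<in> \<Omega>") auto
qed

lemma open_inner_region: "open (inner_region t)"
  unfolding inner_region_def by (intro open_Collect_less continuous_on_const continuous_on_infdist continuous_on_id)

lemma inner_region_antimono: "s \<le> t \<Longrightarrow> inner_region t \<subseteq> inner_region s"
  by (auto simp: inner_region_def intro: order.strict_trans1[OF real_sqrt_le_mono])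

lemma inner_region_exhausts: assumes "x \<in> \<Omega>" obtains e where "e > 0" "\<And>t. t < e \<Longrightarrow> x \<in> inner_region t"
proof -
  have "infdist x (- \<Omega>) > 0"
    using assms in_closed_iff_infdist_zero[of "- \<Omega>" x] open_\<Omega> compl_nonempty infdist_nonneg[of x "- \<Omega>"]
    by (auto simp: closed_Compl order.strict_iff_order)
  then show ?thesis
    by (intro that[of "(infdist x (- \<Omega>))\<^sup>2"]) (auto simp: inner_region_def intro: real_less_lsqrt real_sqrt_less_mono[THEN order.strict_trans2])
qed

lemma g_C2:
  assumes "t > 0" "x \<in> \<Omega>"
  shows "C2_lap \<Omega> (g t x) (grad_g t x) (\<lambda>y. - rho t (y - x))"
proof -
  have "C2_lap \<Omega> (\<lambda>y. Phi t (y - x) + h x y) (\<lambda>y. gradPhi t (y - x) + grad (h x) y) (\<lambda>y. - rho t (y - x) + 0)"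
    by (intro C2_lap_add harmonic_on_C2_lap h_harm assms C2_lap_subset[OF C2_lap_translate[OF Phi_C2]]) auto
  then show ?thesis by (simp add: g_def[abs_def] grad_g_def[abs_def])
qed

text \<open>For \<open>x\<close> in the inner region all frontier points are farther than sqrt t,
  where the smoothing has left the profile unchanged, so the boundary values are those of the true
  Green function.\<close>

lemma g_boundary:
  assumes t: "t > 0" and x: "x \<in> inner_region t" and z: "z \<in> frontier \<Omega>"
  shows "(g t x \<longlongrightarrow> 0) (at z within \<Omega>)"
proof -
  have x\<Omega>: "x \<in> \<Omega>" using x inner_region_subset[of t] t by auto
  have "t < (z - x) \<bullet> (z - x)" using inner_region_D[OF x _ frontier_not_in[OF z]] t by simp
  moreover have "((\<lambda>y. (y - x) \<bullet> (y - x)) \<longlongrightarrow> (z - x) \<bullet> (z - x)) (at z within \<Omega>)"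
    by (intro tendsto_intros)
  ultimately have "\<forall>\<^sub>F y in at z within \<Omega>. t < (y - x) \<bullet> (y - x)"
    by (rule order_tendstoD(1)[rotated])
  then have "\<forall>\<^sub>F y in at z within \<Omega>. p ((y - x) \<bullet> (y - x)) + h x y = g t x y"
    by eventually_elim (simp add: g_def Phi_def smooth_profile_def)
  then show ?thesis by (rule Lim_transform_eventually[OF bdry[OF x\<Omega> z]])
qed

lemma g_nonneg:
  assumes t: "t > 0" and x: "x \<in> inner_region t" and y: "y \<in> \<Omega>"
  shows "0 \<le> g t x y"
proof -
  have x\<Omega>: "x \<in> \<Omega>" using x inner_region_subset[of t] t by auto
  show ?thesis
    by (rule superharmonic_nonneg[OF g_C2[OF t x\<Omega>] open_\<Omega> bounded_\<Omega> _ _ y])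
       (use rho_nonneg order_tendstoD(1)[OF g_boundary[OF t x]] in auto)
qed

text \<open>A bound uniform in both points: \<open>Phi t\<close> is largest at the origin, and
  \<open>h\<close> is at most \<open>- p T\<close>.\<close>

definition g_bound :: "real \<Rightarrow> real" where "g_bound t = Phi t 0 - p T"

lemma Phi_level_le:
  assumes "0 < t" "t \<le> T" "x \<in> \<Omega>" "y \<in> \<Omega>"
  shows "p T \<le> Phi t (y - x)" "ennreal (Phi t (y - x) - p T) \<le> near_kernel T (y - x)"
  using Phi_minus_level_le[OF assms(1,2), of "y - x"] T[of x y] assms closure_subset by auto

lemma g_le:
  assumes "t > 0" "t \<le> T" "x \<in> \<Omega>" "y \<in> \<Omega>"
  shows "g t x y \<le> g_bound t" "ennreal (g t x y) \<le> near_kernel T (y - x)"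
proof -
  have 1: "g t x y \<le> Phi t (y - x) - p T" using h_le[OF assms(3,4)] by (simp add: g_def)
  then show "g t x y \<le> g_bound t" using Phi_le_Phi_0[OF assms(1), of "y - x"] by (simp add: g_bound_def)
  have "ennreal (g t x y) \<le> ennreal (Phi t (y - x) - p T)" using 1 by (rule ennreal_leI)
  also note Phi_level_le(2)[OF assms]
  finally show "ennreal (g t x y) \<le> near_kernel T (y - x)" .
qed

lemma g_bound_nonneg: "0 < t \<Longrightarrow> t \<le> T \<Longrightarrow> 0 \<le> g_bound t"
  using Phi_minus_level_le(1)[of t T 0] T_pos by (simp add: g_bound_def)

definition cut :: "real \<Rightarrow> real \<Rightarrow> 'a \<Rightarrow> 'a \<Rightarrow> real" where
  "cut \<delta> t x y = (if y \<in> \<Omega> then shrink \<delta> (g t x y) else 0)"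

definition cut' :: "real \<Rightarrow> real \<Rightarrow> 'a \<Rightarrow> 'a \<Rightarrow> 'a" where
  "cut' \<delta> t x y = (if y \<in> \<Omega> then shrink' \<delta> (g t x y) *\<^sub>R grad_g t x y else 0)"

context
  fixes t :: real and x :: 'a
  assumes t: "0 < t" "t \<le> T" and x: "x \<in> inner_region t"
begin

lemma x_in: "x \<in> \<Omega>" using x inner_region_subset[of t] t by auto

lemma g_continuous: "continuous_on \<Omega> (g t x)"
  by (rule C1_grad_continuous[OF C2_lap_imp_C1_grad[OF g_C2[OF t(1) x_in]]])

lemma grad_g_continuous: "continuous_on \<Omega> (grad_g t x)"
  using C2_lap_imp_C1_grad[OF g_C2[OF t(1) x_in]] by (simp add: C1_grad_def)

lemma cut_C1:
  assumes \<delta>: "\<delta> > 0"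
  shows "C1_grad UNIV (cut \<delta> t x) (cut' \<delta> t x)" "compact {y \<in> \<Omega>. \<delta> \<le> g t x y}"
proof -
  show K: "compact {y \<in> \<Omega>. \<delta> \<le> g t x y}"
    by (rule compact_superlevel[OF open_\<Omega> bounded_\<Omega> g_continuous])
       (rule order_tendstoD(2)[OF g_boundary[OF t(1) x] \<delta>])
  have "C1_grad \<Omega> (\<lambda>y. shrink \<delta> (g t x y)) (\<lambda>y. shrink' \<delta> (g t x y) *\<^sub>R grad_g t x y)"
    unfolding C1_grad_def
  proof (intro conjI ballI)
    fix y assume y: "y \<in> \<Omega>"
    have "(g t x has_derivative (\<lambda>v. grad_g t x y \<bullet> v)) (at y)"
      using C2_lap_imp_C1_grad[OF g_C2[OF t(1) x_in]] y by (simp add: C1_grad_def)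
    from has_derivative_compose[OF this shrink_deriv[OF \<delta>, unfolded has_field_derivative_def]]
    show "((\<lambda>y. shrink \<delta> (g t x y)) has_derivative (\<bullet>) (shrink' \<delta> (g t x y) *\<^sub>R grad_g t x y)) (at y)"
      by (rule has_derivative_eq_rhs) (simp add: fun_eq_iff)
  next
    show "continuous_on \<Omega> (\<lambda>y. shrink' \<delta> (g t x y) *\<^sub>R grad_g t x y)"
      by (intro continuous_on_scaleR grad_g_continuous continuous_on_compose2[OF continuous_shrink'[OF \<delta>, of UNIV] g_continuous]) simp
  qed
  then show "C1_grad UNIV (cut \<delta> t x) (cut' \<delta> t x)"
    unfolding cut_def[abs_def] cut'_def[abs_def]
    by (rule C1_grad_extend_zero[OF open_\<Omega> _ K]) (auto simp: shrink_zero[OF \<delta>])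
qed

lemma cut_off: "\<delta> > 0 \<Longrightarrow> y \<notin> {y \<in> \<Omega>. \<delta> \<le> g t x y} \<Longrightarrow> cut \<delta> t x y = 0"
  by (auto simp: cut_def shrink_zero)

lemma cut_bounds: "\<delta> > 0 \<Longrightarrow> 0 \<le> cut \<delta> t x y \<and> cut \<delta> t x y \<le> g_bound t"
  using shrink_bounds[of \<delta> "g t x y"] g_nonneg[OF t(1) x, of y] g_le(1)[OF t x_in, of y] g_bound_nonneg[OF t]
  by (auto simp: cut_def)

text \<open>The slope of the truncation lies in [0, 1], so the squared gradient of
  \<open>cut\<close> is at most its inner product with the gradient of \<open>g\<close>. Green's
  identity turns the latter into the integral of \<open>cut\<close> against \<open>rho\<close>,
  which is bounded independently of \<delta>.\<close>

lemma cut_energy: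
  assumes \<delta>: "\<delta> > 0"
  shows "(\<integral>\<^sup>+y. ennreal ((norm (cut' \<delta> t x y))\<^sup>2) \<partial>lborel) \<le> ennreal (g_bound t * c)"
proof -
  note G = green_first_identity[OF g_C2[OF t(1) x_in] open_\<Omega> cut_C1(1)[OF \<delta>] cut_C1(2)[OF \<delta>] _ cut_off[OF \<delta>]]
  have irho: "integrable lborel (\<lambda>y. rho t (y - x))" "integral\<^sup>L lborel (\<lambda>y. rho t (y - x)) = c"
  proof -
    show "integral\<^sup>L lborel (\<lambda>y. rho t (y - x)) = c"
      using lborel_integral_shift[of "rho t" "- x"] integral_rho[OF t(1)] by simp
    then show "integrable lborel (\<lambda>y. rho t (y - x))"
      using c_pos not_integrable_integral_eq by fastforce
  qed
  have nn: "0 \<le> cut' \<delta> t x y \<bullet> grad_g t x y" for y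
    using shrink'_bounds[OF \<delta>] by (auto simp: cut'_def)
  have "(\<integral>\<^sup>+y. ennreal ((norm (cut' \<delta> t x y))\<^sup>2) \<partial>lborel) \<le> (\<integral>\<^sup>+y. ennreal (cut' \<delta> t x y \<bullet> grad_g t x y) \<partial>lborel)"
  proof (intro nn_integral_mono ennreal_leI)
    fix y
    let ?F = "shrink' \<delta> (g t x y)"
    have "?F\<^sup>2 \<le> ?F" using shrink'_bounds[OF \<delta>, of "g t x y"] by (simp add: power2_eq_square mult_left_le_one_le)
    then have "?F\<^sup>2 * (grad_g t x y \<bullet> grad_g t x y) \<le> ?F * (grad_g t x y \<bullet> grad_g t x y)"
      by (intro mult_right_mono) auto
    then show "(norm (cut' \<delta> t x y))\<^sup>2 \<le> cut' \<delta> t x y \<bullet> grad_g t x y"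
      by (auto simp: cut'_def power_mult_distrib dot_square_norm)
  qed
  also have "\<dots> = ennreal (integral\<^sup>L lborel (\<lambda>y. cut' \<delta> t x y \<bullet> grad_g t x y))"
    by (rule nn_integral_eq_integral) (use G nn in auto)
  also have "integral\<^sup>L lborel (\<lambda>y. cut' \<delta> t x y \<bullet> grad_g t x y) = integral\<^sup>L lborel (\<lambda>y. cut \<delta> t x y * rho t (y - x))"
    using G(3) by simp
  also have "\<dots> \<le> integral\<^sup>L lborel (\<lambda>y. g_bound t * rho t (y - x))"
  proof (rule integral_mono)
    show "integrable lborel (\<lambda>y. cut \<delta> t x y * rho t (y - x))" using G(2) by simp
    show "integrable lborel (\<lambda>y. g_bound t * rho t (y - x))" using irho by simp
    show "cut \<delta> t x y * rho t (y - x) \<le> g_bound t * rho t (y - x)" for y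
      using cut_bounds[OF \<delta>] rho_nonneg by (intro mult_right_mono) auto
  qed
  also have "\<dots> = g_bound t * c" using irho by simp
  finally show ?thesis by (simp add: ennreal_leI)
qed

text \<open>The slopes tend to 1 only where \<open>g\<close> is positive. A zero of \<open>g\<close>
  is a minimum, so the gradient vanishes there and the limit is still right.\<close>

lemma cut'_tendsto: assumes y: "y \<in> \<Omega>" shows "(\<lambda>n. cut' (1 / Suc n) t x y) \<longlonglongrightarrow> grad_g t x y"
proof (cases "g t x y > 0")
  case True
  then have "(\<lambda>n. shrink' (1 / Suc n) (g t x y) *\<^sub>R grad_g t x y) \<longlonglongrightarrow> 1 *\<^sub>R grad_g t x y"
    by (intro tendsto_intros shrink_tendsto)
  then show ?thesis using y by (simp add: cut'_def)
next
  case False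
  then have z: "g t x y = 0" using g_nonneg[OF t(1) x y] by simp
  have "grad_g t x y = 0"
    by (rule C1_grad_zero_at_minimum[OF open_\<Omega> y C2_lap_imp_C1_grad[OF g_C2[OF t(1) x_in]]])
       (use g_nonneg[OF t(1) x] z in auto)
  then show ?thesis using y by (simp add: cut'_def)
qed

lemma cut_tendsto: assumes y: "y \<in> \<Omega>" shows "(\<lambda>n. cut (1 / Suc n) t x y) \<longlonglongrightarrow> g t x y"
proof (cases "g t x y > 0")
  case True
  then show ?thesis using y shrink_tendsto(1)[OF True] by (simp add: cut_def)
next
  case False
  then have z: "g t x y = 0" using g_nonneg[OF t(1) x y] by simp
  show ?thesis using y z by (simp add: cut_def shrink_zero)
qed

text \<open>The energy bound for the truncations does not depend on the level, so it passes to the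
  limit by Fatou's lemma, although \<open>g\<close> itself need not have compact support in
  \<Omega>.\<close>

lemma grad_g_energy: "(\<integral>\<^sup>+y. ennreal ((norm (indicator \<Omega> y *\<^sub>R grad_g t x y))\<^sup>2) \<partial>lborel) \<le> ennreal (g_bound t * c)"
proof -
  have m: "cut' (1 / Suc n) t x \<in> borel_measurable borel" for n
    using cut_C1(1)[of "1 / Suc n"] by (intro borel_measurable_continuous_onI) (simp add: C1_grad_def)
  have "(\<integral>\<^sup>+y. ennreal ((norm (indicator \<Omega> y *\<^sub>R grad_g t x y))\<^sup>2) \<partial>lborel)
      = (\<integral>\<^sup>+y. liminf (\<lambda>n. ennreal ((norm (cut' (1 / Suc n) t x y))\<^sup>2)) \<partial>lborel)"
  proof (rule nn_integral_cong)
    fix y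
    have "(\<lambda>n. cut' (1 / Suc n) t x y) \<longlonglongrightarrow> indicator \<Omega> y *\<^sub>R grad_g t x y"
      using cut'_tendsto[of y] by (cases "y \<in> \<Omega>") (auto simp: cut'_def)
    then have "(\<lambda>n. ennreal ((norm (cut' (1 / Suc n) t x y))\<^sup>2)) \<longlonglongrightarrow> ennreal ((norm (indicator \<Omega> y *\<^sub>R grad_g t x y))\<^sup>2)"
      by (intro tendsto_ennrealI tendsto_intros)
    then show "ennreal ((norm (indicator \<Omega> y *\<^sub>R grad_g t x y))\<^sup>2) = liminf (\<lambda>n. ennreal ((norm (cut' (1 / Suc n) t x y))\<^sup>2))"
      by (rule lim_imp_Liminf[OF sequentially_bot, symmetric])
  qed
  also have "\<dots> \<le> liminf (\<lambda>n. \<integral>\<^sup>+y. ennreal ((norm (cut' (1 / Suc n) t x y))\<^sup>2) \<partial>lborel)"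
    using m by (intro nn_integral_liminf) measurable
  also have "\<dots> \<le> liminf (\<lambda>n::nat. ennreal (g_bound t * c))"
    by (intro Liminf_mono always_eventually allI cut_energy) simp
  also have "\<dots> = ennreal (g_bound t * c)" by (simp add: Liminf_const)
  finally show ?thesis .
qed

text \<open>In the second variable minus the Laplacian of \<open>g t x\<close> is
  \<open>rho t\<close> centred at \<open>x\<close>, as \<open>h\<close> is harmonic; Green's
  identity applies because \<phi> has compact support in \<Omega>.\<close>

lemma avg_eq_pairing:
  assumes \<phi>: "C1_grad UNIV \<phi> B" and K: "compact K" "K \<subseteq> \<Omega>" and off: "\<And>x. x \<notin> K \<Longrightarrow> \<phi> x = 0"
  shows "avg t \<phi> x = (LINT y:\<Omega>|lebesgue. B y \<bullet> grad_g t x y)"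
proof -
  have Boff: "B x = 0" if "x \<notin> K" for x
    using \<phi> grad_zero_off_support[OF _ compact_imp_closed[OF K(1)] _ that, of \<phi> "B x"] off
    by (auto simp: C1_grad_def)
  note G = green_first_identity[OF g_C2[OF t(1) x_in] open_\<Omega> \<phi> K off]
  have "avg t \<phi> x = integral\<^sup>L lborel (\<lambda>y. B y \<bullet> grad_g t x y)"
    using G(3) by (simp add: avg_def mult.commute)
  also have "\<dots> = integral\<^sup>L lebesgue (\<lambda>y. B y \<bullet> grad_g t x y)"
    by (rule integral_completion[symmetric]) (use G(1) in auto)
  also have "(\<lambda>y. B y \<bullet> grad_g t x y) = (\<lambda>y. indicator \<Omega> y *\<^sub>R (B y \<bullet> grad_g t x y))"
  proof
    fix y
    show "B y \<bullet> grad_g t x y = indicator \<Omega> y *\<^sub>R (B y \<bullet> grad_g t x y)"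
    proof (cases "y \<in> \<Omega>")
      case False
      then have "B y = 0" using Boff K(2) by blast
      then show ?thesis by simp
    qed simp
  qed
  finally show ?thesis by (simp add: set_lebesgue_integral_def)
qed

end

end

section \<open>L2 pairings and almost everywhere convergent subsequences\<close>

lemma L2_product_integrable:
  fixes f k :: "'a \<Rightarrow> 'b::euclidean_space"
  assumes [measurable]: "f \<in> borel_measurable M" "k \<in> borel_measurable M"
    and f: "(\<integral>\<^sup>+x. ennreal ((norm (f x))\<^sup>2) \<partial>M) < \<infinity>" and k: "(\<integral>\<^sup>+x. ennreal ((norm (k x))\<^sup>2) \<partial>M) < \<infinity>"
  shows "integrable M (\<lambda>x. norm (f x) * norm (k x))" "integrable M (\<lambda>x. f x \<bullet> k x)"
    "ennreal (\<bar>integral\<^sup>L M (\<lambda>x. f x \<bullet> k x)\<bar>\<^sup>2) \<le> (\<integral>\<^sup>+x. ennreal ((norm (f x))\<^sup>2) \<partial>M) * (\<integral>\<^sup>+x. ennreal ((norm (k x))\<^sup>2) \<partial>M)"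
proof -
  have CS: "(\<integral>\<^sup>+x. ennreal (norm (f x)) * ennreal (norm (k x)) \<partial>M)\<^sup>2
      \<le> (\<integral>\<^sup>+x. ennreal ((norm (f x))\<^sup>2) \<partial>M) * (\<integral>\<^sup>+x. ennreal ((norm (k x))\<^sup>2) \<partial>M)"
    using Cauchy_Schwarz_nn_integral[of "\<lambda>x. ennreal (norm (f x))" M "\<lambda>x. ennreal (norm (k x))"]
    by (simp add: ennreal_power)
  also have "\<dots> < \<infinity>" using f k by (simp add: ennreal_mult_less_top)
  finally have fin: "(\<integral>\<^sup>+x. ennreal (norm (f x)) * ennreal (norm (k x)) \<partial>M) < \<infinity>"
    by (auto simp: less_top[symmetric] power2_eq_square ennreal_top_mult)
  show 1: "integrable M (\<lambda>x. norm (f x) * norm (k x))"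
    by (rule integrableI_bounded) (use fin in \<open>auto simp: ennreal_mult\<close>)
  show 2: "integrable M (\<lambda>x. f x \<bullet> k x)"
    by (rule Bochner_Integration.integrable_bound[OF 1]) (auto simp: Cauchy_Schwarz_ineq2)
  have "ennreal (norm (integral\<^sup>L M (\<lambda>x. f x \<bullet> k x))) \<le> (\<integral>\<^sup>+x. ennreal (norm (f x \<bullet> k x)) \<partial>M)"
    by (rule integral_norm_bound_ennreal[OF 2])
  also have "\<dots> \<le> (\<integral>\<^sup>+x. ennreal (norm (f x)) * ennreal (norm (k x)) \<partial>M)"
    by (intro nn_integral_mono) (simp add: ennreal_mult[symmetric] Cauchy_Schwarz_ineq2 ennreal_leI)
  finally have "(ennreal \<bar>integral\<^sup>L M (\<lambda>x. f x \<bullet> k x)\<bar>)\<^sup>2 \<le> (\<integral>\<^sup>+x. ennreal (norm (f x)) * ennreal (norm (k x)) \<partial>M)\<^sup>2"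
    by (intro power_mono) auto
  also note CS
  finally show "ennreal (\<bar>integral\<^sup>L M (\<lambda>x. f x \<bullet> k x)\<bar>\<^sup>2) \<le> (\<integral>\<^sup>+x. ennreal ((norm (f x))\<^sup>2) \<partial>M) * (\<integral>\<^sup>+x. ennreal ((norm (k x))\<^sup>2) \<partial>M)"
    by (simp add: ennreal_power)
qed

text \<open>The \<open>F n\<close> themselves need not be square integrable. Convergence makes
  \<open>F n - f\<close> so from some index on, and Cauchy-Schwarz is applied to this
  difference.\<close>

lemma L2_pairing_tendsto:
  fixes f k :: "'a \<Rightarrow> 'b::euclidean_space"
  assumes m[measurable]: "\<And>n. F n \<in> borel_measurable M" "f \<in> borel_measurable M" "k \<in> borel_measurable M"
    and f: "(\<integral>\<^sup>+x. ennreal ((norm (f x))\<^sup>2) \<partial>M) < \<infinity>" and k: "(\<integral>\<^sup>+x. ennreal ((norm (k x))\<^sup>2) \<partial>M) < \<infinity>"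
    and lim: "(\<lambda>n. \<integral>\<^sup>+x. ennreal ((norm (F n x - f x))\<^sup>2) \<partial>M) \<longlonglongrightarrow> 0"
  shows "(\<lambda>n. integral\<^sup>L M (\<lambda>x. F n x \<bullet> k x)) \<longlonglongrightarrow> integral\<^sup>L M (\<lambda>x. f x \<bullet> k x)"
proof -
  define X where "X n = integral\<^sup>L M (\<lambda>x. (F n x - f x) \<bullet> k x)" for n
  define Ck where "Ck = (\<integral>\<^sup>+x. ennreal ((norm (k x))\<^sup>2) \<partial>M)"
  have ev: "\<forall>\<^sub>F n in sequentially. (\<integral>\<^sup>+x. ennreal ((norm (F n x - f x))\<^sup>2) \<partial>M) < \<infinity>"
    using order_tendstoD(2)[OF lim, of \<infinity>] by simp
  have "(\<lambda>n. (\<integral>\<^sup>+x. ennreal ((norm (F n x - f x))\<^sup>2) \<partial>M) * Ck) \<longlonglongrightarrow> 0 * Ck"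
    using k by (intro tendsto_mult_ennreal lim tendsto_const) (auto simp: Ck_def)
  then have lim0: "(\<lambda>n. (\<integral>\<^sup>+x. ennreal ((norm (F n x - f x))\<^sup>2) \<partial>M) * Ck) \<longlonglongrightarrow> 0" by simp
  have "(\<lambda>n. ennreal (\<bar>X n\<bar>\<^sup>2)) \<longlonglongrightarrow> 0"
  proof (rule tendsto_sandwich[OF _ _ tendsto_const lim0])
    show "\<forall>\<^sub>F n in sequentially. ennreal (\<bar>X n\<bar>\<^sup>2) \<le> (\<integral>\<^sup>+x. ennreal ((norm (F n x - f x))\<^sup>2) \<partial>M) * Ck"
      using ev
    proof eventually_elim
      case (elim n)
      show ?case unfolding X_def Ck_def
        by (rule L2_product_integrable(3)[OF _ _ elim k]) measurable
    qed
  qed simp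
  then have "(\<lambda>n. \<bar>X n\<bar>\<^sup>2) \<longlonglongrightarrow> 0"
    unfolding ennreal_0[symmetric] by (subst (asm) tendsto_ennreal_iff) auto
  then have "(\<lambda>n. sqrt (\<bar>X n\<bar>\<^sup>2)) \<longlonglongrightarrow> sqrt 0" by (rule tendsto_real_sqrt)
  then have "X \<longlonglongrightarrow> 0" by (simp add: tendsto_rabs_zero_iff)
  then have "(\<lambda>n. X n + integral\<^sup>L M (\<lambda>x. f x \<bullet> k x)) \<longlonglongrightarrow> 0 + integral\<^sup>L M (\<lambda>x. f x \<bullet> k x)"
    by (intro tendsto_add tendsto_const)
  moreover have "\<forall>\<^sub>F n in sequentially. X n + integral\<^sup>L M (\<lambda>x. f x \<bullet> k x) = integral\<^sup>L M (\<lambda>x. F n x \<bullet> k x)"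
    using ev
  proof eventually_elim
    case (elim n)
    have "integrable M (\<lambda>x. (F n x - f x) \<bullet> k x)"
      by (rule L2_product_integrable(2)[OF _ _ elim k]) measurable
    moreover have "integrable M (\<lambda>x. f x \<bullet> k x)"
      by (rule L2_product_integrable(2)[OF m(2,3) f k])
    ultimately show ?case
      unfolding X_def by (subst Bochner_Integration.integral_add[symmetric]) (auto simp: inner_diff_left)
  qed
  ultimately show ?thesis by (auto intro: Lim_transform_eventually)
qed

text \<open>The squared differences tend to zero in L1 once the finitely many indices with infinite
  integral are dropped; the shift by \<open>n0\<close> returns in the subsequence.\<close>

lemma L2_tendsto_AE_subseq:
  fixes f :: "'a \<Rightarrow> real"
  assumes [measurable]: "\<And>n. F n \<in> borel_measurable M" "f \<in> borel_measurable M"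
    and lim: "(\<lambda>n. \<integral>\<^sup>+x. ennreal ((F n x - f x)\<^sup>2) \<partial>M) \<longlonglongrightarrow> 0"
  obtains r :: "nat \<Rightarrow> nat" where "strict_mono r" "AE x in M. (\<lambda>n. F (r n) x) \<longlonglongrightarrow> f x"
proof -
  have "\<forall>\<^sub>F n in sequentially. (\<integral>\<^sup>+x. ennreal ((F n x - f x)\<^sup>2) \<partial>M) < \<infinity>"
    using order_tendstoD(2)[OF lim, of \<infinity>] by simp
  then obtain n0 where n0: "\<And>n. n \<ge> n0 \<Longrightarrow> (\<integral>\<^sup>+x. ennreal ((F n x - f x)\<^sup>2) \<partial>M) < \<infinity>"
    by (auto simp: eventually_sequentially)
  define u where "u n x = (F (n + n0) x - f x)\<^sup>2" for n x
  have iu: "integrable M (u n)" for n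
    unfolding u_def by (rule integrableI_bounded) (use n0[of "n + n0"] in auto)
  have "(\<lambda>n. ennreal (\<integral>x. norm (u n x) \<partial>M)) \<longlonglongrightarrow> 0"
  proof -
    have "ennreal (\<integral>x. norm (u n x) \<partial>M) = (\<integral>\<^sup>+x. ennreal ((F (n + n0) x - f x)\<^sup>2) \<partial>M)" for n
    proof -
      have "(\<integral>\<^sup>+x. ennreal (u n x) \<partial>M) = ennreal (\<integral>x. u n x \<partial>M)"
        by (rule nn_integral_eq_integral[OF iu]) (simp add: u_def)
      moreover have "norm (u n x) = u n x" for x by (simp add: u_def)
      ultimately show ?thesis by (simp add: u_def)
    qed
    then show ?thesis using LIMSEQ_ignore_initial_segment[OF lim, of n0] by simp
  qed
  then have "(\<lambda>n. \<integral>x. norm (u n x) \<partial>M) \<longlonglongrightarrow> 0"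
    unfolding ennreal_0[symmetric] by (subst (asm) tendsto_ennreal_iff) auto
  from tendsto_L1_AE_subseq[OF iu this]
  obtain r :: "nat \<Rightarrow> nat" where r: "strict_mono r" "AE x in M. (\<lambda>n. u (r n) x) \<longlonglongrightarrow> 0" by blast
  show ?thesis
  proof (rule that[of "\<lambda>n. r n + n0"])
    show "strict_mono (\<lambda>n. r n + n0)" using r(1) by (simp add: strict_mono_def)
    show "AE x in M. (\<lambda>n. F (r n + n0) x) \<longlonglongrightarrow> f x"
      using r(2)
    proof eventually_elim
      case (elim x)
      then have "(\<lambda>n. sqrt (u (r n) x)) \<longlonglongrightarrow> sqrt 0" by (rule tendsto_real_sqrt)
      then have "(\<lambda>n. F (r n + n0) x - f x) \<longlonglongrightarrow> 0" by (simp add: u_def tendsto_rabs_zero_iff)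
      then show ?case by (rule LIM_zero_cancel)
    qed
  qed
qed

section \<open>Measurability of the Green kernel and removal of the truncation\<close>

context green_function
begin

lemma borel_\<Omega> [measurable]: "\<Omega> \<in> sets borel" using open_\<Omega> by simp

lemma Phi_lim_measurable [measurable]: "Phi_lim \<in> borel_measurable borel"
proof -
  have [measurable]: "Phi (1 / Suc n) \<in> borel_measurable borel" for n
    using continuous_Phi[of "1 / Suc n" UNIV] by (intro borel_measurable_continuous_onI) auto
  show ?thesis unfolding Phi_lim_def[abs_def] by measurable
qed

text \<open>Cut off outside the domain, where nothing is known about \<^term>\<open>h\<close>, to be jointly Borel measurable.\<close>
definition regular_part :: "'a \<times> 'a \<Rightarrow> real" where "regular_part z = indicator (\<Omega> \<times> \<Omega>) z *\<^sub>R (case z of (x, y) \<Rightarrow> h x y)"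

lemma regular_part_measurable [measurable]: "regular_part \<in> borel_measurable (borel \<Otimes>\<^sub>M borel)"
proof -
  have "\<Omega> \<times> \<Omega> \<in> sets borel" using open_\<Omega> by (intro borel_open open_Times)
  then have "regular_part \<in> borel_measurable borel"
    unfolding regular_part_def[abs_def] by (rule borel_measurable_continuous_on_indicator[OF _ h_cont])
  then show ?thesis by (simp add: borel_prod)
qed

lemma regular_part_eq: "x \<in> \<Omega> \<Longrightarrow> y \<in> \<Omega> \<Longrightarrow> regular_part (x, y) = h x y"
  by (simp add: regular_part_def)

text \<open>Nonnegativity of \<open>g t x\<close> is known only for \<open>x\<close> in
  \<open>inner_region t\<close>. Every point of \<Omega> is there for small \<open>t\<close>, so the
  limit inherits the bounds.\<close>

lemma Ghat_bounds:
  assumes x: "x \<in> \<Omega>" and y: "y \<in> \<Omega>" and fin: "near_kernel T (y - x) < \<infinity>"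
  shows "0 \<le> Phi_lim (y - x) + h x y" "ennreal (Phi_lim (y - x) + h x y) \<le> near_kernel T (y - x)"
    "(\<lambda>n. g (1 / Suc n) x y) \<longlonglongrightarrow> Phi_lim (y - x) + h x y"
proof -
  show lim: "(\<lambda>n. g (1 / Suc n) x y) \<longlonglongrightarrow> Phi_lim (y - x) + h x y"
    unfolding g_def by (intro tendsto_intros Phi_tendsto_Phi_lim[OF fin T_pos])
  obtain e where e: "e > 0" "\<And>t. t < e \<Longrightarrow> x \<in> inner_region t" using inner_region_exhausts[OF x] by blast
  have "\<forall>\<^sub>F n in sequentially. inverse (real (Suc n)) < min e T"
    using e T_pos by (intro order_tendstoD(2)[OF LIMSEQ_inverse_real_of_nat]) auto
  then have ev: "\<forall>\<^sub>F n in sequentially. 0 \<le> g (1 / Suc n) x y \<and> ennreal (g (1 / Suc n) x y) \<le> near_kernel T (y - x)"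
  proof eventually_elim
    case (elim n)
    then show ?case using g_nonneg[of "1 / Suc n" x y] g_le(2)[of "1 / Suc n" x y] e(2)[of "1 / Suc n"] x y
      by (auto simp: inverse_eq_divide)
  qed
  show "0 \<le> Phi_lim (y - x) + h x y"
    by (rule tendsto_lowerbound[OF lim]) (use ev in \<open>auto elim: eventually_mono\<close>)
  show "ennreal (Phi_lim (y - x) + h x y) \<le> near_kernel T (y - x)"
    by (rule tendsto_upperbound[OF tendsto_ennrealI[OF lim]]) (use ev in \<open>auto elim: eventually_mono\<close>)
qed

text \<open>The truncations \<open>cut\<close> are admissible in \<open>weak\<close>. When their
  level tends to 0, the gradient side is dominated by |Du| |grad g|, integrable by the energy bound,
  and the \<mu> side by |w| times \<open>g_bound t\<close>. The density is arbitrary so that it can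
  absorb the eigenvalue.\<close>

lemma weak_pairing:
  assumes t: "0 < t" "t \<le> T" and x: "x \<in> inner_region t"
    and Du: "(\<lambda>y. indicator \<Omega> y *\<^sub>R Du y) \<in> borel_measurable lebesgue"
    and DuL2: "(\<integral>\<^sup>+y. ennreal ((norm (indicator \<Omega> y *\<^sub>R Du y))\<^sup>2) \<partial>lebesgue) < \<infinity>"
    and \<mu>[measurable_cong]: "sets \<mu> = sets borel" and w: "set_integrable \<mu> \<Omega> w"
    and weak: "\<And>\<psi> B K. C1_grad UNIV \<psi> B \<Longrightarrow> compact K \<Longrightarrow> K \<subseteq> \<Omega> \<Longrightarrow> (\<And>x. x \<notin> K \<Longrightarrow> \<psi> x = 0) \<Longrightarrow>
       (LINT x:\<Omega>|lebesgue. Du x \<bullet> B x) = (LINT x:\<Omega>|\<mu>. w x * \<psi> x)"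
  shows "(LINT y:\<Omega>|lebesgue. Du y \<bullet> grad_g t x y) = (LINT y:\<Omega>|\<mu>. w y * g t x y)"
    and "(\<lambda>y. indicator \<Omega> y *\<^sub>R grad_g t x y) \<in> borel_measurable lebesgue"
    and "(\<integral>\<^sup>+y. ennreal ((norm (indicator \<Omega> y *\<^sub>R grad_g t x y))\<^sup>2) \<partial>lebesgue) < \<infinity>"
proof -
  define DU where "DU y = indicator \<Omega> y *\<^sub>R Du y" for y
  define GA where "GA y = indicator \<Omega> y *\<^sub>R grad_g t x y" for y
  have mDU: "DU \<in> borel_measurable lebesgue" using Du by (simp add: DU_def[abs_def])
  have mGA: "GA \<in> borel_measurable lborel"
    unfolding GA_def[abs_def] using borel_measurable_continuous_on_indicator[OF borel_\<Omega> grad_g_continuous[OF t x]] by simp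
  have mGA': "GA \<in> borel_measurable lebesgue" using mGA by (rule measurable_completion)
  then show "(\<lambda>y. indicator \<Omega> y *\<^sub>R grad_g t x y) \<in> borel_measurable lebesgue" by (simp add: GA_def[abs_def])
  have GAL2: "(\<integral>\<^sup>+y. ennreal ((norm (GA y))\<^sup>2) \<partial>lebesgue) < \<infinity>"
    using grad_g_energy[OF t x] by (simp add: GA_def nn_integral_completion order.strict_trans1 ennreal_less_top)
  then show "(\<integral>\<^sup>+y. ennreal ((norm (indicator \<Omega> y *\<^sub>R grad_g t x y))\<^sup>2) \<partial>lebesgue) < \<infinity>" by (simp add: GA_def)
  have prod: "integrable lebesgue (\<lambda>y. norm (DU y) * norm (GA y))"
    by (rule L2_product_integrable(1)[OF mDU mGA' _ GAL2]) (use DuL2 in \<open>simp add: DU_def\<close>)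
  have cutm: "cut' (1 / Suc n) t x \<in> borel_measurable lebesgue" for n
  proof (rule measurable_completion)
    show "cut' (1 / Suc n) t x \<in> borel_measurable lborel"
      using cut_C1(1)[OF t x, of "1 / Suc n"] by (simp add: C1_grad_def borel_measurable_continuous_onI)
  qed
  have cutm2: "cut (1 / Suc n) t x \<in> borel_measurable \<mu>" for n
    using C1_grad_continuous[OF cut_C1(1)[OF t x, of "1 / Suc n"]]
    by (simp add: borel_measurable_continuous_onI measurable_cong_sets[OF \<mu> refl])
  have L1: "(\<lambda>n. integral\<^sup>L lebesgue (\<lambda>y. DU y \<bullet> cut' (1 / Suc n) t x y)) \<longlonglongrightarrow> integral\<^sup>L lebesgue (\<lambda>y. DU y \<bullet> GA y)"
  proof (rule integral_dominated_convergence[where w="\<lambda>y. norm (DU y) * norm (GA y)"])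
    show "(\<lambda>y. DU y \<bullet> GA y) \<in> borel_measurable lebesgue" using mDU mGA' by (rule borel_measurable_inner)
    show "(\<lambda>y. DU y \<bullet> cut' (1 / Suc n) t x y) \<in> borel_measurable lebesgue" for n using mDU cutm by (rule borel_measurable_inner)
    show "AE y in lebesgue. (\<lambda>n. DU y \<bullet> cut' (1 / Suc n) t x y) \<longlonglongrightarrow> DU y \<bullet> GA y"
    proof (intro AE_I2)
      fix y
      show "(\<lambda>n. DU y \<bullet> cut' (1 / Suc n) t x y) \<longlonglongrightarrow> DU y \<bullet> GA y"
      proof (cases "y \<in> \<Omega>")
        case True
        have "(\<lambda>n. DU y \<bullet> cut' (1 / Suc n) t x y) \<longlonglongrightarrow> DU y \<bullet> grad_g t x y"
          by (intro tendsto_intros cut'_tendsto[OF t x True])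
        then show ?thesis using True by (simp add: GA_def)
      qed (simp add: DU_def)
    qed
    show "AE y in lebesgue. norm (DU y \<bullet> cut' (1 / Suc n) t x y) \<le> norm (DU y) * norm (GA y)" for n
    proof (intro AE_I2)
      fix y
      have "norm (cut' (1 / Suc n) t x y) \<le> norm (GA y)"
        using shrink'_bounds[of "1 / Suc n" "g t x y"] by (auto simp: cut'_def GA_def intro!: mult_left_le_one_le)
      then show "norm (DU y \<bullet> cut' (1 / Suc n) t x y) \<le> norm (DU y) * norm (GA y)"
        using Cauchy_Schwarz_ineq2[of "DU y" "cut' (1 / Suc n) t x y"]
          mult_left_mono[of "norm (cut' (1 / Suc n) t x y)" "norm (GA y)" "norm (DU y)"] by simp
    qed
  qed (rule prod)
  have L2: "(\<lambda>n. integral\<^sup>L \<mu> (\<lambda>y. indicator \<Omega> y *\<^sub>R (w y * cut (1 / Suc n) t x y)))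
      \<longlonglongrightarrow> integral\<^sup>L \<mu> (\<lambda>y. indicator \<Omega> y *\<^sub>R (w y * g t x y))"
  proof (rule integral_dominated_convergence[where w="\<lambda>y. norm (indicator \<Omega> y *\<^sub>R w y) * g_bound t"])
    have mw: "(\<lambda>y. indicator \<Omega> y *\<^sub>R w y) \<in> borel_measurable \<mu>"
      using w borel_measurable_integrable unfolding set_integrable_def by blast
    have mg: "(\<lambda>y. indicator \<Omega> y *\<^sub>R g t x y) \<in> borel_measurable \<mu>"
      using borel_measurable_continuous_on_indicator[OF borel_\<Omega> g_continuous[OF t x]]
      by (simp add: measurable_cong_sets[OF \<mu> refl])
    show "integrable \<mu> (\<lambda>y. norm (indicator \<Omega> y *\<^sub>R w y) * g_bound t)"
      using w unfolding set_integrable_def by (intro integrable_mult_left integrable_norm)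
    have "(\<lambda>y. (indicator \<Omega> y *\<^sub>R w y) * (indicator \<Omega> y *\<^sub>R g t x y)) = (\<lambda>y. indicator \<Omega> y *\<^sub>R (w y * g t x y))"
      by (auto simp: fun_eq_iff indicator_def)
    then show "(\<lambda>y. indicator \<Omega> y *\<^sub>R (w y * g t x y)) \<in> borel_measurable \<mu>"
      using borel_measurable_times[OF mw mg] by simp
    show "(\<lambda>y. indicator \<Omega> y *\<^sub>R (w y * cut (1 / Suc n) t x y)) \<in> borel_measurable \<mu>" for n
      using borel_measurable_times[OF mw cutm2] by (simp add: mult.assoc)
    show "AE y in \<mu>. (\<lambda>n. indicator \<Omega> y *\<^sub>R (w y * cut (1 / Suc n) t x y)) \<longlonglongrightarrow> indicator \<Omega> y *\<^sub>R (w y * g t x y)"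
    proof (intro AE_I2)
      fix y
      show "(\<lambda>n. indicator \<Omega> y *\<^sub>R (w y * cut (1 / Suc n) t x y)) \<longlonglongrightarrow> indicator \<Omega> y *\<^sub>R (w y * g t x y)"
      proof (cases "y \<in> \<Omega>")
        case True
        show ?thesis by (intro tendsto_intros cut_tendsto[OF t x True])
      qed simp
    qed
    show "AE y in \<mu>. norm (indicator \<Omega> y *\<^sub>R (w y * cut (1 / Suc n) t x y)) \<le> norm (indicator \<Omega> y *\<^sub>R w y) * g_bound t" for n
    proof (intro AE_I2)
      fix y
      have "\<bar>cut (1 / Suc n) t x y\<bar> \<le> g_bound t" using cut_bounds[OF t x, of "1 / Suc n" y] by simp
      then show "norm (indicator \<Omega> y *\<^sub>R (w y * cut (1 / Suc n) t x y)) \<le> norm (indicator \<Omega> y *\<^sub>R w y) * g_bound t"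
        by (auto simp: indicator_def abs_mult intro: mult_left_mono)
    qed
  qed
  have eqn: "integral\<^sup>L lebesgue (\<lambda>y. DU y \<bullet> cut' (1 / Suc n) t x y) = integral\<^sup>L \<mu> (\<lambda>y. indicator \<Omega> y *\<^sub>R (w y * cut (1 / Suc n) t x y))" for n
    using weak[OF cut_C1(1)[OF t x, of "1 / Suc n"] cut_C1(2)[OF t x, of "1 / Suc n"] _ cut_off[OF t x, of "1 / Suc n"]]
    by (simp add: set_lebesgue_integral_def DU_def)
  have "integral\<^sup>L lebesgue (\<lambda>y. DU y \<bullet> GA y) = integral\<^sup>L \<mu> (\<lambda>y. indicator \<Omega> y *\<^sub>R (w y * g t x y))"
    by (rule LIMSEQ_unique[OF L1[unfolded eqn] L2])
  moreover have "(\<lambda>y. DU y \<bullet> GA y) = (\<lambda>y. indicator \<Omega> y *\<^sub>R (Du y \<bullet> grad_g t x y))"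
    by (auto simp: fun_eq_iff DU_def GA_def indicator_def)
  ultimately show "(LINT y:\<Omega>|lebesgue. Du y \<bullet> grad_g t x y) = (LINT y:\<Omega>|\<mu>. w y * g t x y)"
    by (simp add: set_lebesgue_integral_def)
qed

end

section \<open>The Green representation\<close>

context green_function
begin

definition smoothed_potential :: "'a measure \<Rightarrow> ('a \<Rightarrow> real) \<Rightarrow> real \<Rightarrow> 'a \<Rightarrow> real" where
  "smoothed_potential \<mu> w t x = (LINT y:\<Omega>|\<mu>. w y * g t x y)"

definition green_potential :: "'a measure \<Rightarrow> ('a \<Rightarrow> real) \<Rightarrow> 'a \<Rightarrow> real" where
  "green_potential \<mu> w x = (LINT y:\<Omega>|\<mu>. w y * (Phi_lim (y - x) + h x y))"

lemma smoothed_potential_measurable: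
  assumes \<mu>: "finite_measure \<mu>" and [measurable_cong]: "sets \<mu> = sets borel" and w: "set_integrable \<mu> \<Omega> w" and t: "t > 0"
  shows "(\<lambda>x. indicator \<Omega> x * smoothed_potential \<mu> w t x) \<in> borel_measurable borel"
proof -
  interpret finite_measure \<mu> by fact
  have [measurable]: "(\<lambda>y. indicator \<Omega> y * w y) \<in> borel_measurable \<mu>"
    using w borel_measurable_integrable unfolding set_integrable_def by force
  have [measurable]: "Phi t \<in> borel_measurable borel"
    using continuous_Phi[OF t, of UNIV] by (intro borel_measurable_continuous_onI)
  have "(\<lambda>x. indicator \<Omega> x * smoothed_potential \<mu> w t x) = (\<lambda>x. indicator \<Omega> x * integral\<^sup>L \<mu> (\<lambda>y. (indicator \<Omega> y * w y) * (Phi t (y - x) + regular_part (x, y))))"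
  proof
    fix x
    show "indicator \<Omega> x * smoothed_potential \<mu> w t x = indicator \<Omega> x * integral\<^sup>L \<mu> (\<lambda>y. (indicator \<Omega> y * w y) * (Phi t (y - x) + regular_part (x, y)))"
    proof (cases "x \<in> \<Omega>")
      case True
      have "(\<lambda>y. indicator \<Omega> y *\<^sub>R (w y * g t x y)) = (\<lambda>y. (indicator \<Omega> y * w y) * (Phi t (y - x) + regular_part (x, y)))"
        using True by (auto simp: fun_eq_iff indicator_def g_def regular_part_eq)
      then show ?thesis by (simp add: smoothed_potential_def set_lebesgue_integral_def)
    qed simp
  qed
  moreover have "(\<lambda>x. indicator \<Omega> x * integral\<^sup>L \<mu> (\<lambda>y. (indicator \<Omega> y * w y) * (Phi t (y - x) + regular_part (x, y)))) \<in> borel_measurable borel"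
    by measurable
  ultimately show ?thesis by simp
qed

lemma green_potential_measurable:
  assumes \<mu>: "finite_measure \<mu>" and [measurable_cong]: "sets \<mu> = sets borel" and w: "set_integrable \<mu> \<Omega> w"
  shows "(\<lambda>x. indicator \<Omega> x * green_potential \<mu> w x) \<in> borel_measurable borel"
proof -
  interpret finite_measure \<mu> by fact
  have [measurable]: "(\<lambda>y. indicator \<Omega> y * w y) \<in> borel_measurable \<mu>"
    using w borel_measurable_integrable unfolding set_integrable_def by force
  have "(\<lambda>x. indicator \<Omega> x * green_potential \<mu> w x) = (\<lambda>x. indicator \<Omega> x * integral\<^sup>L \<mu> (\<lambda>y. (indicator \<Omega> y * w y) * (Phi_lim (y - x) + regular_part (x, y))))"
  proof
    fix x
    show "indicator \<Omega> x * green_potential \<mu> w x = indicator \<Omega> x * integral\<^sup>L \<mu> (\<lambda>y. (indicator \<Omega> y * w y) * (Phi_lim (y - x) + regular_part (x, y)))"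
    proof (cases "x \<in> \<Omega>")
      case True
      have "(\<lambda>y. indicator \<Omega> y *\<^sub>R (w y * (Phi_lim (y - x) + h x y))) = (\<lambda>y. (indicator \<Omega> y * w y) * (Phi_lim (y - x) + regular_part (x, y)))"
        using True by (auto simp: fun_eq_iff indicator_def regular_part_eq)
      then show ?thesis by (simp add: green_potential_def set_lebesgue_integral_def)
    qed simp
  qed
  moreover have "(\<lambda>x. indicator \<Omega> x * integral\<^sup>L \<mu> (\<lambda>y. (indicator \<Omega> y * w y) * (Phi_lim (y - x) + regular_part (x, y)))) \<in> borel_measurable borel"
    by measurable
  ultimately show ?thesis by simp
qed

lemma w_measurable:
  fixes w :: "'a \<Rightarrow> real"
  shows "set_integrable \<mu> \<Omega> w \<Longrightarrow> (\<lambda>y. indicator \<Omega> y * w y) \<in> borel_measurable \<mu>"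
  using borel_measurable_integrable[of \<mu> "\<lambda>x. indicator \<Omega> x *\<^sub>R w x"] by (simp add: set_integrable_def)

text \<open>Finiteness of the integral forces the density to vanish almost everywhere where the
  kernel is infinite. Elsewhere \<open>enn2real\<close> loses nothing, and the product is a real
  dominating function.\<close>

lemma w_near_kernel_integrable:
  assumes \<mu>[measurable_cong]: "sets \<mu> = sets borel" and w: "set_integrable \<mu> \<Omega> w"
    and fin: "(\<integral>\<^sup>+y. ennreal \<bar>indicator \<Omega> y * w y\<bar> * near_kernel T (y - x) \<partial>\<mu>) < \<infinity>"
  shows "integrable \<mu> (\<lambda>y. \<bar>indicator \<Omega> y * w y\<bar> * enn2real (near_kernel T (y - x)))"
    and "AE y in \<mu>. indicator \<Omega> y * w y = 0 \<or> near_kernel T (y - x) < \<infinity>"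
proof -
  have [measurable]: "(\<lambda>y. indicator \<Omega> y * w y) \<in> borel_measurable \<mu>" by (rule w_measurable[OF w])
  have "AE y in \<mu>. ennreal \<bar>indicator \<Omega> y * w y\<bar> * near_kernel T (y - x) \<noteq> \<infinity>"
    by (rule nn_integral_PInf_AE) (use fin in auto)
  then show ae: "AE y in \<mu>. indicator \<Omega> y * w y = 0 \<or> near_kernel T (y - x) < \<infinity>"
    by eventually_elim (auto simp: ennreal_mult_eq_top_iff less_top[symmetric])
  have "(\<integral>\<^sup>+y. ennreal (norm (\<bar>indicator \<Omega> y * w y\<bar> * enn2real (near_kernel T (y - x)))) \<partial>\<mu>)
      = (\<integral>\<^sup>+y. ennreal \<bar>indicator \<Omega> y * w y\<bar> * near_kernel T (y - x) \<partial>\<mu>)"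
  proof (rule nn_integral_cong_AE)
    show "AE y in \<mu>. ennreal (norm (\<bar>indicator \<Omega> y * w y\<bar> * enn2real (near_kernel T (y - x)))) = ennreal \<bar>indicator \<Omega> y * w y\<bar> * near_kernel T (y - x)"
      using ae by eventually_elim (auto simp: ennreal_mult abs_mult)
  qed
  then show "integrable \<mu> (\<lambda>y. \<bar>indicator \<Omega> y * w y\<bar> * enn2real (near_kernel T (y - x)))"
    using fin by (intro integrableI_bounded) auto
qed

text \<open>Both \<open>g\<close> and its limit lie between 0 and \<open>near_kernel T\<close>, so
  the weighted kernel dominates. Where the kernel is infinite the density is almost everywhere zero,
  and junk values do not matter.\<close>

lemma smoothed_potential_tendsto_green_potential:
  assumes \<mu>[measurable_cong]: "sets \<mu> = sets borel" and w: "set_integrable \<mu> \<Omega> w" and x: "x \<in> \<Omega>"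
    and fin: "(\<integral>\<^sup>+y. ennreal \<bar>indicator \<Omega> y * w y\<bar> * near_kernel T (y - x) \<partial>\<mu>) < \<infinity>"
  shows "(\<lambda>n. smoothed_potential \<mu> w (1 / Suc n) x) \<longlonglongrightarrow> green_potential \<mu> w x"
    and "ennreal \<bar>green_potential \<mu> w x\<bar> \<le> (\<integral>\<^sup>+y. ennreal \<bar>indicator \<Omega> y * w y\<bar> * near_kernel T (y - x) \<partial>\<mu>)"
proof -
  have [measurable]: "(\<lambda>y. indicator \<Omega> y * w y) \<in> borel_measurable \<mu>" by (rule w_measurable[OF w])
  note KI = w_near_kernel_integrable[OF \<mu> w fin]
  obtain e where e: "e > 0" "\<And>t. t < e \<Longrightarrow> x \<in> inner_region t" using inner_region_exhausts[OF x] by blast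
  have "\<forall>\<^sub>F n in sequentially. inverse (real (Suc n)) < min e T"
    using e T_pos by (intro order_tendstoD(2)[OF LIMSEQ_inverse_real_of_nat]) auto
  then obtain n0 where n0: "\<And>n. n \<ge> n0 \<Longrightarrow> 1 / real (Suc n) < min e T"
    by (auto simp: eventually_sequentially inverse_eq_divide)
  \<comment> \<open>The shift makes every member of the sequence satisfy the side conditions
    \<open>s n \<le> T\<close> and \<open>x \<in> inner_region (s n)\<close>.\<close>
  define s where "s n = 1 / real (Suc (n + n0))" for n
  have s: "0 < s n" "s n \<le> T" "x \<in> inner_region (s n)" for n
    using n0[of "n + n0"] e(2)[of "s n"] by (auto simp: s_def)
  have hx: "(\<lambda>y. regular_part (x, y)) \<in> borel_measurable \<mu>" by measurable
  have [measurable]: "Phi (s n) \<in> borel_measurable borel" for n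
    using continuous_Phi[OF s(1), of UNIV] by (intro borel_measurable_continuous_onI)
  have "(\<lambda>n. integral\<^sup>L \<mu> (\<lambda>y. indicator \<Omega> y *\<^sub>R (w y * g (s n) x y))) \<longlonglongrightarrow>
      integral\<^sup>L \<mu> (\<lambda>y. indicator \<Omega> y *\<^sub>R (w y * (Phi_lim (y - x) + h x y)))"
  proof (rule integral_dominated_convergence[where w="\<lambda>y. \<bar>indicator \<Omega> y * w y\<bar> * enn2real (near_kernel T (y - x))"])
    show "integrable \<mu> (\<lambda>y. \<bar>indicator \<Omega> y * w y\<bar> * enn2real (near_kernel T (y - x)))" by (rule KI(1))
    have "(\<lambda>y. indicator \<Omega> y *\<^sub>R (w y * (Phi_lim (y - x) + h x y))) = (\<lambda>y. (indicator \<Omega> y * w y) * (Phi_lim (y - x) + regular_part (x, y)))"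
      using x by (auto simp: fun_eq_iff indicator_def regular_part_eq)
    then show "(\<lambda>y. indicator \<Omega> y *\<^sub>R (w y * (Phi_lim (y - x) + h x y))) \<in> borel_measurable \<mu>" by simp
    show "(\<lambda>y. indicator \<Omega> y *\<^sub>R (w y * g (s n) x y)) \<in> borel_measurable \<mu>" for n
    proof -
      have "(\<lambda>y. indicator \<Omega> y *\<^sub>R (w y * g (s n) x y)) = (\<lambda>y. (indicator \<Omega> y * w y) * (Phi (s n) (y - x) + regular_part (x, y)))"
        using x by (auto simp: fun_eq_iff indicator_def regular_part_eq g_def)
      then show ?thesis by simp
    qed
    show "AE y in \<mu>. (\<lambda>n. indicator \<Omega> y *\<^sub>R (w y * g (s n) x y)) \<longlonglongrightarrow> indicator \<Omega> y *\<^sub>R (w y * (Phi_lim (y - x) + h x y))"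
      using KI(2)
    proof eventually_elim
      case (elim y)
      show ?case
      proof (cases "indicator \<Omega> y * w y = 0")
        case True
        then have zero: "indicator \<Omega> y *\<^sub>R (w y * z) = 0" for z by auto
        show ?thesis unfolding zero by (rule tendsto_const)
      next
        case False
        then have y: "y \<in> \<Omega>" "near_kernel T (y - x) < \<infinity>"
          using elim by (auto simp: indicator_def split: if_splits)
        have "(\<lambda>n. g (s n) x y) \<longlonglongrightarrow> Phi_lim (y - x) + h x y"
          unfolding s_def using LIMSEQ_ignore_initial_segment[OF Ghat_bounds(3)[OF x y], of n0] by simp
        then show ?thesis by (intro tendsto_intros)
      qed
    qed
    show "AE y in \<mu>. norm (indicator \<Omega> y *\<^sub>R (w y * g (s n) x y)) \<le> \<bar>indicator \<Omega> y * w y\<bar> * enn2real (near_kernel T (y - x))" for n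
      using KI(2)
    proof eventually_elim
      case (elim y)
      show ?case
      proof (cases "indicator \<Omega> y * w y = 0")
        case True
        then have zero: "indicator \<Omega> y *\<^sub>R (w y * z) = 0" for z by auto
        show ?thesis unfolding zero by simp
      next
        case False
        then have y: "y \<in> \<Omega>" "near_kernel T (y - x) < \<infinity>"
          using elim by (auto simp: indicator_def split: if_splits)
        have "0 \<le> g (s n) x y" by (rule g_nonneg[OF s(1,3) y(1)])
        moreover have "g (s n) x y \<le> enn2real (near_kernel T (y - x))"
          using g_le(2)[OF s(1,2) x y(1), of n] y(2) calculation
          by (metis enn2real_ennreal enn2real_mono infinity_ennreal_def)
        ultimately show ?thesis using y(1) by (simp add: abs_mult mult_left_mono)
      qed
    qed
  qed
  then have lim: "(\<lambda>n. smoothed_potential \<mu> w (s n) x) \<longlonglongrightarrow> green_potential \<mu> w x" by (simp add: smoothed_potential_def green_potential_def set_lebesgue_integral_def)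
  then show "(\<lambda>n. smoothed_potential \<mu> w (1 / Suc n) x) \<longlonglongrightarrow> green_potential \<mu> w x"
    unfolding s_def by (rule LIMSEQ_offset)
  have "ennreal \<bar>green_potential \<mu> w x\<bar> \<le> (\<integral>\<^sup>+y. ennreal (norm (indicator \<Omega> y *\<^sub>R (w y * (Phi_lim (y - x) + h x y)))) \<partial>\<mu>)"
    using norm_integral_le_nn_integral[of "\<mu>" "(\<lambda>y. indicator \<Omega> y *\<^sub>R (w y * (Phi_lim (y - x) + h x y)))"] by (simp add: green_potential_def set_lebesgue_integral_def)
  also have "\<dots> \<le> (\<integral>\<^sup>+y. ennreal \<bar>indicator \<Omega> y * w y\<bar> * near_kernel T (y - x) \<partial>\<mu>)"
  proof (rule nn_integral_mono_AE)
    show "AE y in \<mu>. ennreal (norm (indicator \<Omega> y *\<^sub>R (w y * (Phi_lim (y - x) + h x y)))) \<le> ennreal \<bar>indicator \<Omega> y * w y\<bar> * near_kernel T (y - x)"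
      using KI(2)
    proof eventually_elim
      case (elim y)
      show ?case
      proof (cases "indicator \<Omega> y * w y = 0")
        case True
        then have zero: "indicator \<Omega> y *\<^sub>R (w y * z) = 0" for z by auto
        show ?thesis unfolding zero by simp
      next
        case False
        then have y: "y \<in> \<Omega>" "near_kernel T (y - x) < \<infinity>"
          using elim by (auto simp: indicator_def split: if_splits)
        have "ennreal (norm (indicator \<Omega> y *\<^sub>R (w y * (Phi_lim (y - x) + h x y)))) = ennreal \<bar>w y\<bar> * ennreal (Phi_lim (y - x) + h x y)"
          using Ghat_bounds(1)[OF x y] y by (simp add: abs_mult ennreal_mult)
        also have "\<dots> \<le> ennreal \<bar>w y\<bar> * near_kernel T (y - x)" by (intro mult_left_mono Ghat_bounds(2)[OF x y]) simp
        finally show ?thesis using y by simp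
      qed
    qed
  qed
  finally show "ennreal \<bar>green_potential \<mu> w x\<bar> \<le> (\<integral>\<^sup>+y. ennreal \<bar>indicator \<Omega> y * w y\<bar> * near_kernel T (y - x) \<partial>\<mu>)" .
qed

text \<open>Tonelli: integrating first over \<nu> uses the uniform potential bound and leaves the L1
  norm of the density. The two measures may differ.\<close>

lemma AE_near_kernel_finite:
  assumes \<nu>: "finite_measure \<nu>" and s\<nu>[measurable_cong]: "sets \<nu> = sets borel"
    and pot: "\<And>y. (\<integral>\<^sup>+x. near_kernel T (x - y) \<partial>\<nu>) \<le> ennreal k"
    and \<mu>: "finite_measure \<mu>" and s\<mu>[measurable_cong]: "sets \<mu> = sets borel" and w: "set_integrable \<mu> \<Omega> w"
  shows "AE x in \<nu>. (\<integral>\<^sup>+y. ennreal \<bar>indicator \<Omega> y * w y\<bar> * near_kernel T (y - x) \<partial>\<mu>) < \<infinity>"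
proof -
  interpret N: finite_measure \<nu> by fact
  interpret M: finite_measure \<mu> by fact
  interpret P: pair_sigma_finite \<mu> \<nu> ..
  have [measurable]: "(\<lambda>y. indicator \<Omega> y * w y) \<in> borel_measurable \<mu>" by (rule w_measurable[OF w])
  have "(\<integral>\<^sup>+x. \<integral>\<^sup>+y. ennreal \<bar>indicator \<Omega> y * w y\<bar> * near_kernel T (y - x) \<partial>\<mu> \<partial>\<nu>)
      = (\<integral>\<^sup>+y. \<integral>\<^sup>+x. ennreal \<bar>indicator \<Omega> y * w y\<bar> * near_kernel T (y - x) \<partial>\<nu> \<partial>\<mu>)"
    by (rule P.Fubini') measurable
  also have "\<dots> \<le> (\<integral>\<^sup>+y. ennreal \<bar>indicator \<Omega> y * w y\<bar> * ennreal k \<partial>\<mu>)"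
  proof (rule nn_integral_mono)
    fix y
    have "(\<integral>\<^sup>+x. ennreal \<bar>indicator \<Omega> y * w y\<bar> * near_kernel T (y - x) \<partial>\<nu>) = ennreal \<bar>indicator \<Omega> y * w y\<bar> * (\<integral>\<^sup>+x. near_kernel T (x - y) \<partial>\<nu>)"
      by (subst near_kernel_minus, rule nn_integral_cmult) measurable
    also have "\<dots> \<le> ennreal \<bar>indicator \<Omega> y * w y\<bar> * ennreal k" by (intro mult_left_mono pot) simp
    finally show "(\<integral>\<^sup>+x. ennreal \<bar>indicator \<Omega> y * w y\<bar> * near_kernel T (y - x) \<partial>\<nu>) \<le> ennreal \<bar>indicator \<Omega> y * w y\<bar> * ennreal k" .
  qed
  also have "\<dots> = (\<integral>\<^sup>+y. ennreal \<bar>indicator \<Omega> y * w y\<bar> \<partial>\<mu>) * ennreal k"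
    by (rule nn_integral_multc) measurable
  also have "\<dots> < \<infinity>"
    using w unfolding set_integrable_def integrable_iff_bounded by (simp add: ennreal_mult_less_top)
  finally have "(\<integral>\<^sup>+x. \<integral>\<^sup>+y. ennreal \<bar>indicator \<Omega> y * w y\<bar> * near_kernel T (y - x) \<partial>\<mu> \<partial>\<nu>) \<noteq> \<infinity>" by simp
  then have "AE x in \<nu>. (\<integral>\<^sup>+y. ennreal \<bar>indicator \<Omega> y * w y\<bar> * near_kernel T (y - x) \<partial>\<mu>) \<noteq> \<infinity>"
    by (intro nn_integral_PInf_AE) measurable
  then show ?thesis by eventually_elim (simp add: less_top[symmetric])
qed

text \<open>The limits are taken in a fixed order. For fixed \<open>t\<close>, letting n grow turns
  the averages into the smoothed potential at each point of \<open>inner_region t\<close>, by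
  \<open>avg_eq_pairing\<close> and \<open>weak_pairing\<close>, while the energy estimate bounds
  the L1 distance to \<open>c * f\<close> by \<open>E t\<close>. Then \<open>t\<close> tends to
  0.\<close>

lemma representation:
  assumes \<nu>: "finite_measure \<nu>" and s\<nu>[measurable_cong]: "sets \<nu> = sets borel"
    and growth: "\<And>y r. r > 0 \<Longrightarrow> emeasure \<nu> (ball y r) \<le> ennreal (C * r powr Q)" and Q: "Q > d - 2" and C: "C \<ge> 0"
    and \<mu>: "finite_measure \<mu>" and s\<mu>[measurable_cong]: "sets \<mu> = sets borel" and w: "set_integrable \<mu> \<Omega> w"
    and Du: "(\<lambda>y. indicator \<Omega> y *\<^sub>R Du y) \<in> borel_measurable lebesgue"
    and DuL2: "(\<integral>\<^sup>+y. ennreal ((norm (indicator \<Omega> y *\<^sub>R Du y))\<^sup>2) \<partial>lebesgue) < \<infinity>"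
    and weak: "\<And>\<psi> B K. C1_grad UNIV \<psi> B \<Longrightarrow> compact K \<Longrightarrow> K \<subseteq> \<Omega> \<Longrightarrow> (\<And>x. x \<notin> K \<Longrightarrow> \<psi> x = 0) \<Longrightarrow>
       (LINT x:\<Omega>|lebesgue. Du x \<bullet> B x) = (LINT x:\<Omega>|\<mu>. w x * \<psi> x)"
    and \<phi>: "\<And>n. test_fun \<Omega> (\<phi> n)"
    and \<phi>N: "\<And>n. (\<integral>\<^sup>+y. ennreal ((norm (grad (\<phi> n) y))\<^sup>2) \<partial>lborel) \<le> ennreal N" and N: "N \<ge> 0"
    and \<phi>Du: "(\<lambda>n. \<integral>\<^sup>+y. ennreal ((norm (indicator \<Omega> y *\<^sub>R grad (\<phi> n) y - indicator \<Omega> y *\<^sub>R Du y))\<^sup>2) \<partial>lebesgue) \<longlonglongrightarrow> 0"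
    and f[measurable]: "f \<in> borel_measurable \<nu>"
    and \<phi>f: "(\<lambda>n. \<integral>\<^sup>+x. ennreal ((indicator \<Omega> x * \<phi> n x - indicator \<Omega> x * f x)\<^sup>2) \<partial>\<nu>) \<longlonglongrightarrow> 0"
  shows "AE x in \<nu>. x \<in> \<Omega> \<longrightarrow> c * f x = green_potential \<mu> w x"
proof -
  interpret N: finite_measure \<nu> by fact
  interpret M: finite_measure \<mu> by fact
  define \<alpha> where "\<alpha> = (Q - d) / 2 + 1"
  have \<alpha>: "\<alpha> > 0" using Q by (simp add: \<alpha>_def field_simps)
  define k where "k t = \<kappa> * C * (t powr \<alpha> / \<alpha>)" for t
  have pot: "(\<integral>\<^sup>+x. near_kernel t (x - y) \<partial>\<nu>) \<le> ennreal (k t)" if "t > 0" for t y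
    unfolding k_def \<alpha>_def by (rule near_kernel_potential(2)[OF s\<nu> \<nu> growth Q C that])
  have k0: "k t \<ge> 0" for t using \<kappa>_pos C \<alpha> by (simp add: k_def)
  define E where "E t = sqrt (N * (2 * k t * c * measure \<nu> (space \<nu>)))" for t
  have C1: "C1_grad UNIV (\<phi> n) (grad (\<phi> n))" for n by (rule test_fun_C1_grad[OF \<phi>])
  have c\<phi>: "continuous_on UNIV (\<phi> n)" for n by (rule C1_grad_continuous[OF C1])
  have [measurable]: "\<phi> n \<in> borel_measurable borel" for n
    using c\<phi> by (rule borel_measurable_continuous_onI)
  have [measurable]: "avg t (\<phi> n) \<in> borel_measurable borel" for t n by (rule avg_measurable[OF c\<phi>])
  have [measurable]: "inner_region t \<in> sets borel" for t using open_inner_region by simp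
  have est: "(\<integral>\<^sup>+x. ennreal \<bar>c * \<phi> n x - avg t (\<phi> n) x\<bar> \<partial>\<nu>) \<le> ennreal (E t)" if t: "t > 0" for t n
    unfolding E_def
    by (rule energy_estimate[OF \<nu> s\<nu> pot[OF t] t k0 C1 test_fun_support(1)[OF \<phi>] test_fun_support(3)[OF \<phi>] \<phi>N N])
  have avg_lim: "(\<lambda>n. avg t (\<phi> n) x) \<longlonglongrightarrow> smoothed_potential \<mu> w t x" if t: "0 < t" "t \<le> T" and x: "x \<in> inner_region t" for t x
  proof -
    have wp: "(LINT y:\<Omega>|lebesgue. Du y \<bullet> grad_g t x y) = (LINT y:\<Omega>|\<mu>. w y * g t x y)"
      "(\<lambda>y. indicator \<Omega> y *\<^sub>R grad_g t x y) \<in> borel_measurable lebesgue"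
      "(\<integral>\<^sup>+y. ennreal ((norm (indicator \<Omega> y *\<^sub>R grad_g t x y))\<^sup>2) \<partial>lebesgue) < \<infinity>"
      by (rule weak_pairing[OF t x Du DuL2 s\<mu> w], rule weak; assumption)+
    have mg: "(\<lambda>y. indicator \<Omega> y *\<^sub>R grad (\<phi> n) y) \<in> borel_measurable lebesgue" for n
    proof (rule measurable_completion)
      have "grad (\<phi> n) \<in> borel_measurable borel"
        using C1[of n] by (intro borel_measurable_continuous_onI) (simp add: C1_grad_def)
      then show "(\<lambda>y. indicator \<Omega> y *\<^sub>R grad (\<phi> n) y) \<in> borel_measurable lborel" by measurable
    qed
    have pair_lim: "(\<lambda>n. integral\<^sup>L lebesgue (\<lambda>y. (indicator \<Omega> y *\<^sub>R grad (\<phi> n) y) \<bullet> (indicator \<Omega> y *\<^sub>R grad_g t x y)))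
        \<longlonglongrightarrow> integral\<^sup>L lebesgue (\<lambda>y. (indicator \<Omega> y *\<^sub>R Du y) \<bullet> (indicator \<Omega> y *\<^sub>R grad_g t x y))"
      by (rule L2_pairing_tendsto[OF mg Du wp(2) DuL2 wp(3) \<phi>Du])
    have ind: "(indicator \<Omega> y *\<^sub>R a) \<bullet> (indicator \<Omega> y *\<^sub>R b) = indicator \<Omega> y *\<^sub>R (a \<bullet> b)" for y and a b :: 'a
      by (simp add: indicator_def)
    have lim: "(\<lambda>n. LINT y:\<Omega>|lebesgue. grad (\<phi> n) y \<bullet> grad_g t x y) \<longlonglongrightarrow> (LINT y:\<Omega>|lebesgue. Du y \<bullet> grad_g t x y)"
      using pair_lim unfolding set_lebesgue_integral_def ind .
    have avg: "avg t (\<phi> n) x = (LINT y:\<Omega>|lebesgue. grad (\<phi> n) y \<bullet> grad_g t x y)" for n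
      by (rule avg_eq_pairing[OF t x C1 test_fun_support[OF \<phi>]])
    show ?thesis unfolding smoothed_potential_def wp(1)[symmetric] avg by (rule lim)
  qed
  obtain r :: "nat \<Rightarrow> nat" where r: "strict_mono r" "AE x in \<nu>. (\<lambda>n. indicator \<Omega> x * \<phi> (r n) x) \<longlonglongrightarrow> indicator \<Omega> x * f x"
  proof (rule L2_tendsto_AE_subseq[OF _ _ \<phi>f])
    show "(\<lambda>x. indicator \<Omega> x * \<phi> n x) \<in> borel_measurable \<nu>" for n by measurable
    show "(\<lambda>x. indicator \<Omega> x * f x) \<in> borel_measurable \<nu>" by measurable
  qed (rule that)
  \<comment> \<open>Fatou's lemma along \<open>r\<close>: convergence of the test functions to
    \<open>f\<close> holds almost everywhere only on this subsequence.\<close>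
  have step1: "(\<integral>\<^sup>+x. indicator (inner_region t) x * ennreal \<bar>c * f x - smoothed_potential \<mu> w t x\<bar> \<partial>\<nu>) \<le> ennreal (E t)" if t: "0 < t" "t \<le> T" for t
  proof -
    have "(\<integral>\<^sup>+x. indicator (inner_region t) x * ennreal \<bar>c * f x - smoothed_potential \<mu> w t x\<bar> \<partial>\<nu>)
        \<le> (\<integral>\<^sup>+x. liminf (\<lambda>n. indicator (inner_region t) x * ennreal \<bar>c * \<phi> (r n) x - avg t (\<phi> (r n)) x\<bar>) \<partial>\<nu>)"
    proof (rule nn_integral_mono_AE)
      show "AE x in \<nu>. indicator (inner_region t) x * ennreal \<bar>c * f x - smoothed_potential \<mu> w t x\<bar>
          \<le> liminf (\<lambda>n. indicator (inner_region t) x * ennreal \<bar>c * \<phi> (r n) x - avg t (\<phi> (r n)) x\<bar>)"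
        using r(2)
      proof eventually_elim
        case (elim x)
        show ?case
        proof (cases "x \<in> inner_region t")
          case True
          then have "x \<in> \<Omega>" using inner_region_subset[of t] t by auto
          then have 1: "(\<lambda>n. \<phi> (r n) x) \<longlonglongrightarrow> f x" using elim by simp
          have 2: "(\<lambda>n. avg t (\<phi> (r n)) x) \<longlonglongrightarrow> smoothed_potential \<mu> w t x"
            using LIMSEQ_subseq_LIMSEQ[OF avg_lim[OF t True] r(1)] by (simp add: o_def)
          have "(\<lambda>n. ennreal \<bar>c * \<phi> (r n) x - avg t (\<phi> (r n)) x\<bar>) \<longlonglongrightarrow> ennreal \<bar>c * f x - smoothed_potential \<mu> w t x\<bar>"
            by (intro tendsto_ennrealI tendsto_intros 1 2)
          then have "ennreal \<bar>c * f x - smoothed_potential \<mu> w t x\<bar> = liminf (\<lambda>n. ennreal \<bar>c * \<phi> (r n) x - avg t (\<phi> (r n)) x\<bar>)"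
            by (rule lim_imp_Liminf[OF sequentially_bot, symmetric])
          then show ?thesis using True by simp
        qed simp
      qed
    qed
    also have "\<dots> \<le> liminf (\<lambda>n. \<integral>\<^sup>+x. indicator (inner_region t) x * ennreal \<bar>c * \<phi> (r n) x - avg t (\<phi> (r n)) x\<bar> \<partial>\<nu>)"
      by (rule nn_integral_liminf) measurable
    also have "\<dots> \<le> liminf (\<lambda>n::nat. ennreal (E t))"
    proof (intro Liminf_mono always_eventually allI)
      fix n
      have "(\<integral>\<^sup>+x. indicator (inner_region t) x * ennreal \<bar>c * \<phi> (r n) x - avg t (\<phi> (r n)) x\<bar> \<partial>\<nu>)
          \<le> (\<integral>\<^sup>+x. ennreal \<bar>c * \<phi> (r n) x - avg t (\<phi> (r n)) x\<bar> \<partial>\<nu>)"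
        by (intro nn_integral_mono) (auto simp: indicator_def)
      also note est[OF t(1)]
      finally show "(\<integral>\<^sup>+x. indicator (inner_region t) x * ennreal \<bar>c * \<phi> (r n) x - avg t (\<phi> (r n)) x\<bar> \<partial>\<nu>) \<le> ennreal (E t)" .
    qed
    also have "\<dots> = ennreal (E t)" by (simp add: Liminf_const)
    finally show ?thesis .
  qed
  have [measurable]: "(\<lambda>x. indicator \<Omega> x * smoothed_potential \<mu> w t x) \<in> borel_measurable borel" if "t > 0" for t
    by (rule smoothed_potential_measurable[OF \<mu> s\<mu> w that])
  have [measurable]: "(\<lambda>x. indicator \<Omega> x * green_potential \<mu> w x) \<in> borel_measurable borel"
    by (rule green_potential_measurable[OF \<mu> s\<mu> w])
  note inv = LIMSEQ_one_over_Suc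
  have E0: "(\<lambda>n. ennreal (E (1 / Suc n))) \<longlonglongrightarrow> 0"
  proof -
    have "(\<lambda>n. k (1 / Suc n)) \<longlonglongrightarrow> 0"
      unfolding k_def by (rule potential_bound_tendsto_0[OF \<alpha>])
    then have "(\<lambda>n. sqrt (N * (2 * k (1 / Suc n) * c * measure \<nu> (space \<nu>)))) \<longlonglongrightarrow> sqrt (N * (2 * 0 * c * measure \<nu> (space \<nu>)))"
      by (intro tendsto_intros)
    then have "(\<lambda>n. E (1 / Suc n)) \<longlonglongrightarrow> 0" by (simp add: E_def)
    then show ?thesis unfolding ennreal_0[symmetric] by (rule tendsto_ennrealI)
  qed
  have finAE: "AE x in \<nu>. (\<integral>\<^sup>+y. ennreal \<bar>indicator \<Omega> y * w y\<bar> * near_kernel T (y - x) \<partial>\<mu>) < \<infinity>"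
    by (rule AE_near_kernel_finite[OF \<nu> s\<nu> pot[OF T_pos] \<mu> s\<mu> w])
  \<comment> \<open>The region is frozen at index \<open>i\<close> while the smoothing parameter
    decreases; it is contained in \<open>inner_region (1 / Suc n)\<close> for all n from i on, so
    the bounds of \<open>step1\<close> apply.\<close>
  have step2: "AE x in \<nu>. x \<in> inner_region (1 / Suc i) \<longrightarrow> c * f x = green_potential \<mu> w x" for i
  proof -
    let ?O = "inner_region (1 / Suc i)"
    have O\<Omega>: "?O \<subseteq> \<Omega>" by (rule inner_region_subset) simp
    have "(\<integral>\<^sup>+x. indicator ?O x * ennreal \<bar>c * f x - indicator \<Omega> x * green_potential \<mu> w x\<bar> \<partial>\<nu>)
        \<le> (\<integral>\<^sup>+x. liminf (\<lambda>n. indicator ?O x * ennreal \<bar>c * f x - indicator \<Omega> x * smoothed_potential \<mu> w (1 / Suc n) x\<bar>) \<partial>\<nu>)"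
    proof (rule nn_integral_mono_AE)
      show "AE x in \<nu>. indicator ?O x * ennreal \<bar>c * f x - indicator \<Omega> x * green_potential \<mu> w x\<bar>
          \<le> liminf (\<lambda>n. indicator ?O x * ennreal \<bar>c * f x - indicator \<Omega> x * smoothed_potential \<mu> w (1 / Suc n) x\<bar>)"
        using finAE
      proof eventually_elim
        case (elim x)
        show ?case
        proof (cases "x \<in> ?O")
          case True
          then have x: "x \<in> \<Omega>" using O\<Omega> by auto
          have "(\<lambda>n. ennreal \<bar>c * f x - indicator \<Omega> x * smoothed_potential \<mu> w (1 / Suc n) x\<bar>) \<longlonglongrightarrow> ennreal \<bar>c * f x - indicator \<Omega> x * green_potential \<mu> w x\<bar>"
            by (intro tendsto_ennrealI tendsto_intros smoothed_potential_tendsto_green_potential(1)[OF s\<mu> w x elim])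
          then have "ennreal \<bar>c * f x - indicator \<Omega> x * green_potential \<mu> w x\<bar> = liminf (\<lambda>n. ennreal \<bar>c * f x - indicator \<Omega> x * smoothed_potential \<mu> w (1 / Suc n) x\<bar>)"
            by (rule lim_imp_Liminf[OF sequentially_bot, symmetric])
          then show ?thesis using True by simp
        qed simp
      qed
    qed
    also have "\<dots> \<le> liminf (\<lambda>n. \<integral>\<^sup>+x. indicator ?O x * ennreal \<bar>c * f x - indicator \<Omega> x * smoothed_potential \<mu> w (1 / Suc n) x\<bar> \<partial>\<nu>)"
      by (rule nn_integral_liminf) measurable
    also have "\<dots> \<le> liminf (\<lambda>n. ennreal (E (1 / Suc n)))"
    proof (rule Liminf_mono)
      have "\<forall>\<^sub>F n in sequentially. 1 / real (Suc n) < T" by (rule order_tendstoD(2)[OF inv T_pos])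
      then show "\<forall>\<^sub>F n in sequentially. (\<integral>\<^sup>+x. indicator ?O x * ennreal \<bar>c * f x - indicator \<Omega> x * smoothed_potential \<mu> w (1 / Suc n) x\<bar> \<partial>\<nu>)
          \<le> ennreal (E (1 / Suc n))"
        using eventually_ge_at_top[of i]
      proof eventually_elim
        case (elim n)
        have sub: "?O \<subseteq> inner_region (1 / Suc n)" by (rule inner_region_antimono) (use elim in \<open>simp add: field_simps\<close>)
        have "(\<integral>\<^sup>+x. indicator ?O x * ennreal \<bar>c * f x - indicator \<Omega> x * smoothed_potential \<mu> w (1 / Suc n) x\<bar> \<partial>\<nu>)
            \<le> (\<integral>\<^sup>+x. indicator (inner_region (1 / Suc n)) x * ennreal \<bar>c * f x - smoothed_potential \<mu> w (1 / Suc n) x\<bar> \<partial>\<nu>)"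
          using sub O\<Omega> by (intro nn_integral_mono) (auto simp: indicator_def)
        also have "\<dots> \<le> ennreal (E (1 / Suc n))" by (rule step1) (use elim in auto)
        finally show ?case .
      qed
    qed
    also have "\<dots> = 0" using E0 by (rule lim_imp_Liminf[OF sequentially_bot])
    finally have "(\<integral>\<^sup>+x. indicator ?O x * ennreal \<bar>c * f x - indicator \<Omega> x * green_potential \<mu> w x\<bar> \<partial>\<nu>) = 0" by simp
    then have "AE x in \<nu>. indicator ?O x * ennreal \<bar>c * f x - indicator \<Omega> x * green_potential \<mu> w x\<bar> = 0"
      by (subst (asm) nn_integral_0_iff_AE) measurable
    then show ?thesis
    proof eventually_elim
      case (elim x)
      then show ?case using O\<Omega> by (auto simp: indicator_def)
    qed
  qed
  \<comment> \<open>Countably many inner regions exhaust \<Omega>, so the exceptional null sets may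
    be united.\<close>
  then have "AE x in \<nu>. \<forall>i. x \<in> inner_region (1 / Suc i) \<longrightarrow> c * f x = green_potential \<mu> w x"
    by (subst AE_all_countable) (rule allI)
  then show ?thesis
  proof eventually_elim
    case (elim x)
    show ?case
    proof
      assume "x \<in> \<Omega>"
      then obtain e where e: "e > 0" "\<And>t. t < e \<Longrightarrow> x \<in> inner_region t" using inner_region_exhausts by blast
      obtain i where "inverse (real (Suc i)) < e" using reals_Archimedean[OF e(1)] by blast
      then have "x \<in> inner_region (1 / Suc i)" using e(2)[of "1 / Suc i"] by (simp add: inverse_eq_divide)
      then show "c * f x = green_potential \<mu> w x" using elim by blast
    qed
  qed
qed

end

section \<open>Boundedness and continuity\<close>

context green_function
begin

text \<open>The near part of the Green operator has norm at most one half on \<open>L\<^sup>1\<close>, and it maps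
  the excess of \<open>|w|\<close> over a suitable level to a function dominating that excess, which therefore vanishes.\<close>
lemma bounded_of_representation:
  assumes \<mu>: "finite_measure \<mu>" and s\<mu>[measurable_cong]: "sets \<mu> = sets borel"
    and pot: "\<And>t y. t > 0 \<Longrightarrow> (\<integral>\<^sup>+x. near_kernel t (x - y) \<partial>\<mu>) \<le> ennreal (k t)"
    and k0: "\<And>t. k t \<ge> 0" and klim: "(\<lambda>n. k (1 / Suc n)) \<longlonglongrightarrow> 0"
    and w: "set_integrable \<mu> \<Omega> w"
    and rep: "AE x in \<mu>. x \<in> \<Omega> \<longrightarrow> c * w x = green_potential \<mu> (\<lambda>x. lam * w x) x"
  shows "\<exists>M\<ge>0. AE x in \<mu>. x \<in> \<Omega> \<longrightarrow> \<bar>w x\<bar> \<le> M"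
proof -
  interpret finite_measure \<mu> by fact
  interpret P: pair_sigma_finite \<mu> \<mu> ..
  define W where "W x = ennreal \<bar>indicator \<Omega> x * w x\<bar>" for x
  have mw: "(\<lambda>y. indicator \<Omega> y * w y) \<in> borel_measurable \<mu>" by (rule w_measurable[OF w])
  then have [measurable]: "W \<in> borel_measurable \<mu>" unfolding W_def by measurable
  have Wfin: "(\<integral>\<^sup>+x. W x \<partial>\<mu>) < \<infinity>"
    using w unfolding set_integrable_def integrable_iff_bounded by (simp add: W_def)
  define L1 where "L1 = enn2real (\<integral>\<^sup>+x. W x \<partial>\<mu>)"
  have L1: "(\<integral>\<^sup>+x. W x \<partial>\<mu>) = ennreal L1" "L1 \<ge> 0" using Wfin by (auto simp: L1_def)
  define a where "a = \<bar>lam\<bar> / c"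
  have a: "a \<ge> 0" using c_pos by (simp add: a_def)
  obtain t where t: "0 < t" "t \<le> T" "a * k t \<le> 1 / 2"
  proof -
    have "(\<lambda>n. a * k (1 / Suc n)) \<longlonglongrightarrow> a * 0" by (intro tendsto_intros klim)
    then have "\<forall>\<^sub>F n in sequentially. a * k (1 / Suc n) < 1 / 2" by (intro order_tendstoD(2)) auto
    moreover have "\<forall>\<^sub>F n in sequentially. inverse (real (Suc n)) < T"
      by (rule order_tendstoD(2)[OF LIMSEQ_inverse_real_of_nat T_pos])
    ultimately have "\<forall>\<^sub>F n in sequentially. a * k (1 / Suc n) < 1 / 2 \<and> inverse (real (Suc n)) < T"
      by eventually_elim simp
    then obtain n where "a * k (1 / Suc n) < 1 / 2" "inverse (real (Suc n)) < T"
      by (auto simp: eventually_sequentially)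
    then show ?thesis by (intro that[of "1 / Suc n"]) (auto simp: inverse_eq_divide)
  qed
  \<comment> \<open>By \<open>near_kernel_split\<close> this bounds the far part of the kernel,
    whose contribution to |w| is therefore at most \<open>M0\<close>.\<close>
  define b where "b = q t * (T - t)"
  have b: "b \<ge> 0" using t q_nonneg by (simp add: b_def)
  define M0 where "M0 = a * (b * L1)"
  have M0: "M0 \<ge> 0" using a b L1 by (simp add: M0_def)
  have lw: "set_integrable \<mu> \<Omega> (\<lambda>x. lam * w x)" using w by simp
  have finAE: "AE x in \<mu>. (\<integral>\<^sup>+y. ennreal \<bar>indicator \<Omega> y * (lam * w y)\<bar> * near_kernel T (y - x) \<partial>\<mu>) < \<infinity>"
    by (rule AE_near_kernel_finite[OF \<mu> s\<mu> pot[OF T_pos] \<mu> s\<mu> lw])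
  have W_le: "AE x in \<mu>. W x \<le> ennreal a * (\<integral>\<^sup>+y. W y * near_kernel t (y - x) \<partial>\<mu>) + ennreal M0"
    using rep finAE
  proof eventually_elim
    case (elim x)
    show ?case
    proof (cases "x \<in> \<Omega>")
      case True
      have "ennreal c * W x = ennreal \<bar>green_potential \<mu> (\<lambda>x. lam * w x) x\<bar>"
      proof -
        have "c * w x = green_potential \<mu> (\<lambda>x. lam * w x) x" using elim(1) True by blast
        then have "\<bar>green_potential \<mu> (\<lambda>x. lam * w x) x\<bar> = \<bar>c * w x\<bar>" by (rule arg_cong[OF sym])
        then have "\<bar>green_potential \<mu> (\<lambda>x. lam * w x) x\<bar> = c * \<bar>w x\<bar>" using c_pos by (simp only: abs_mult abs_of_pos)
        then show ?thesis using True c_pos by (simp add: W_def ennreal_mult)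
      qed
      also have "\<dots> \<le> (\<integral>\<^sup>+y. ennreal \<bar>indicator \<Omega> y * (lam * w y)\<bar> * near_kernel T (y - x) \<partial>\<mu>)"
        by (rule smoothed_potential_tendsto_green_potential(2)[OF s\<mu> lw True elim(2)])
      also have "\<dots> = (\<integral>\<^sup>+y. ennreal \<bar>lam\<bar> * (W y * near_kernel T (y - x)) \<partial>\<mu>)"
        by (intro nn_integral_cong) (simp add: W_def abs_mult ennreal_mult mult_ac)
      also have "\<dots> = ennreal \<bar>lam\<bar> * (\<integral>\<^sup>+y. W y * near_kernel T (y - x) \<partial>\<mu>)"
        by (rule nn_integral_cmult) measurable
      finally have 1: "ennreal c * W x \<le> ennreal \<bar>lam\<bar> * (\<integral>\<^sup>+y. W y * near_kernel T (y - x) \<partial>\<mu>)" .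
      have "W x = ennreal (1 / c) * (ennreal c * W x)"
        using c_pos by (simp add: mult.assoc[symmetric] ennreal_mult[symmetric])
      also have "\<dots> \<le> ennreal (1 / c) * (ennreal \<bar>lam\<bar> * (\<integral>\<^sup>+y. W y * near_kernel T (y - x) \<partial>\<mu>))"
        by (intro mult_left_mono 1) simp
      also have "\<dots> = ennreal a * (\<integral>\<^sup>+y. W y * near_kernel T (y - x) \<partial>\<mu>)"
        using c_pos by (simp add: a_def mult.assoc[symmetric] ennreal_mult[symmetric])
      also have "\<dots> \<le> ennreal a * (\<integral>\<^sup>+y. W y * near_kernel t (y - x) + ennreal b * W y \<partial>\<mu>)"
      proof (intro mult_left_mono nn_integral_mono)
        fix y
        have "W y * near_kernel T (y - x) \<le> W y * (near_kernel t (y - x) + ennreal b)"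
          unfolding b_def by (intro mult_left_mono near_kernel_split t) simp
        then show "W y * near_kernel T (y - x) \<le> W y * near_kernel t (y - x) + ennreal b * W y"
          by (simp add: distrib_left mult.commute)
      qed simp
      also have "(\<integral>\<^sup>+y. W y * near_kernel t (y - x) + ennreal b * W y \<partial>\<mu>) = (\<integral>\<^sup>+y. W y * near_kernel t (y - x) \<partial>\<mu>) + ennreal b * (\<integral>\<^sup>+y. W y \<partial>\<mu>)"
        by (subst nn_integral_add) (auto simp: nn_integral_cmult)
      also have "ennreal a * ((\<integral>\<^sup>+y. W y * near_kernel t (y - x) \<partial>\<mu>) + ennreal b * (\<integral>\<^sup>+y. W y \<partial>\<mu>))
          = ennreal a * (\<integral>\<^sup>+y. W y * near_kernel t (y - x) \<partial>\<mu>) + ennreal M0"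
        using a b L1 by (simp add: distrib_left M0_def ennreal_mult)
      finally show ?thesis .
    qed (simp add: W_def)
  qed
  \<comment> \<open>Subtraction in \<open>ennreal\<close> is truncated, so this is the positive
    excess over the level. The level \<open>2 * M0\<close> reproduces itself: its near potential
    contributes at most \<open>M0\<close>, and the far part adds another \<open>M0\<close>.\<close>
  define e where "e x = W x - ennreal (2 * M0)" for x
  have [measurable]: "e \<in> borel_measurable \<mu>" unfolding e_def by measurable
  have We: "W x \<le> e x + ennreal (2 * M0)" for x
  proof (cases "ennreal (2 * M0) \<le> W x")
    case True
    then show ?thesis by (simp add: e_def diff_add_cancel_ennreal)
  next
    case False
    then have "W x \<le> ennreal (2 * M0)" by simp
    also have "\<dots> \<le> e x + ennreal (2 * M0)" by simp
    finally show ?thesis .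
  qed
  have e_le: "AE x in \<mu>. e x \<le> ennreal a * (\<integral>\<^sup>+y. e y * near_kernel t (y - x) \<partial>\<mu>)"
    using W_le
  proof eventually_elim
    case (elim x)
    have "ennreal a * (\<integral>\<^sup>+y. W y * near_kernel t (y - x) \<partial>\<mu>) \<le> ennreal a * (\<integral>\<^sup>+y. (e y + ennreal (2 * M0)) * near_kernel t (y - x) \<partial>\<mu>)"
      by (intro mult_left_mono nn_integral_mono mult_right_mono We) auto
    also have "(\<integral>\<^sup>+y. (e y + ennreal (2 * M0)) * near_kernel t (y - x) \<partial>\<mu>)
        = (\<integral>\<^sup>+y. e y * near_kernel t (y - x) \<partial>\<mu>) + ennreal (2 * M0) * (\<integral>\<^sup>+y. near_kernel t (y - x) \<partial>\<mu>)"
      unfolding distrib_right by (subst nn_integral_add) (auto simp: nn_integral_cmult)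
    also have "ennreal a * \<dots> \<le> ennreal a * (\<integral>\<^sup>+y. e y * near_kernel t (y - x) \<partial>\<mu>) + ennreal M0"
    proof -
      have "ennreal a * (ennreal (2 * M0) * (\<integral>\<^sup>+y. near_kernel t (y - x) \<partial>\<mu>)) \<le> ennreal a * (ennreal (2 * M0) * ennreal (k t))"
        by (intro mult_left_mono pot t) auto
      also have "\<dots> = ennreal (a * k t * (2 * M0))"
        using a M0 k0[of t] by (simp add: ennreal_mult[symmetric] mult_ac)
      also have "\<dots> \<le> ennreal (1 / 2 * (2 * M0))"
        using M0 by (intro ennreal_leI mult_right_mono t) auto
      finally show ?thesis by (simp add: distrib_left add_left_mono)
    qed
    finally have "W x \<le> ennreal a * (\<integral>\<^sup>+y. e y * near_kernel t (y - x) \<partial>\<mu>) + ennreal M0 + ennreal M0"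
      using elim by (meson add_right_mono order_trans)
    also have "\<dots> = ennreal (2 * M0) + ennreal a * (\<integral>\<^sup>+y. e y * near_kernel t (y - x) \<partial>\<mu>)"
      using M0 by (simp add: add.assoc ennreal_plus[symmetric] add.commute del: ennreal_plus)
    finally show ?case unfolding e_def[of x] by (simp add: ennreal_minus_le_iff)
  qed
  have efin: "(\<integral>\<^sup>+x. e x \<partial>\<mu>) < \<infinity>"
  proof -
    have "(\<integral>\<^sup>+x. e x \<partial>\<mu>) \<le> (\<integral>\<^sup>+x. W x \<partial>\<mu>)"
      by (intro nn_integral_mono) (simp add: e_def diff_le_self_ennreal)
    then show ?thesis using Wfin by simp
  qed
  have "(\<integral>\<^sup>+x. e x \<partial>\<mu>) \<le> (\<integral>\<^sup>+x. ennreal a * (\<integral>\<^sup>+y. e y * near_kernel t (y - x) \<partial>\<mu>) \<partial>\<mu>)"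
    by (rule nn_integral_mono_AE[OF e_le])
  also have "\<dots> = ennreal a * (\<integral>\<^sup>+x. \<integral>\<^sup>+y. e y * near_kernel t (y - x) \<partial>\<mu> \<partial>\<mu>)"
    by (rule nn_integral_cmult) measurable
  also have "(\<integral>\<^sup>+x. \<integral>\<^sup>+y. e y * near_kernel t (y - x) \<partial>\<mu> \<partial>\<mu>) = (\<integral>\<^sup>+y. \<integral>\<^sup>+x. e y * near_kernel t (y - x) \<partial>\<mu> \<partial>\<mu>)"
    by (rule P.Fubini') measurable
  also have "\<dots> \<le> (\<integral>\<^sup>+y. e y * ennreal (k t) \<partial>\<mu>)"
  proof (rule nn_integral_mono)
    fix y
    have "(\<integral>\<^sup>+x. e y * near_kernel t (y - x) \<partial>\<mu>) = e y * (\<integral>\<^sup>+x. near_kernel t (x - y) \<partial>\<mu>)"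
      by (subst near_kernel_minus, rule nn_integral_cmult) measurable
    also have "\<dots> \<le> e y * ennreal (k t)" by (intro mult_left_mono pot t) simp
    finally show "(\<integral>\<^sup>+x. e y * near_kernel t (y - x) \<partial>\<mu>) \<le> e y * ennreal (k t)" .
  qed
  also have "\<dots> = (\<integral>\<^sup>+y. e y \<partial>\<mu>) * ennreal (k t)" by (rule nn_integral_multc) measurable
  finally have "(\<integral>\<^sup>+x. e x \<partial>\<mu>) \<le> ennreal a * ((\<integral>\<^sup>+y. e y \<partial>\<mu>) * ennreal (k t))"
    by (simp add: mult_left_mono)
  also have "\<dots> = ennreal (a * k t) * (\<integral>\<^sup>+y. e y \<partial>\<mu>)"
    using a k0[of t] by (simp add: ennreal_mult mult_ac)
  also have "\<dots> \<le> ennreal (1 / 2) * (\<integral>\<^sup>+y. e y \<partial>\<mu>)"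
    by (intro mult_right_mono ennreal_leI t) auto
  finally have half: "(\<integral>\<^sup>+x. e x \<partial>\<mu>) \<le> ennreal (1 / 2) * (\<integral>\<^sup>+y. e y \<partial>\<mu>)" .
  \<comment> \<open>Finiteness from \<open>efin\<close> is essential, because infinity also
    satisfies the inequality \<open>half\<close>.\<close>
  have "(\<integral>\<^sup>+x. e x \<partial>\<mu>) = 0"
  proof -
    obtain s where s: "(\<integral>\<^sup>+x. e x \<partial>\<mu>) = ennreal s" "s \<ge> 0"
      using efin by (cases "\<integral>\<^sup>+x. e x \<partial>\<mu>") auto
    then have "ennreal s \<le> ennreal (1 / 2) * ennreal s" using half by (simp only:)
    also have "\<dots> = ennreal (1 / 2 * s)" using s(2) by (intro ennreal_mult[symmetric]) auto
    finally have "s \<le> 1 / 2 * s" using s(2) by (subst (asm) ennreal_le_iff) auto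
    then show ?thesis using s by simp
  qed
  then have "AE x in \<mu>. e x = 0" by (subst (asm) nn_integral_0_iff_AE) measurable
  then have "AE x in \<mu>. x \<in> \<Omega> \<longrightarrow> \<bar>w x\<bar> \<le> 2 * M0"
  proof eventually_elim
    case (elim x)
    then have "W x \<le> ennreal (2 * M0)" using We[of x] by simp
    then show ?case using M0 by (auto simp: W_def ennreal_le_iff)
  qed
  then show ?thesis using M0 by (intro exI[of _ "2 * M0"]) auto
qed

text \<open>Away from the origin the function is the differentiable profile. If the kernel is finite
  at the origin, its value there dominates all others, so the continuous functions
  \<open>Phi t\<close> converge uniformly along a sequence of parameters.\<close>

lemma isCont_Phi_lim:
  assumes fin: "near_kernel T z < \<infinity>"
  shows "isCont Phi_lim z"
proof (cases "z = 0")
  case False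
  have op: "open (- {0::'a})" by auto
  have "isCont (\<lambda>z. p (z \<bullet> z)) z"
  proof (rule isCont_o2[where f="\<lambda>z. z \<bullet> z"])
    show "isCont p (z \<bullet> z)" using p_deriv[of "z \<bullet> z"] False by (auto intro: DERIV_isCont)
  qed (intro continuous_intros)
  moreover have ev: "\<forall>\<^sub>F y in nhds z. Phi_lim y = p (y \<bullet> y)"
    using eventually_nhds_in_open[OF op, of z] False by (auto elim!: eventually_mono intro: Phi_lim_eq_p)
  ultimately show ?thesis by (simp only: isCont_cong[OF ev])
next
  case True
  have le0: "near_kernel t y \<le> near_kernel t 0" for t and y :: 'a
    unfolding near_kernel_def using inner_ge_zero[of y]
    by (intro nn_integral_mono) (auto simp: indicator_def simp del: inner_ge_zero)
  show ?thesis unfolding continuous_at_eps_delta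
  proof (intro allI impI)
    fix e :: real assume e: "e > 0"
    have "(\<lambda>n. near_kernel (min T (1 / Suc n)) (0::'a)) \<longlonglongrightarrow> 0"
      using near_kernel_tendsto_0[of T 0] fin True T_pos by simp
    then have "\<forall>\<^sub>F n in sequentially. near_kernel (min T (1 / Suc n)) (0::'a) < ennreal (e / 3)"
      using e by (intro order_tendstoD(2)) auto
    then obtain n where n: "near_kernel (min T (1 / Suc n)) (0::'a) < ennreal (e / 3)"
      by (auto simp: eventually_sequentially)
    define t where "t = min T (1 / Suc n)"
    have t: "t > 0" using T_pos by (simp add: t_def)
    have close: "\<bar>Phi_lim y - Phi t y\<bar> < e / 3" for y
    proof -
      have lt: "near_kernel t y < ennreal (e / 3)" using le0[of t y] n by (simp add: t_def order.strict_trans1)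
      then have "ennreal \<bar>Phi_lim y - Phi t y\<bar> < ennreal (e / 3)"
      proof -
        have "near_kernel t y < \<infinity>" using lt ennreal_less_top order.strict_trans unfolding infinity_ennreal_def by blast
        from Phi_lim_diff_le_near_kernel[OF t this] lt show ?thesis by (rule order.strict_trans1)
      qed
      then show ?thesis using e by (simp add: ennreal_less_iff)
    qed
    have "isCont (Phi t) z" using continuous_Phi[OF t, of UNIV] by (simp add: continuous_on_eq_continuous_at)
    then obtain r where r: "r > 0" "\<And>y. dist y z < r \<Longrightarrow> dist (Phi t y) (Phi t z) < e / 3"
      unfolding continuous_at_eps_delta using e by (metis zero_less_divide_iff zero_less_numeral)
    have "dist (Phi_lim y) (Phi_lim z) < e" if "dist y z < r" for y
      using r(2)[OF that] close[of y] close[of z] unfolding dist_real_def by linarith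
    then show "\<exists>d>0. \<forall>x'. dist x' z < d \<longrightarrow> dist (Phi_lim x') (Phi_lim z) < e" using r(1) by blast
  qed
qed

text \<open>The value 0 for \<open>x\<close> outside \<Omega> is the boundary value of the Green
  function, so that limits at interior and at frontier points become one statement.\<close>

definition green_ext :: "'a \<Rightarrow> 'a \<Rightarrow> real" where
  "green_ext x y = (if x \<in> \<Omega> then Phi_lim (y - x) + regular_part (x, y) else 0)"

lemma green_ext_measurable [measurable]: "green_ext x \<in> borel_measurable borel"
  unfolding green_ext_def by (cases "x \<in> \<Omega>") auto

lemma green_ext_bounds:
  assumes "y \<in> \<Omega>" "near_kernel T (y - x) < \<infinity>"
  shows "0 \<le> green_ext x y" "ennreal (green_ext x y) \<le> near_kernel T (y - x)"
  using Ghat_bounds[of x y] assms by (auto simp: green_ext_def regular_part_eq)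

text \<open>At boundary points this rests on the boundary values of the Green function in its second
  argument, transferred to the first one by the symmetry of \<^term>\<open>h\<close>.\<close>
lemma green_ext_tendsto:
  assumes X: "\<And>n. X n \<in> closure \<Omega>" "X \<longlonglongrightarrow> x" and y: "y \<in> \<Omega>" "near_kernel T (y - x) < \<infinity>"
  shows "(\<lambda>n. green_ext (X n) y) \<longlonglongrightarrow> green_ext x y"
proof (cases "x \<in> \<Omega>")
  case True
  have ev: "\<forall>\<^sub>F n in sequentially. X n \<in> \<Omega>"
    using X(2) open_\<Omega> True by (rule topological_tendstoD)
  have "(\<lambda>n. Phi_lim (y - X n)) \<longlonglongrightarrow> Phi_lim (y - x)"
    by (rule isCont_tendsto_compose[OF isCont_Phi_lim[OF y(2)]]) (intro tendsto_intros X)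
  moreover have "(\<lambda>n. h (X n) y) \<longlonglongrightarrow> h x y"
  proof -
    have "((\<lambda>n. (\<lambda>(x, y). h x y) (X n, y)) \<longlonglongrightarrow> (\<lambda>(x, y). h x y) (x, y))"
      by (rule continuous_on_tendsto_compose[OF h_cont])
         (use True y ev in \<open>auto intro!: tendsto_intros X elim: eventually_mono\<close>)
    then show ?thesis by simp
  qed
  ultimately have "(\<lambda>n. Phi_lim (y - X n) + h (X n) y) \<longlonglongrightarrow> Phi_lim (y - x) + h x y" by (rule tendsto_add)
  moreover have "\<forall>\<^sub>F n in sequentially. Phi_lim (y - X n) + h (X n) y = green_ext (X n) y"
    using ev by eventually_elim (simp add: green_ext_def regular_part_eq y)
  ultimately show ?thesis using True y by (auto simp: green_ext_def regular_part_eq intro: Lim_transform_eventually)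
next
  case False
  have xf: "x \<in> frontier \<Omega>"
    using False X closure_sequential[of x "closure \<Omega>"] open_\<Omega> by (auto simp: frontier_def interior_open)
  have "(\<lambda>n. green_ext (X n) y) \<longlonglongrightarrow> 0"
  proof (rule tendstoI)
    fix e :: real assume e: "e > 0"
    obtain r where r: "r > 0" "\<And>z. z \<in> \<Omega> \<Longrightarrow> z \<noteq> x \<Longrightarrow> dist z x < r \<Longrightarrow> dist (p ((z - y) \<bullet> (z - y)) + h y z) 0 < e"
      using tendstoD[OF bdry[OF y(1) xf] e] unfolding eventually_at by blast
    \<comment> \<open>The second bound keeps \<open>X n\<close> away from the pole \<open>y\<close>,
      where \<open>Phi_lim\<close> need not be given by the profile.\<close>
    have "\<forall>\<^sub>F n in sequentially. dist (X n) x < min r (dist y x)"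
      using r(1) y(1) False by (intro tendstoD[OF X(2)]) auto
    then show "\<forall>\<^sub>F n in sequentially. dist (green_ext (X n) y) 0 < e"
    proof eventually_elim
      case (elim n)
      show ?case
      proof (cases "X n \<in> \<Omega>")
        case True
        have ne: "y - X n \<noteq> 0" using elim by (auto simp: dist_commute)
        have "(y - X n) \<bullet> (y - X n) = (X n - y) \<bullet> (X n - y)" by (simp add: inner_diff inner_commute)
        then have "green_ext (X n) y = p ((X n - y) \<bullet> (X n - y)) + h y (X n)"
          using True y(1) Phi_lim_eq_p[OF ne] h_sym[OF True y(1)] by (simp add: green_ext_def regular_part_eq)
        then show ?thesis using r(2)[of "X n"] True False elim by auto
      qed (simp add: green_ext_def e)
    qed
  qed
  then show ?thesis using False by (simp add: green_ext_def)
qed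

text \<open>Uniform integrability of the kernels: truncated at height \<open>b\<close> they converge
  boundedly, and the excess over \<open>b\<close> is at most \<open>near_kernel t\<close>, whose
  potential is at most \<open>k t\<close> uniformly in the point. Boundedness of the density turns
  this into a uniform error.\<close>

lemma green_potential_continuous:
  assumes \<mu>: "finite_measure \<mu>" and s\<mu>[measurable_cong]: "sets \<mu> = sets borel"
    and pot: "\<And>t y. t > 0 \<Longrightarrow> (\<integral>\<^sup>+x. near_kernel t (x - y) \<partial>\<mu>) \<le> ennreal (k t)"
    and k0: "\<And>t. k t \<ge> 0" and klim: "(\<lambda>n. k (1 / Suc n)) \<longlonglongrightarrow> 0"
    and w: "set_integrable \<mu> \<Omega> w" and M: "M \<ge> 0" "AE x in \<mu>. x \<in> \<Omega> \<longrightarrow> \<bar>w x\<bar> \<le> M"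
  shows "continuous_on (closure \<Omega>) (\<lambda>x. if x \<in> \<Omega> then green_potential \<mu> w x else 0)"
proof -
  interpret finite_measure \<mu> by fact
  define wi where "wi y = indicator \<Omega> y * w y" for y
  have [measurable]: "wi \<in> borel_measurable \<mu>" unfolding wi_def by (rule w_measurable[OF w])
  define V where "V x = integral\<^sup>L \<mu> (\<lambda>y. wi y * green_ext x y)" for x
  have V_eq: "(if x \<in> \<Omega> then green_potential \<mu> w x else 0) = V x" for x
  proof (cases "x \<in> \<Omega>")
    case True
    have "(\<lambda>y. indicator \<Omega> y *\<^sub>R (w y * (Phi_lim (y - x) + h x y))) = (\<lambda>y. wi y * green_ext x y)"
      using True by (auto simp: fun_eq_iff indicator_def regular_part_eq wi_def green_ext_def)
    then show ?thesis using True by (simp add: green_potential_def set_lebesgue_integral_def V_def)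
  qed (simp add: V_def green_ext_def)
  have wiM: "AE y in \<mu>. \<bar>wi y\<bar> \<le> M * indicator \<Omega> y"
    using M(2) by eventually_elim (auto simp: wi_def indicator_def)
  have finT: "AE y in \<mu>. near_kernel T (y - x) < \<infinity>" for x
  proof -
    have "(\<integral>\<^sup>+y. near_kernel T (y - x) \<partial>\<mu>) \<noteq> \<infinity>" using pot[OF T_pos, of x] by (auto simp: top_unique)
    then have "AE y in \<mu>. near_kernel T (y - x) \<noteq> \<infinity>" by (intro nn_integral_PInf_AE) measurable
    then show ?thesis by eventually_elim (simp add: less_top[symmetric])
  qed
  have int: "integrable \<mu> (\<lambda>y. wi y * green_ext x y)" for x
  proof (rule integrableI_bounded)
    have "(\<integral>\<^sup>+y. ennreal (norm (wi y * green_ext x y)) \<partial>\<mu>) \<le> (\<integral>\<^sup>+y. ennreal M * near_kernel T (y - x) \<partial>\<mu>)"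
    proof (rule nn_integral_mono_AE)
      show "AE y in \<mu>. ennreal (norm (wi y * green_ext x y)) \<le> ennreal M * near_kernel T (y - x)"
        using wiM finT[of x]
      proof eventually_elim
        case (elim y)
        show ?case
        proof (cases "y \<in> \<Omega>")
          case True
          have "ennreal (norm (wi y * green_ext x y)) = ennreal \<bar>wi y\<bar> * ennreal (green_ext x y)"
            using green_ext_bounds(1)[OF True elim(2)] by (simp add: abs_mult ennreal_mult)
          also have "\<dots> \<le> ennreal M * near_kernel T (y - x)"
            using elim True by (intro mult_mono green_ext_bounds(2) ennreal_leI) auto
          finally show ?thesis .
        qed (simp add: wi_def)
      qed
    qed
    also have "\<dots> = ennreal M * (\<integral>\<^sup>+y. near_kernel T (y - x) \<partial>\<mu>)" by (rule nn_integral_cmult) measurable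
    also have "\<dots> \<le> ennreal M * ennreal (k T)" by (intro mult_left_mono pot T_pos) simp
    also have "\<dots> < \<infinity>" by (simp add: ennreal_mult_less_top)
    finally show "(\<integral>\<^sup>+y. ennreal (norm (wi y * green_ext x y)) \<partial>\<mu>) < \<infinity>" .
  qed measurable
  have "continuous_on (closure \<Omega>) V"
    unfolding continuous_on_sequentially
  proof (intro allI ballI impI)
    fix X x assume x: "x \<in> closure \<Omega>" and "(\<forall>n. X n \<in> closure \<Omega>) \<and> X \<longlonglongrightarrow> x"
    then have X: "\<And>n. X n \<in> closure \<Omega>" "X \<longlonglongrightarrow> x" by auto
    \<comment> \<open>Along a sequence there are only countably many exceptional null sets; this is
      why continuity is tested sequentially.\<close>
    have finX: "AE y in \<mu>. near_kernel T (y - x) < \<infinity> \<and> (\<forall>n. near_kernel T (y - X n) < \<infinity>)"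
      using finT by (simp add: AE_all_countable)
    have key: "\<forall>\<^sub>F n in sequentially. dist (V (X n)) (V x) < e" if e: "e > 0" for e
    proof -
      \<comment> \<open>The excess terms at \<open>X n\<close> and at \<open>x\<close> cost at most
        \<open>M * k t\<close> each, and the truncated difference costs another quarter of the
        tolerance.\<close>
      obtain t where t: "0 < t" "t \<le> T" "M * k t < e / 4"
      proof -
        have "(\<lambda>n. M * k (1 / Suc n)) \<longlonglongrightarrow> M * 0" by (intro tendsto_intros klim)
        then have "\<forall>\<^sub>F n in sequentially. M * k (1 / Suc n) < e / 4" using e by (intro order_tendstoD(2)) auto
        moreover have "\<forall>\<^sub>F n in sequentially. inverse (real (Suc n)) < T"
          by (rule order_tendstoD(2)[OF LIMSEQ_inverse_real_of_nat T_pos])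
        ultimately have "\<forall>\<^sub>F n in sequentially. M * k (1 / Suc n) < e / 4 \<and> inverse (real (Suc n)) < T"
          by eventually_elim simp
        then obtain n where "M * k (1 / Suc n) < e / 4" "inverse (real (Suc n)) < T"
          by (auto simp: eventually_sequentially)
        then show ?thesis by (intro that[of "1 / Suc n"]) (auto simp: inverse_eq_divide)
      qed
      define b where "b = q t * (T - t)"
      have b: "b \<ge> 0" using t q_nonneg by (simp add: b_def)
      \<comment> \<open>The difference of the kernels truncated at \<open>b\<close>; since both are
        nonnegative it is at most \<open>b\<close>, which is integrable for a finite
        measure.\<close>
      define m where "m n y = indicator \<Omega> y * \<bar>min (green_ext (X n) y) b - min (green_ext x y) b\<bar>" for n y
      have [measurable]: "m n \<in> borel_measurable \<mu>" for n unfolding m_def by measurable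
      have mlim: "(\<lambda>n. \<integral>\<^sup>+y. ennreal (m n y) \<partial>\<mu>) \<longlonglongrightarrow> (\<integral>\<^sup>+y. 0 \<partial>\<mu>)"
      proof (rule nn_integral_dominated_convergence[where w="\<lambda>_. ennreal b"])
        show "AE y in \<mu>. ennreal (m n y) \<le> ennreal b" for n
          using finX
        proof eventually_elim
          case (elim y)
          show ?case
          proof (cases "y \<in> \<Omega>")
            case True
            then show ?thesis using green_ext_bounds(1)[OF True, of x] green_ext_bounds(1)[OF True, of "X n"] elim b
              by (intro ennreal_leI) (auto simp: m_def min_def)
          qed (simp add: m_def)
        qed
        show "(\<integral>\<^sup>+y. ennreal b \<partial>\<mu>) < \<infinity>"
          by (simp add: ennreal_mult_eq_top_iff less_top[symmetric])
        show "AE y in \<mu>. (\<lambda>n. ennreal (m n y)) \<longlonglongrightarrow> 0"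
          using finX
        proof eventually_elim
          case (elim y)
          show ?case
          proof (cases "y \<in> \<Omega>")
            case True
            have "(\<lambda>n. \<bar>min (green_ext (X n) y) b - min (green_ext x y) b\<bar>) \<longlonglongrightarrow> \<bar>min (green_ext x y) b - min (green_ext x y) b\<bar>"
              by (intro tendsto_intros green_ext_tendsto X True) (use elim in simp)
            then have "(\<lambda>n. m n y) \<longlonglongrightarrow> 0" using True by (simp add: m_def)
            then show ?thesis unfolding ennreal_0[symmetric] by (rule tendsto_ennrealI)
          qed (simp add: m_def)
        qed
      qed measurable
      then have "(\<lambda>n. ennreal M * (\<integral>\<^sup>+y. ennreal (m n y) \<partial>\<mu>)) \<longlonglongrightarrow> ennreal M * 0"
        by (intro tendsto_mult_ennreal tendsto_const) auto
      then have "\<forall>\<^sub>F n in sequentially. ennreal M * (\<integral>\<^sup>+y. ennreal (m n y) \<partial>\<mu>) < ennreal (e / 4)"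
        using e by (intro order_tendstoD(2)) auto
      then show ?thesis
      proof eventually_elim
        case (elim n)
        have exc: "ennreal (green_ext z y - b) \<le> near_kernel t (y - z)" if "y \<in> \<Omega>" "near_kernel T (y - z) < \<infinity>" for y z
        proof -
          have "ennreal (green_ext z y) \<le> near_kernel t (y - z) + ennreal b"
            using green_ext_bounds(2)[OF that] near_kernel_split[OF t(1,2), of "y - z"] by (simp add: b_def)
          then show ?thesis using b by (simp add: ennreal_minus[symmetric] ennreal_minus_le_iff add.commute)
        qed
        have "ennreal \<bar>V (X n) - V x\<bar> = ennreal (norm (integral\<^sup>L \<mu> (\<lambda>y. wi y * green_ext (X n) y - wi y * green_ext x y)))"
          unfolding V_def using int by simp
        also have "\<dots> \<le> (\<integral>\<^sup>+y. ennreal (norm (wi y * green_ext (X n) y - wi y * green_ext x y)) \<partial>\<mu>)"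
          using int by (intro integral_norm_bound_ennreal) auto
        also have "\<dots> \<le> (\<integral>\<^sup>+y. ennreal M * ennreal (m n y) + (ennreal M * near_kernel t (y - X n) + ennreal M * near_kernel t (y - x)) \<partial>\<mu>)"
        proof (rule nn_integral_mono_AE)
          show "AE y in \<mu>. ennreal (norm (wi y * green_ext (X n) y - wi y * green_ext x y))
              \<le> ennreal M * ennreal (m n y) + (ennreal M * near_kernel t (y - X n) + ennreal M * near_kernel t (y - x))"
            using wiM finX
          proof eventually_elim
            case (elim y)
            show ?case
            proof (cases "y \<in> \<Omega>")
              case True
              let ?G = "green_ext (X n) y" and ?H = "green_ext x y"
              have fX: "near_kernel T (y - X n) < \<infinity>" and fx: "near_kernel T (y - x) < \<infinity>" using elim by auto
              have G0: "0 \<le> ?G" "0 \<le> ?H" using green_ext_bounds(1)[OF True] fX fx by auto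
              have "\<bar>?G - ?H\<bar> \<le> m n y + (max 0 (?G - b) + max 0 (?H - b))"
                using True by (auto simp: m_def min_def max_def)
              then have "ennreal \<bar>?G - ?H\<bar> \<le> ennreal (m n y + (max 0 (?G - b) + max 0 (?H - b)))" by (rule ennreal_leI)
              also have "\<dots> = ennreal (m n y) + (ennreal (max 0 (?G - b)) + ennreal (max 0 (?H - b)))"
                by (simp add: m_def)
              also have "\<dots> = ennreal (m n y) + (ennreal (?G - b) + ennreal (?H - b))"
                by (simp add: max_def ennreal_neg)
              also have "\<dots> \<le> ennreal (m n y) + (near_kernel t (y - X n) + near_kernel t (y - x))"
                by (intro add_mono order_refl exc True fX fx)
              finally have 1: "ennreal \<bar>?G - ?H\<bar> \<le> ennreal (m n y) + (near_kernel t (y - X n) + near_kernel t (y - x))" .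
              have "norm (wi y * ?G - wi y * ?H) \<le> M * \<bar>?G - ?H\<bar>"
                using elim(1) True by (simp add: right_diff_distrib[symmetric] abs_mult mult_right_mono)
              then have "ennreal (norm (wi y * ?G - wi y * ?H)) \<le> ennreal (M * \<bar>?G - ?H\<bar>)" by (rule ennreal_leI)
              also have "\<dots> = ennreal M * ennreal \<bar>?G - ?H\<bar>" using M by (simp add: ennreal_mult)
              also have "\<dots> \<le> ennreal M * (ennreal (m n y) + (near_kernel t (y - X n) + near_kernel t (y - x)))"
                by (intro mult_left_mono 1) simp
              finally show ?thesis by (simp add: distrib_left)
            qed (simp add: wi_def)
          qed
        qed
        also have "\<dots> = ennreal M * (\<integral>\<^sup>+y. ennreal (m n y) \<partial>\<mu>) + (ennreal M * (\<integral>\<^sup>+y. near_kernel t (y - X n) \<partial>\<mu>) + ennreal M * (\<integral>\<^sup>+y. near_kernel t (y - x) \<partial>\<mu>))"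
          by (simp add: nn_integral_add nn_integral_cmult)
        also have "\<dots> \<le> ennreal (e / 4) + (ennreal M * ennreal (k t) + ennreal M * ennreal (k t))"
          using elim by (intro add_mono mult_left_mono pot t) auto
        also have "\<dots> = ennreal (e / 4 + (M * k t + M * k t))"
        proof -
          have "ennreal (e / 4 + (M * k t + M * k t)) = ennreal (e / 4) + (ennreal (M * k t) + ennreal (M * k t))"
            using e M(1) k0[of t] by (subst ennreal_plus; (subst ennreal_plus)?) simp_all
          then show ?thesis using M(1) k0[of t] by (simp only: ennreal_mult)
        qed
        finally have "\<bar>V (X n) - V x\<bar> \<le> e / 4 + (M * k t + M * k t)"
          using e M k0[of t] by (subst (asm) ennreal_le_iff) auto
        then show ?case using t(3) e unfolding dist_real_def by linarith
      qed
    qed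
    then show "(V \<circ> X) \<longlonglongrightarrow> V x" unfolding o_def by (rule tendstoI)
  qed
  then show ?thesis unfolding V_eq .
qed

end

section \<open>Growth of the measure and the main theorem\<close>

text \<open>The complement of the support is a union of null balls, and by Lindelof countably many
  of them suffice.\<close>

lemma null_sets_compl_msupp:
  fixes \<mu> :: "'a::euclidean_space measure"
  assumes "sets \<mu> = sets borel"
  shows "- msupp \<mu> \<in> null_sets \<mu>"
proof -
  define F where "F = {ball x e | x e. e > 0 \<and> emeasure \<mu> (ball x e) = 0}"
  obtain F' where F': "F' \<subseteq> F" "countable F'" "\<Union>F' = \<Union>F"
    using Lindelof[of F] by (auto simp: F_def)
  have "- msupp \<mu> = \<Union>F"
  proof (intro equalityI subsetI)
    fix x assume "x \<in> - msupp \<mu>"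
    then obtain e where "e > 0" "emeasure \<mu> (ball x e) = 0" by (auto simp: msupp_def zero_less_iff_neq_zero)
    then show "x \<in> \<Union>F" by (auto simp: F_def intro!: exI[of _ "ball x e"])
  next
    fix y assume "y \<in> \<Union>F"
    then obtain x e where xe: "e > 0" "emeasure \<mu> (ball x e) = 0" "y \<in> ball x e" by (auto simp: F_def)
    obtain r where r: "r > 0" "ball y r \<subseteq> ball x e" using xe(3) open_ball openE by blast
    have "emeasure \<mu> (ball y r) \<le> emeasure \<mu> (ball x e)"
      by (rule emeasure_mono[OF r(2)]) (simp add: assms)
    then show "y \<in> - msupp \<mu>" using r(1) xe(2) by (auto simp: msupp_def)
  qed
  moreover have "\<Union>F' \<in> null_sets \<mu>"
  proof (rule null_sets_UN'[OF F'(2), of "\<lambda>x. x", simplified])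
    fix S assume "S \<in> F'"
    then show "S \<in> null_sets \<mu>" using F'(1) by (auto simp: F_def assms intro!: null_setsI)
  qed
  ultimately show ?thesis using F'(3) by simp
qed

text \<open>The dimension controls only small balls centred in the support. A ball of positive mass
  meets the support, so it lies in a centred ball of twice the radius; large radii are handled by
  the total mass.\<close>

lemma ball_growth_of_lower_Linf_dim:
  fixes \<mu> :: "'a::euclidean_space measure"
  assumes \<mu>: "finite_measure \<mu>" and sets: "sets \<mu> = sets borel" and pos: "emeasure \<mu> \<Omega> > 0"
    and dim: "lower_Linf_dim \<mu> > ereal (real DIM('a) - 2)"
  shows "\<exists>C Q. 0 \<le> C \<and> real DIM('a) - 2 < Q \<and> (\<forall>y r. 0 < r \<longrightarrow> emeasure \<mu> (ball y r) \<le> ennreal (C * r powr Q))"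
proof (cases "DIM('a) = 1")
  \<comment> \<open>Here the lower bound for the exponent is -1, and exponent 0 with the total mass
    suffices. The other case has \<open>q > 0\<close>, as monotonicity of the power in its base
    requires.\<close>
  case True
  interpret finite_measure \<mu> by fact
  have "emeasure \<mu> (ball y r) \<le> ennreal (measure \<mu> (space \<mu>) * r powr 0)" if "r > 0" for y r
    using that by (simp add: emeasure_eq_measure bounded_measure ennreal_leI)
  then show ?thesis using True by (intro exI[of _ "measure \<mu> (space \<mu>)"] exI[of _ 0]) auto
next
  case False
  interpret finite_measure \<mu> by fact
  have D: "real DIM('a) \<ge> 2" using False DIM_positive[where 'a='a] by linarith
  obtain q where q: "real DIM('a) - 2 < q" "ereal q < lower_Linf_dim \<mu>"
    using ereal_dense2[OF dim] by auto
  have q0: "q > 0" using q(1) D by linarith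
  define S where "S \<delta> = (SUP x\<in>msupp \<mu>. measure \<mu> (ball x \<delta>))" for \<delta>
  have bdd: "bdd_above ((\<lambda>x. measure \<mu> (ball x \<delta>)) ` msupp \<mu>)" for \<delta>
    by (rule bdd_aboveI2[of _ _ "measure \<mu> (space \<mu>)"]) (rule bounded_measure)
  have le_S: "measure \<mu> (ball x \<delta>) \<le> S \<delta>" if "x \<in> msupp \<mu>" for x \<delta>
    unfolding S_def by (rule cSUP_upper[OF that bdd])
  have "\<forall>\<^sub>F \<delta> in at_right 0. ereal q < ereal (ln (S \<delta>) / ln \<delta>)"
    using less_LiminfD[OF q(2)[unfolded lower_Linf_dim_def]] by (simp add: S_def)
  then obtain b where b: "b > 0" "\<And>\<delta>. 0 < \<delta> \<Longrightarrow> \<delta> < b \<Longrightarrow> q < ln (S \<delta>) / ln \<delta>"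
    unfolding eventually_at_right[OF zero_less_one] by auto
  define \<delta>0 where "\<delta>0 = min b (1 / 2)"
  have \<delta>0: "\<delta>0 > 0" "\<delta>0 \<le> b" "\<delta>0 < 1" using b(1) by (auto simp: \<delta>0_def)
  have small: "measure \<mu> (ball x \<delta>) \<le> \<delta> powr q" if x: "x \<in> msupp \<mu>" and \<delta>: "0 < \<delta>" "\<delta> < \<delta>0" for x \<delta>
  proof -
    have "emeasure \<mu> (ball x \<delta>) > 0" using x \<delta>(1) by (simp add: msupp_def)
    then have "measure \<mu> (ball x \<delta>) > 0" by (simp add: emeasure_eq_measure)
    then have Spos: "S \<delta> > 0" using le_S[OF x, of \<delta>] by linarith
    have "ln \<delta> < 0" using \<delta> \<delta>0 by simp
    then have "ln (S \<delta>) < q * ln \<delta>"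
      using b(2)[of \<delta>] \<delta> \<delta>0 by (simp add: neg_less_divide_eq)
    then have "ln (S \<delta>) < ln (\<delta> powr q)" using \<delta> by (simp add: ln_powr)
    then have "S \<delta> < \<delta> powr q" using Spos \<delta> by (subst (asm) ln_less_cancel_iff) auto
    then show ?thesis using le_S[OF x, of \<delta>] by linarith
  qed
  define m where "m = measure \<mu> (space \<mu>)"
  have m: "m \<ge> 0" by (simp add: m_def)
  \<comment> \<open>The factor \<open>2 powr q\<close> pays for doubling the radius, and
    \<open>m / \<delta>0 powr q\<close> for radii with \<open>2 * r\<close> at least
    \<delta>0.\<close>
  define C where "C = 2 powr q * (1 + m / \<delta>0 powr q)"
  have C: "C \<ge> 0" using m by (simp add: C_def)
  have "emeasure \<mu> (ball y r) \<le> ennreal (C * r powr q)" if r: "r > 0" for y r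
  proof -
    have "measure \<mu> (ball y r) \<le> C * r powr q"
    proof (cases "measure \<mu> (ball y r) = 0")
      case True
      then show ?thesis using C by simp
    next
      case False
      have eq: "C * r powr q = (2 * r) powr q * (1 + m / \<delta>0 powr q)"
        using r by (simp add: C_def powr_mult)
      have "\<not> ball y r \<subseteq> - msupp \<mu>"
      proof
        assume "ball y r \<subseteq> - msupp \<mu>"
        then have "emeasure \<mu> (ball y r) \<le> emeasure \<mu> (- msupp \<mu>)"
          by (rule emeasure_mono) (use null_sets_compl_msupp[OF sets] in auto)
        then show False using False null_sets_compl_msupp[OF sets] by (simp add: measure_def null_setsD1)
      qed
      then obtain x where x: "x \<in> msupp \<mu>" "x \<in> ball y r" by auto
      have sub: "ball y r \<subseteq> ball x (2 * r)"
      proof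
        fix z assume "z \<in> ball y r"
        then show "z \<in> ball x (2 * r)" using x(2) dist_triangle[of x z y] by (simp add: dist_commute)
      qed
      show ?thesis
      proof (cases "2 * r < \<delta>0")
        case True
        have "measure \<mu> (ball y r) \<le> measure \<mu> (ball x (2 * r))"
          by (rule finite_measure_mono[OF sub]) (simp add: sets)
        also have "\<dots> \<le> (2 * r) powr q" by (rule small[OF x(1)]) (use True r in auto)
        also have "\<dots> \<le> (2 * r) powr q * (1 + m / \<delta>0 powr q)"
          using m by (simp add: mult_le_cancel_left1)
        finally show ?thesis unfolding eq .
      next
        case False
        have "measure \<mu> (ball y r) \<le> m" unfolding m_def by (rule bounded_measure)
        also have "\<dots> = \<delta>0 powr q * (m / \<delta>0 powr q)" using \<delta>0 by simp
        also have "\<dots> \<le> (2 * r) powr q * (1 + m / \<delta>0 powr q)"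
          using False \<delta>0 m q0 by (intro mult_mono powr_mono2) auto
        finally show ?thesis unfolding eq .
      qed
    qed
    then show ?thesis by (simp add: emeasure_eq_measure ennreal_leI)
  qed
  then show ?thesis using C q(1) by blast
qed

section \<open>Integrability of limits and the continuous version\<close>

lemma norm_square_le_of_close:
  fixes F f :: "'b::real_normed_vector"
  shows "(norm f)\<^sup>2 \<le> 2 * (norm (F - f))\<^sup>2 + 2 * (norm F)\<^sup>2"
proof -
  have "norm f \<le> norm (F - f) + norm F"
    using norm_triangle_ineq4[of F "F - f"] by simp
  then have "(norm f)\<^sup>2 \<le> (norm (F - f) + norm F)\<^sup>2" by (intro power_mono) auto
  also have "\<dots> \<le> 2 * (norm (F - f))\<^sup>2 + 2 * (norm F)\<^sup>2"
    using sum_squares_bound[of "norm (F - f)" "norm F"] by (simp add: power2_sum)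
  finally show ?thesis .
qed

lemma L2_norm_le_of_close:
  fixes F f :: "'a \<Rightarrow> 'b::euclidean_space"
  assumes [measurable]: "F \<in> borel_measurable M" "f \<in> borel_measurable M"
  shows "(\<integral>\<^sup>+x. ennreal ((norm (f x))\<^sup>2) \<partial>M)
    \<le> 2 * (\<integral>\<^sup>+x. ennreal ((norm (F x - f x))\<^sup>2) \<partial>M) + 2 * (\<integral>\<^sup>+x. ennreal ((norm (F x))\<^sup>2) \<partial>M)"
proof -
  have "(\<integral>\<^sup>+x. ennreal ((norm (f x))\<^sup>2) \<partial>M)
      \<le> (\<integral>\<^sup>+x. 2 * ennreal ((norm (F x - f x))\<^sup>2) + 2 * ennreal ((norm (F x))\<^sup>2) \<partial>M)"
  proof (rule nn_integral_mono)
    fix x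
    have "ennreal ((norm (f x))\<^sup>2) \<le> ennreal (2 * (norm (F x - f x))\<^sup>2 + 2 * (norm (F x))\<^sup>2)"
      by (intro ennreal_leI norm_square_le_of_close)
    then show "ennreal ((norm (f x))\<^sup>2) \<le> 2 * ennreal ((norm (F x - f x))\<^sup>2) + 2 * ennreal ((norm (F x))\<^sup>2)"
      by (simp add: ennreal_mult)
  qed
  also have "\<dots> = 2 * (\<integral>\<^sup>+x. ennreal ((norm (F x - f x))\<^sup>2) \<partial>M) + 2 * (\<integral>\<^sup>+x. ennreal ((norm (F x))\<^sup>2) \<partial>M)"
    by (simp add: nn_integral_add nn_integral_cmult)
  finally show ?thesis .
qed

text \<open>On a set of finite measure, |f| is at most 1 + |f|^2.\<close>

lemma set_integrable_of_L2:
  fixes f :: "'a \<Rightarrow> 'b::euclidean_space"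
  assumes [measurable]: "(\<lambda>x. indicator S x *\<^sub>R f x) \<in> borel_measurable M" "S \<in> sets M"
    and S: "emeasure M S < \<infinity>" and f: "(\<integral>\<^sup>+x. ennreal ((norm (indicator S x *\<^sub>R f x))\<^sup>2) \<partial>M) < \<infinity>"
  shows "set_integrable M S f"
proof -
  define F where "F x = indicator S x *\<^sub>R f x" for x
  have mF[measurable]: "F \<in> borel_measurable M" using assms(1) by (simp add: F_def[abs_def])
  have "(\<integral>\<^sup>+x. ennreal (norm (F x)) \<partial>M)
      \<le> (\<integral>\<^sup>+x. indicator S x + ennreal ((norm (F x))\<^sup>2) \<partial>M)"
  proof (rule nn_integral_mono)
    fix x
    have "2 * norm (f x) \<le> 1 + (norm (f x))\<^sup>2" using sum_squares_bound[of 1 "norm (f x)"] by simp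
    then have "norm (f x) \<le> 1 + (norm (f x))\<^sup>2" using norm_ge_zero[of "f x"] by linarith
    then have "ennreal (norm (f x)) \<le> ennreal (1 + (norm (f x))\<^sup>2)" by (rule ennreal_leI)
    then show "ennreal (norm (F x)) \<le> indicator S x + ennreal ((norm (F x))\<^sup>2)"
      by (simp add: F_def indicator_def)
  qed
  also have "\<dots> = emeasure M S + (\<integral>\<^sup>+x. ennreal ((norm (F x))\<^sup>2) \<partial>M)"
    by (subst nn_integral_add) auto
  also have "\<dots> < \<infinity>" using S f[folded F_def] by simp
  finally have "(\<integral>\<^sup>+x. ennreal (norm (F x)) \<partial>M) < \<infinity>" .
  then have "integrable M F" by (intro integrableI_bounded mF)
  then show ?thesis by (simp add: set_integrable_def F_def[abs_def])
qed

lemma test_fun_L2_finite: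
  assumes "test_fun \<Omega> \<phi>"
  shows "(\<integral>\<^sup>+x. ennreal ((norm (grad \<phi> x))\<^sup>2) \<partial>lborel) < \<infinity>" "\<exists>M\<ge>0. \<forall>x. \<bar>\<phi> x\<bar> \<le> M"
    "x \<notin> \<Omega> \<Longrightarrow> grad \<phi> x = 0"
proof -
  let ?K = "closure {x. \<phi> x \<noteq> 0}"
  note C1 = test_fun_C1_grad[OF assms] and sup = test_fun_support[OF assms]
  have off: "grad \<phi> x = 0" if "x \<notin> ?K" for x
  proof (rule grad_zero_off_support[OF _ closed_closure sup(3) that])
    show "(\<phi> has_derivative (\<lambda>v. grad \<phi> x \<bullet> v)) (at x)" using C1 unfolding C1_grad_def by blast
  qed
  show "x \<notin> \<Omega> \<Longrightarrow> grad \<phi> x = 0" using off sup(2) by blast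
  have "integrable lborel (\<lambda>x. (norm (grad \<phi> x))\<^sup>2)"
    by (rule integrable_continuous_compact_support[OF _ sup(1)])
       (use off C1 in \<open>auto simp: C1_grad_def intro!: continuous_intros intro: continuous_on_subset\<close>)
  then show "(\<integral>\<^sup>+x. ennreal ((norm (grad \<phi> x))\<^sup>2) \<partial>lborel) < \<infinity>"
    unfolding integrable_iff_bounded by simp
  show "\<exists>M\<ge>0. \<forall>x. \<bar>\<phi> x\<bar> \<le> M"
    using continuous_compact_support_bounded[OF C1_grad_continuous[OF C1] sup(1)] sup(3) by (metis real_norm_def)
qed

context green_function
begin

lemma eigenfunction_continuous_version:
  assumes \<mu>: "finite_measure \<mu>" and s\<mu>[measurable_cong]: "sets \<mu> = sets borel"
    and growth: "\<And>y r. r > 0 \<Longrightarrow> emeasure \<mu> (ball y r) \<le> ennreal (C * r powr Q)" and Q: "Q > d - 2" and C: "C \<ge> 0"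
    and eig: "eigenfunction \<Omega> \<mu> u lam"
  shows "\<exists>v. continuous_on (closure \<Omega>) v \<and> (AE x in lebesgue. x \<in> \<Omega> \<longrightarrow> v x = u x)"
proof -
  interpret finite_measure \<mu> by fact
  obtain Du w where rep: "H01_rep \<Omega> \<mu> u Du w" and nz: "\<not> (AE x in \<mu>. x \<in> \<Omega> \<longrightarrow> w x = 0)"
    and eq: "\<And>\<phi>. test_fun \<Omega> \<phi> \<Longrightarrow>
           (LINT x:\<Omega>|lebesgue. Du x \<bullet> grad \<phi> x) = (LINT x:\<Omega>|\<mu>. lam * w x * \<phi> x)"
    using eig unfolding eigenfunction_def by blast
  have mu: "u \<in> borel_measurable lebesgue" and mDu: "Du \<in> borel_measurable lebesgue" and mw[measurable]: "w \<in> borel_measurable \<mu>"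
    using rep by (auto simp: H01_rep_def)
  obtain \<phi> where \<phi>: "\<And>n. test_fun \<Omega> (\<phi> n)"
    and limu: "(\<lambda>n. \<integral>\<^sup>+x\<in>\<Omega>. ennreal ((\<phi> n x - u x)\<^sup>2) \<partial>lebesgue) \<longlonglongrightarrow> 0"
    and limDu: "(\<lambda>n. \<integral>\<^sup>+x\<in>\<Omega>. ennreal ((norm (grad (\<phi> n) x - Du x))\<^sup>2) \<partial>lebesgue) \<longlonglongrightarrow> 0"
    and limw: "(\<lambda>n. \<integral>\<^sup>+x\<in>\<Omega>. ennreal ((\<phi> n x - w x)\<^sup>2) \<partial>\<mu>) \<longlonglongrightarrow> 0"
    using rep unfolding H01_rep_def by blast
  have c\<phi>: "continuous_on UNIV (\<phi> n)" for n by (rule C1_grad_continuous[OF test_fun_C1_grad[OF \<phi>]])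
  have [measurable]: "\<phi> n \<in> borel_measurable borel" for n
    using c\<phi> by (rule borel_measurable_continuous_onI)
  have mgb[measurable]: "grad (\<phi> n) \<in> borel_measurable borel" for n
    using test_fun_C1_grad[OF \<phi>, of n] by (intro borel_measurable_continuous_onI) (simp add: C1_grad_def)
  have mg: "grad (\<phi> n) \<in> borel_measurable lebesgue" for n
    by (rule measurable_completion) (simp add: mgb)
  have \<Omega>leb: "\<Omega> \<in> sets lebesgue" using borel_\<Omega> by (simp add: sets_completionI_sets)
  have \<Omega>fin: "emeasure lebesgue \<Omega> < \<infinity>"
    using emeasure_bounded_finite[OF bounded_\<Omega>] borel_\<Omega> by (simp add: emeasure_completion)
  have ind_sq: "ennreal ((norm (indicator \<Omega> x *\<^sub>R a - indicator \<Omega> x *\<^sub>R b))\<^sup>2) = ennreal ((norm (a - b))\<^sup>2) * indicator \<Omega> x"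
    for x and a b :: "'c::real_normed_vector" by (simp add: indicator_def)
  define gi where "gi n x = indicator \<Omega> x *\<^sub>R grad (\<phi> n) x" for n x
  define Di where "Di x = indicator \<Omega> x *\<^sub>R Du x" for x
  define wi where "wi x = indicator \<Omega> x *\<^sub>R w x" for x
  have gi_eq: "gi n = grad (\<phi> n)" for n
    using test_fun_L2_finite(3)[OF \<phi>] by (auto simp: gi_def fun_eq_iff indicator_def)
  have mDi: "Di \<in> borel_measurable lebesgue"
    unfolding Di_def by (intro borel_measurable_scaleR borel_measurable_indicator \<Omega>leb mDu)
  have limDi: "(\<lambda>n. \<integral>\<^sup>+x. ennreal ((norm (gi n x - Di x))\<^sup>2) \<partial>lebesgue) \<longlonglongrightarrow> 0"
    using limDu by (simp only: gi_def Di_def ind_sq)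
  have gfin: "(\<integral>\<^sup>+x. ennreal ((norm (gi n x))\<^sup>2) \<partial>lebesgue) < \<infinity>" for n
    using test_fun_L2_finite(1)[OF \<phi>] by (simp add: gi_eq nn_integral_completion)
  have "\<forall>\<^sub>F n in sequentially. (\<integral>\<^sup>+x. ennreal ((norm (gi n x - Di x))\<^sup>2) \<partial>lebesgue) < 1"
    by (rule order_tendstoD(2)[OF limDi]) simp
  \<comment> \<open>From this index on the gradients are within L2 distance 1 of \<open>Du\<close>.
    This gives the energy bound \<open>2 + 2 * L\<close> independent of n, so the representation is
    applied to the shifted sequence.\<close>
  then obtain n0 where n0: "\<And>n. n \<ge> n0 \<Longrightarrow> (\<integral>\<^sup>+x. ennreal ((norm (gi n x - Di x))\<^sup>2) \<partial>lebesgue) < 1"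
    by (auto simp: eventually_sequentially)
  have DiL2: "(\<integral>\<^sup>+x. ennreal ((norm (Di x))\<^sup>2) \<partial>lebesgue) < \<infinity>"
  proof -
    have "(\<integral>\<^sup>+x. ennreal ((norm (Di x))\<^sup>2) \<partial>lebesgue)
        \<le> 2 * (\<integral>\<^sup>+x. ennreal ((norm (gi n0 x - Di x))\<^sup>2) \<partial>lebesgue) + 2 * (\<integral>\<^sup>+x. ennreal ((norm (gi n0 x))\<^sup>2) \<partial>lebesgue)"
      by (rule L2_norm_le_of_close) (use mg mDi in \<open>auto simp: gi_eq\<close>)
    also have "\<dots> < \<infinity>"
      using n0[of n0] gfin[of n0] by (auto simp: ennreal_mult_less_top intro: order.strict_trans)
    finally show ?thesis .
  qed
  obtain L where L: "(\<integral>\<^sup>+x. ennreal ((norm (Di x))\<^sup>2) \<partial>lebesgue) = ennreal L" "L \<ge> 0"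
    using DiL2 by (cases "\<integral>\<^sup>+x. ennreal ((norm (Di x))\<^sup>2) \<partial>lebesgue") auto
  have gN: "(\<integral>\<^sup>+y. ennreal ((norm (grad (\<phi> (n + n0)) y))\<^sup>2) \<partial>lborel) \<le> ennreal (2 + 2 * L)" for n
  proof -
    let ?m = "n + n0"
    have "(\<integral>\<^sup>+x. ennreal ((norm (gi ?m x))\<^sup>2) \<partial>lebesgue)
        \<le> 2 * (\<integral>\<^sup>+x. ennreal ((norm (Di x - gi ?m x))\<^sup>2) \<partial>lebesgue) + 2 * (\<integral>\<^sup>+x. ennreal ((norm (Di x))\<^sup>2) \<partial>lebesgue)"
      by (rule L2_norm_le_of_close) (use mg mDi in \<open>auto simp: gi_eq\<close>)
    also have "\<dots> \<le> 2 * 1 + 2 * ennreal L"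
      unfolding L(1) norm_minus_commute[of "Di _"]
      using n0[of ?m] by (intro add_mono mult_left_mono) auto
    also have "\<dots> = ennreal (2 + 2 * L)" using L(2) by (simp add: ennreal_mult)
    finally show ?thesis by (simp add: gi_eq nn_integral_completion)
  qed
  have setDu: "set_integrable lebesgue \<Omega> Du"
    by (rule set_integrable_of_L2[OF mDi[unfolded Di_def[abs_def]] \<Omega>leb \<Omega>fin DiL2[unfolded Di_def]])
  have limwi: "(\<lambda>n. \<integral>\<^sup>+x. ennreal ((norm (indicator \<Omega> x *\<^sub>R \<phi> n x - wi x))\<^sup>2) \<partial>\<mu>) \<longlonglongrightarrow> 0"
    using limw unfolding wi_def ind_sq by (simp only: real_norm_def power2_abs)
  have [measurable]: "wi \<in> borel_measurable \<mu>" unfolding wi_def by measurable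
  have wiL2: "(\<integral>\<^sup>+x. ennreal ((norm (wi x))\<^sup>2) \<partial>\<mu>) < \<infinity>"
  proof -
    have "\<forall>\<^sub>F n in sequentially. (\<integral>\<^sup>+x. ennreal ((norm (indicator \<Omega> x *\<^sub>R \<phi> n x - wi x))\<^sup>2) \<partial>\<mu>) < 1"
      by (rule order_tendstoD(2)[OF limwi]) simp
    then obtain n where n: "(\<integral>\<^sup>+x. ennreal ((norm (indicator \<Omega> x *\<^sub>R \<phi> n x - wi x))\<^sup>2) \<partial>\<mu>) < 1"
      by (auto simp: eventually_sequentially)
    obtain M where M: "M \<ge> 0" "\<And>x. \<bar>\<phi> n x\<bar> \<le> M" using test_fun_L2_finite(2)[OF \<phi>, of n] by blast
    have "(\<integral>\<^sup>+x. ennreal ((norm (indicator \<Omega> x *\<^sub>R \<phi> n x))\<^sup>2) \<partial>\<mu>) \<le> (\<integral>\<^sup>+x. ennreal (M\<^sup>2) \<partial>\<mu>)"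
      using M by (intro nn_integral_mono ennreal_leI) (auto simp: indicator_def abs_le_square_iff[symmetric])
    also have "\<dots> < \<infinity>" by (simp add: ennreal_mult_less_top emeasure_eq_measure)
    finally have fin: "(\<integral>\<^sup>+x. ennreal ((norm (indicator \<Omega> x *\<^sub>R \<phi> n x))\<^sup>2) \<partial>\<mu>) < \<infinity>" .
    have "(\<integral>\<^sup>+x. ennreal ((norm (wi x))\<^sup>2) \<partial>\<mu>)
        \<le> 2 * (\<integral>\<^sup>+x. ennreal ((norm (indicator \<Omega> x *\<^sub>R \<phi> n x - wi x))\<^sup>2) \<partial>\<mu>) + 2 * (\<integral>\<^sup>+x. ennreal ((norm (indicator \<Omega> x *\<^sub>R \<phi> n x))\<^sup>2) \<partial>\<mu>)"
      by (rule L2_norm_le_of_close) measurable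
    also have "\<dots> < \<infinity>"
      using n fin by (auto simp: ennreal_mult_less_top intro: order.strict_trans)
    finally show ?thesis .
  qed
  have setw: "set_integrable \<mu> \<Omega> w"
    by (rule set_integrable_of_L2) (use wiL2 in \<open>auto simp: wi_def emeasure_eq_measure\<close>)
  define W where "W x = lam * w x" for x
  have setW: "set_integrable \<mu> \<Omega> W" unfolding W_def using setw by simp
  \<comment> \<open>If all approximants vanished, their limit \<open>w\<close> would vanish
    \<mu>-almost everywhere in \<Omega>, contrary to the definition of an eigenfunction. The nonzero
    test function feeds the mollifier.\<close>
  obtain n1 a1 where ne: "\<phi> n1 a1 \<noteq> 0"
  proof (cases "\<forall>n a. \<phi> n a = 0")
    case True
    then have "(\<lambda>n::nat. \<integral>\<^sup>+x. ennreal ((norm (wi x))\<^sup>2) \<partial>\<mu>) \<longlonglongrightarrow> 0" using limwi by simp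
    then have "(\<integral>\<^sup>+x. ennreal ((norm (wi x))\<^sup>2) \<partial>\<mu>) = 0" by (simp add: LIMSEQ_const_iff)
    then have "AE x in \<mu>. ennreal ((norm (wi x))\<^sup>2) = 0" by (subst (asm) nn_integral_0_iff_AE) measurable
    then have "AE x in \<mu>. x \<in> \<Omega> \<longrightarrow> w x = 0"
      by eventually_elim (auto simp: wi_def)
    then show ?thesis using nz by blast
  qed (use that in blast)
  have weak: "(LINT x:\<Omega>|lebesgue. Du x \<bullet> B x) = (LINT x:\<Omega>|\<mu>. W x * \<psi> x)"
    if "C1_grad UNIV \<psi> B" "compact K" "K \<subseteq> \<Omega>" "\<And>x. x \<notin> K \<Longrightarrow> \<psi> x = 0" for \<psi> B K
    by (rule weak_equation_C1[OF \<phi> ne open_\<Omega> s\<mu> setDu setW _ that]) (use eq in \<open>auto simp: W_def\<close>)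
  have limDi': "(\<lambda>n. \<integral>\<^sup>+y. ennreal ((norm (indicator \<Omega> y *\<^sub>R grad (\<phi> (n + n0)) y - indicator \<Omega> y *\<^sub>R Du y))\<^sup>2) \<partial>lebesgue) \<longlonglongrightarrow> 0"
    using LIMSEQ_ignore_initial_segment[OF limDi, of n0] by (simp add: gi_def Di_def)
  have rep: "AE x in \<nu>. x \<in> \<Omega> \<longrightarrow> c * f x = green_potential \<mu> W x"
    if \<nu>: "finite_measure \<nu>" "sets \<nu> = sets borel" "\<And>y r. r > 0 \<Longrightarrow> emeasure \<nu> (ball y r) \<le> ennreal (C' * r powr Q')"
      "Q' > d - 2" "C' \<ge> 0" "f \<in> borel_measurable \<nu>"
      "(\<lambda>n. \<integral>\<^sup>+x. ennreal ((indicator \<Omega> x * \<phi> n x - indicator \<Omega> x * f x)\<^sup>2) \<partial>\<nu>) \<longlonglongrightarrow> 0" for \<nu> f C' Q'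
  proof (rule representation[where \<phi>="\<lambda>n. \<phi> (n + n0)" and N="2 + 2 * L" and Du=Du and C=C' and Q=Q'])
    show "(\<lambda>y. indicator \<Omega> y *\<^sub>R Du y) \<in> borel_measurable lebesgue" using mDi by (simp add: Di_def[abs_def])
    show "(\<integral>\<^sup>+y. ennreal ((norm (indicator \<Omega> y *\<^sub>R Du y))\<^sup>2) \<partial>lebesgue) < \<infinity>" using DiL2 by (simp add: Di_def)
    show "(\<lambda>n. \<integral>\<^sup>+x. ennreal ((indicator \<Omega> x * \<phi> (n + n0) x - indicator \<Omega> x * f x)\<^sup>2) \<partial>\<nu>) \<longlonglongrightarrow> 0"
      using LIMSEQ_ignore_initial_segment[OF \<nu>(7), of n0] .
    show "0 \<le> 2 + 2 * L" using L by simp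
  qed (fact \<nu> \<mu> s\<mu> setW weak \<phi> gN limDi')+
  define \<alpha> where "\<alpha> = (Q - d) / 2 + 1"
  have \<alpha>: "\<alpha> > 0" using Q by (simp add: \<alpha>_def field_simps)
  define k where "k t = \<kappa> * C * (t powr \<alpha> / \<alpha>)" for t
  have pot: "(\<integral>\<^sup>+x. near_kernel t (x - y) \<partial>\<mu>) \<le> ennreal (k t)" if "t > 0" for t y
    unfolding k_def \<alpha>_def by (rule near_kernel_potential(2)[OF s\<mu> \<mu> growth Q C that])
  have k0: "k t \<ge> 0" for t using \<kappa>_pos C \<alpha> by (simp add: k_def)
  have klim: "(\<lambda>n. k (1 / Suc n)) \<longlonglongrightarrow> 0"
    unfolding k_def by (rule potential_bound_tendsto_0[OF \<alpha>])
  have "AE x in \<mu>. x \<in> \<Omega> \<longrightarrow> c * w x = green_potential \<mu> W x"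
    by (rule rep[OF \<mu> s\<mu> growth Q C mw]) (use limwi in \<open>simp_all add: wi_def\<close>)
  then obtain M where M: "M \<ge> 0" "AE x in \<mu>. x \<in> \<Omega> \<longrightarrow> \<bar>w x\<bar> \<le> M"
    using bounded_of_representation[OF \<mu> s\<mu> pot k0 klim setw] unfolding W_def by blast
  have "AE x in \<mu>. x \<in> \<Omega> \<longrightarrow> \<bar>W x\<bar> \<le> \<bar>lam\<bar> * M"
    using M(2) by eventually_elim (auto simp: W_def abs_mult intro: mult_left_mono)
  then have cont: "continuous_on (closure \<Omega>) (\<lambda>x. if x \<in> \<Omega> then green_potential \<mu> W x else 0)"
    using M(1) by (intro green_potential_continuous[OF \<mu> s\<mu> pot k0 klim setW, of "\<bar>lam\<bar> * M"]) auto
  \<comment> \<open>The representation is stated for measures on the Borel sets, while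
    \<open>u\<close> is only Lebesgue measurable; a Borel version differs on a null set.\<close>
  obtain u' where u'[measurable]: "u' \<in> borel_measurable lborel" and uu': "AE x in lborel. u x = u' x"
    using completion_ex_borel_measurable_real[OF mu] by blast
  \<comment> \<open>Lebesgue measure restricted to \<Omega> is finite, and its balls have mass of
    order r^d, so the growth exponent \<open>d\<close> is admissible.\<close>
  define \<nu> where "\<nu> = density lborel (indicator \<Omega> :: 'a \<Rightarrow> ennreal)"
  have s\<nu>: "sets \<nu> = sets borel" by (simp add: \<nu>_def)
  have e\<nu>: "emeasure \<nu> A = emeasure lborel (\<Omega> \<inter> A)" if "A \<in> sets borel" for A
    using that by (simp add: \<nu>_def emeasure_density nn_integral_cmult_indicator flip: indicator_inter_arith)
  have \<nu>: "finite_measure \<nu>"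
  proof (rule finite_measureI)
    have "emeasure \<nu> (space \<nu>) = emeasure lborel \<Omega>" using e\<nu>[of UNIV] by (simp add: \<nu>_def)
    then show "emeasure \<nu> (space \<nu>) \<noteq> \<infinity>" using emeasure_bounded_finite[OF bounded_\<Omega>] by simp
  qed
  have growth\<nu>: "emeasure \<nu> (ball y r) \<le> ennreal (unit_ball_vol d * r powr d)" if r: "r > 0" for y r
  proof -
    have "emeasure \<nu> (ball y r) \<le> emeasure lborel (ball y r)" by (simp add: e\<nu> emeasure_mono)
    also have "\<dots> = ennreal (unit_ball_vol d * r powr d)"
      using r by (simp add: emeasure_ball d_DIM powr_realpow)
    finally show ?thesis .
  qed
  have lim\<nu>: "(\<lambda>n. \<integral>\<^sup>+x. ennreal ((indicator \<Omega> x * \<phi> n x - indicator \<Omega> x * u' x)\<^sup>2) \<partial>\<nu>) \<longlonglongrightarrow> 0"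
  proof -
    have "(\<integral>\<^sup>+x\<in>\<Omega>. ennreal ((\<phi> n x - u x)\<^sup>2) \<partial>lebesgue) = (\<integral>\<^sup>+x. ennreal ((indicator \<Omega> x * \<phi> n x - indicator \<Omega> x * u' x)\<^sup>2) \<partial>\<nu>)" for n
    proof -
      have "(\<integral>\<^sup>+x\<in>\<Omega>. ennreal ((\<phi> n x - u x)\<^sup>2) \<partial>lebesgue) = (\<integral>\<^sup>+x. ennreal ((\<phi> n x - u x)\<^sup>2) * indicator \<Omega> x \<partial>lborel)"
        by (rule nn_integral_completion)
      also have "\<dots> = (\<integral>\<^sup>+x. indicator \<Omega> x * ennreal ((indicator \<Omega> x * \<phi> n x - indicator \<Omega> x * u' x)\<^sup>2) \<partial>lborel)"
      proof (rule nn_integral_cong_AE)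
        show "AE x in lborel. ennreal ((\<phi> n x - u x)\<^sup>2) * indicator \<Omega> x
            = indicator \<Omega> x * ennreal ((indicator \<Omega> x * \<phi> n x - indicator \<Omega> x * u' x)\<^sup>2)"
          using uu' by eventually_elim (auto simp: indicator_def)
      qed
      also have "\<dots> = (\<integral>\<^sup>+x. ennreal ((indicator \<Omega> x * \<phi> n x - indicator \<Omega> x * u' x)\<^sup>2) \<partial>\<nu>)"
        unfolding \<nu>_def by (subst nn_integral_density) measurable
      finally show ?thesis .
    qed
    then show ?thesis using limu by simp
  qed
  have "AE x in \<nu>. x \<in> \<Omega> \<longrightarrow> c * u' x = green_potential \<mu> W x"
    by (rule rep[OF \<nu> s\<nu> growth\<nu> _ _ _ lim\<nu>]) (auto simp: unit_ball_vol_nonneg d_DIM \<nu>_def)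
  then have "AE x in lborel. x \<in> \<Omega> \<longrightarrow> c * u' x = green_potential \<mu> W x"
    unfolding \<nu>_def by (subst (asm) AE_density) (auto simp: indicator_def)
  with uu' have "AE x in lborel. x \<in> \<Omega> \<longrightarrow> (if x \<in> \<Omega> then green_potential \<mu> W x else 0) / c = u x"
    by eventually_elim (use c_pos in \<open>auto simp: field_simps\<close>)
  then have "AE x in lebesgue. x \<in> \<Omega> \<longrightarrow> (if x \<in> \<Omega> then green_potential \<mu> W x else 0) / c = u x"
    by (rule AE_completion)
  moreover have "continuous_on (closure \<Omega>) (\<lambda>x. (if x \<in> \<Omega> then green_potential \<mu> W x else 0) / c)"
    using cont c_pos by (intro continuous_on_divide continuous_on_const) auto
  ultimately show ?thesis by (intro exI[of _ "\<lambda>x. (if x \<in> \<Omega> then green_potential \<mu> W x else 0) / c"]) blast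
qed

end

theorem theorem1p2:
  fixes \<Omega> :: "'a::euclidean_space set" and \<mu> :: "'a measure"
  assumes "open \<Omega>" and "connected \<Omega>" and "bounded \<Omega>" and "\<Omega> \<noteq> {}"
    and "has_classical_green \<Omega>"
    and "sets \<mu> = sets borel" and "emeasure \<mu> (space \<mu>) < \<infinity>"
    and "msupp \<mu> \<subseteq> closure \<Omega>" and "emeasure \<mu> \<Omega> > 0"
    and "lower_Linf_dim \<mu> > ereal (real DIM('a) - 2)"
  shows "(\<forall>u lam. eigenfunction \<Omega> \<mu> u lam \<longrightarrow>
            (\<exists>v. continuous_on \<Omega> v \<and> (AE x in lebesgue. x \<in> \<Omega> \<longrightarrow> v x = u x)))
       \<and> (lipschitz_boundary \<Omega> \<longrightarrow>
           (\<forall>u lam. eigenfunction \<Omega> \<mu> u lam \<longrightarrow>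
            (\<exists>v. continuous_on (closure \<Omega>) v \<and> (AE x in lebesgue. x \<in> \<Omega> \<longrightarrow> v x = u x))))"
proof -
  have \<mu>: "finite_measure \<mu>" using assms(7) by (intro finite_measureI) simp
  obtain C Q where growth: "0 \<le> C" "real DIM('a) - 2 < Q"
    "\<And>y r. 0 < r \<Longrightarrow> emeasure \<mu> (ball y r) \<le> ennreal (C * r powr Q)"
    using ball_growth_of_lower_Linf_dim[OF \<mu> assms(6,9,10)] by blast
  obtain p \<kappa> where p: "\<kappa> > 0"
    "\<And>s. s > 0 \<Longrightarrow> (p has_real_derivative - (\<kappa> * s powr (- real DIM('a) / 2))) (at s)"
    "\<And>x::'a. x \<noteq> 0 \<Longrightarrow> fund_sol x = p (x \<bullet> x)"
    by (rule fund_sol_radial_profile[where 'a='a]) (rule that)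
  obtain G h where G: "\<forall>x\<in>\<Omega>. \<forall>y\<in>\<Omega>. x \<noteq> y \<longrightarrow> G x y = fund_sol (x - y) + h x y"
    and h: "\<forall>x\<in>\<Omega>. \<forall>y\<in>\<Omega>. h x y = h y x" "continuous_on (\<Omega> \<times> \<Omega>) (\<lambda>(x, y). h x y)"
      "\<forall>x\<in>\<Omega>. harmonic_on \<Omega> (\<lambda>y. h x y)"
    and bd: "\<forall>x\<in>\<Omega>. \<forall>z\<in>frontier \<Omega>. ((\<lambda>y. G x y) \<longlongrightarrow> 0) (at z within \<Omega>)"
    using assms(5) unfolding has_classical_green_def classical_green_def by blast
  obtain r where r: "r > 0" "\<And>x. x \<in> closure \<Omega> \<Longrightarrow> norm x \<le> r"
    using bounded_closure[OF assms(3)] bounded_pos by blast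
  \<comment> \<open>The closure lies in a ball of radius \<open>r\<close> about the origin, so
    squared distances are at most \<open>(2 * r)\<^sup>2\<close>.\<close>
  interpret green_function p \<kappa> "real DIM('a)" "TYPE('a)" \<Omega> h "(2 * r)\<^sup>2"
  proof unfold_locales
    show "(y - x) \<bullet> (y - x) \<le> (2 * r)\<^sup>2" if "x \<in> closure \<Omega>" "y \<in> closure \<Omega>" for x y
    proof -
      have "norm (y - x) \<le> 2 * r" using r(2)[OF that(1)] r(2)[OF that(2)] norm_triangle_ineq4[of y x] by linarith
      then show ?thesis unfolding dot_square_norm by (intro power_mono) auto
    qed
    show "((\<lambda>y. p ((y - x) \<bullet> (y - x)) + h x y) \<longlongrightarrow> 0) (at z within \<Omega>)" if x: "x \<in> \<Omega>" and z: "z \<in> frontier \<Omega>" for x z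
    proof (rule Lim_transform_eventually[OF bd[rule_format, OF x z]])
      have "z \<notin> \<Omega>" using z assms(1) by (simp add: frontier_def interior_open)
      then have "\<forall>\<^sub>F y in at z within \<Omega>. y \<noteq> x"
        using tendsto_imp_eventually_ne[OF tendsto_ident_at, of z x \<Omega>] x by auto
      moreover have "\<forall>\<^sub>F y in at z within \<Omega>. y \<in> \<Omega>" by (simp add: eventually_at_filter)
      ultimately show "\<forall>\<^sub>F y in at z within \<Omega>. G x y = p ((y - x) \<bullet> (y - x)) + h x y"
      proof eventually_elim
        case (elim y)
        have "(x - y) \<bullet> (x - y) = (y - x) \<bullet> (y - x)" by (simp add: inner_diff inner_commute)
        then show ?case using G x elim p(3)[of "x - y"] by auto
      qed
    qed
  qed (use assms p h r in auto)
  have main: "\<exists>v. continuous_on (closure \<Omega>) v \<and> (AE x in lebesgue. x \<in> \<Omega> \<longrightarrow> v x = u x)"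
    if "eigenfunction \<Omega> \<mu> u lam" for u lam
    by (rule eigenfunction_continuous_version[OF \<mu> assms(6) growth(3,2,1) that])
  then show ?thesis
    by (meson closure_subset continuous_on_subset)
qed

end
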